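(* Consider the equation $w_xE_x+w_yE_y+E(w_{xx}+w_{yy})=-1$ with $w=w(x,y)$ and $E=E(x,y)$ both dependent variables, and a nonclassical generator $\mathcal U=\xi\,\partial_x+\partial_y+\phi\,\partial_w+\psi\,\partial_E$ of this equation with $\xi=A(x,y)$ and $\phi=G(x,y,w)$. Suppose that $A=A(x,y)$ is a nonconstant function satisfying $$(A^4-1)A_{xx}+4A(A^2+1)A_{xy}-(A^4-1)A_{yy}-2A(A^2-3)A_x^2-4(3A^2-1)A_xA_y+2A(A^2-3)A_y^2=0,$$ and that $G(x,y,w)=u_y(A^2+1)S(u,w)$ with $u=u(x,y)$, where $u$ satisfies $u_x=A(x,y)u_y$ and $S=S(u,w)$ is a nonzero solution of $$q_1\,(S_{uw}S-S_uS_w+S_{uu})+q_2\,S_u+q_3\,S=0$$ (with $S$ and its derivatives evaluated at $u=u(x,y)$), where $$q_1=u_y^3(A^2+1)^3,$$ $$q_2=u_y(A^2+1)\left[3u_{yy}(A^2+1)^2+u_y\left(5A_x+3A^3A_y+3A^2A_x+AA_y\right)\right],$$ $$\begin{aligned}q_3={}&u_{yyy}(A^2+1)^3+u_{yy}(A^2+1)\left[(3A^2+5)A_x+(3A^2+1)AA_y\right]\\&+u_y\big[2A(A^2+1)A_{xx}+(A^2+1)(A^2+3)A_{xy}+A(A^2+1)^2A_{yy}\\&\qquad-2(A^2-3)A_x^2+2A(A^2-3)A_xA_y+(A^4-1)A_y^2\big].\end{aligned}$$ Then the nonclassical generator is $$\mathcal U=A\,\partial_x+\partial_y+u_y(A^2+1)S\,\partial_w+E\left(-u_y(A^2+1)S_w+\frac{2(A_x-AA_y)}{A^2+1}\right)\partial_E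 .$$
   Context: All functions are assumed real analytic on open domains, and $E\neq 0$. Put $F=w_xE_x+w_yE_y+E(w_{xx}+w_{yy})+1$ on the second-order jet space with independent variables $x,y$ and dependent variables $w,E$. For a vector field $\mathcal U=\xi\,\partial_x+\partial_y+\phi\,\partial_w+\psi\,\partial_E$ with $\xi,\phi,\psi$ functions of $(x,y,w,E)$ (the coefficient of $\partial_y$ is normalized to $1$), put $\phi_1=\xi w_x+w_y-\phi$ and $\phi_2=\xi E_x+E_y-\psi$. $\mathcal U$ is called a nonclassical generator (generator of a nonclassical equivalence transformation, or conditional symmetry) of the equation $F=0$ if $\mathrm{pr}^{(2)}\mathcal U(F)=0$, $\mathrm{pr}^{(1)}\mathcal U(\phi_1)=0$ and $\mathrm{pr}^{(1)}\mathcal U(\phi_2)=0$ at all jet points where $F=0$, $\phi_1=\phi_2=0$, and the total derivatives of $\phi_1,\phi_2$ with respect to $x$ and $y$ vanish. Here $\mathrm{pr}^{(n)}\mathcal U$ is the usual $n$-th prolongation ($x,y$ independent, $w,E$ dependent). A statement that "the nonclassical generator" with prescribed $\xi$ and $\phi$ is a given vector field means that this vector field is a nonclassical generator and is the one with those $\xi,\phi$. In the equation for $S$, the functions $q_1,q_2,q_3$ depend on $(x,y)$, the variable $w$ is independent of $(x,y)$, and the equation is required to hold for all $(x,y,w)$ in the domain. *)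

theory Defs
  imports "HOL-Analysis.Analysis"
begin

(* Real analyticity in several variables: near a, the function is the sum of an (absolutely
   convergent) power series in the coordinates of z - a.  The multi-indices are the functions
   Basis \<rightarrow>\<^sub>E UNIV into the naturals; for example, Basis = {(1,0), (0,1)} for real \<times> real. *)
definition real_analytic_at :: "('a::euclidean_space \<Rightarrow> real) \<Rightarrow> 'a \<Rightarrow> bool" where
  "real_analytic_at f a \<longleftrightarrow>
     (\<exists>r>0. \<exists>c :: ('a \<Rightarrow> nat) \<Rightarrow> real. \<forall>z\<in>ball a r.
        ((\<lambda>\<alpha>. c \<alpha> * (\<Prod>b\<in>Basis. ((z - a) \<bullet> b) ^ \<alpha> b)) has_sum f z) (Basis \<rightarrow>\<^sub>E UNIV))"

definition real_analytic_on :: "('a::euclidean_space \<Rightarrow> real) \<Rightarrow> 'a set \<Rightarrow> bool" where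
  "real_analytic_on f T \<longleftrightarrow> (\<forall>a\<in>T. real_analytic_at f a)"

definition d1 :: "(real \<Rightarrow> real \<Rightarrow> real) \<Rightarrow> real \<Rightarrow> real \<Rightarrow> real" where
  "d1 f x y = deriv (\<lambda>s. f s y) x"

definition d2 :: "(real \<Rightarrow> real \<Rightarrow> real) \<Rightarrow> real \<Rightarrow> real \<Rightarrow> real" where
  "d2 f x y = deriv (\<lambda>t. f x t) y"

section \<open>The second-order jet space and prolongations\<close>

datatype coord = X | Y | W | E | Wx | Wy | Ex | Ey | Wxx | Wxy | Wyy | Exx | Exy | Eyy

type_synonym jet = "coord \<Rightarrow> real"

definition pd :: "coord \<Rightarrow> (jet \<Rightarrow> real) \<Rightarrow> jet \<Rightarrow> real" where
  "pd c f j = deriv (\<lambda>t. f (j(c := t))) (j c)"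

(* Total derivatives, truncated so as to stay inside the second-order jet space: they are
   the full total derivatives only of functions of the coordinates of order at most one,
   and are only applied to such functions. *)
definition Dx :: "(jet \<Rightarrow> real) \<Rightarrow> jet \<Rightarrow> real" where
  "Dx f j = pd X f j + j Wx * pd W f j + j Ex * pd E f j
     + j Wxx * pd Wx f j + j Wxy * pd Wy f j + j Exx * pd Ex f j + j Exy * pd Ey f j"

definition Dy :: "(jet \<Rightarrow> real) \<Rightarrow> jet \<Rightarrow> real" where
  "Dy f j = pd Y f j + j Wy * pd W f j + j Ey * pd E f j
     + j Wxy * pd Wx f j + j Wyy * pd Wy f j + j Exy * pd Ex f j + j Eyy * pd Ey f j"

(* The recursion for prolongation coefficients: if \<theta> is the coefficient of \<partial>/\<partial>v, for a jet
   coordinate v with x- and y-derivatives vx and vy, then the coefficient of the coordinate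
   D v (D = Dx or Dy) is D \<theta> - (D \<xi>) vx - (D \<eta>) vy. *)
definition prol ::
  "((jet \<Rightarrow> real) \<Rightarrow> jet \<Rightarrow> real) \<Rightarrow> (jet \<Rightarrow> real) \<Rightarrow> (jet \<Rightarrow> real) \<Rightarrow> coord \<Rightarrow> coord
     \<Rightarrow> (jet \<Rightarrow> real) \<Rightarrow> jet \<Rightarrow> real" where
  "prol D \<xi> \<eta> vx vy \<theta> j = D \<theta> j - D \<xi> j * j vx - D \<eta> j * j vy"

(* First and second prolongations of \<xi> \<partial>x + \<eta> \<partial>y + \<phi> \<partial>w + \<psi> \<partial>E, applied to f;
   pr1 is meant for f of order at most one. *)
definition pr1 ::
  "(jet \<Rightarrow> real) \<Rightarrow> (jet \<Rightarrow> real) \<Rightarrow> (jet \<Rightarrow> real) \<Rightarrow> (jet \<Rightarrow> real) \<Rightarrow> (jet \<Rightarrow> real) \<Rightarrow> jet \<Rightarrow> real" where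
  "pr1 \<xi> \<eta> \<phi> \<psi> f j =
     \<xi> j * pd X f j + \<eta> j * pd Y f j + \<phi> j * pd W f j + \<psi> j * pd E f j
     + prol Dx \<xi> \<eta> Wx Wy \<phi> j * pd Wx f j + prol Dy \<xi> \<eta> Wx Wy \<phi> j * pd Wy f j
     + prol Dx \<xi> \<eta> Ex Ey \<psi> j * pd Ex f j + prol Dy \<xi> \<eta> Ex Ey \<psi> j * pd Ey f j"

definition pr2 ::
  "(jet \<Rightarrow> real) \<Rightarrow> (jet \<Rightarrow> real) \<Rightarrow> (jet \<Rightarrow> real) \<Rightarrow> (jet \<Rightarrow> real) \<Rightarrow> (jet \<Rightarrow> real) \<Rightarrow> jet \<Rightarrow> real" where
  "pr2 \<xi> \<eta> \<phi> \<psi> f j =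
     pr1 \<xi> \<eta> \<phi> \<psi> f j
     + prol Dx \<xi> \<eta> Wxx Wxy (prol Dx \<xi> \<eta> Wx Wy \<phi>) j * pd Wxx f j
     + prol Dy \<xi> \<eta> Wxx Wxy (prol Dx \<xi> \<eta> Wx Wy \<phi>) j * pd Wxy f j
     + prol Dy \<xi> \<eta> Wxy Wyy (prol Dy \<xi> \<eta> Wx Wy \<phi>) j * pd Wyy f j
     + prol Dx \<xi> \<eta> Exx Exy (prol Dx \<xi> \<eta> Ex Ey \<psi>) j * pd Exx f j
     + prol Dy \<xi> \<eta> Exx Exy (prol Dx \<xi> \<eta> Ex Ey \<psi>) j * pd Exy f j
     + prol Dy \<xi> \<eta> Exy Eyy (prol Dy \<xi> \<eta> Ex Ey \<psi>) j * pd Eyy f j"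

section \<open>Nonclassical generators\<close>

definition F :: "jet \<Rightarrow> real" where
  "F j = j Wx * j Ex + j Wy * j Ey + j E * (j Wxx + j Wyy) + 1"

definition lift :: "(real \<Rightarrow> real \<Rightarrow> real \<Rightarrow> real \<Rightarrow> real) \<Rightarrow> jet \<Rightarrow> real" where
  "lift c j = c (j X) (j Y) (j W) (j E)"

definition \<phi>1 ::
  "(real \<Rightarrow> real \<Rightarrow> real \<Rightarrow> real \<Rightarrow> real) \<Rightarrow> (real \<Rightarrow> real \<Rightarrow> real \<Rightarrow> real \<Rightarrow> real) \<Rightarrow> jet \<Rightarrow> real" where
  "\<phi>1 \<xi> \<phi> j = lift \<xi> j * j Wx + j Wy - lift \<phi> j"

definition \<phi>2 ::
  "(real \<Rightarrow> real \<Rightarrow> real \<Rightarrow> real \<Rightarrow> real) \<Rightarrow> (real \<Rightarrow> real \<Rightarrow> real \<Rightarrow> real \<Rightarrow> real) \<Rightarrow> jet \<Rightarrow> real" where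
  "\<phi>2 \<xi> \<psi> j = lift \<xi> j * j Ex + j Ey - lift \<psi> j"

(* \<xi> \<partial>x + \<partial>y + \<phi> \<partial>w + \<psi> \<partial>E, with coefficients analytic on the set \<Omega> of points (x, y, w, E),
   is a nonclassical generator of F = 0; the jet points are those lying over \<Omega>. *)
definition nonclassical_generator ::
  "(real \<times> real \<times> real \<times> real) set
     \<Rightarrow> (real \<Rightarrow> real \<Rightarrow> real \<Rightarrow> real \<Rightarrow> real)
     \<Rightarrow> (real \<Rightarrow> real \<Rightarrow> real \<Rightarrow> real \<Rightarrow> real)
     \<Rightarrow> (real \<Rightarrow> real \<Rightarrow> real \<Rightarrow> real \<Rightarrow> real) \<Rightarrow> bool" where
  "nonclassical_generator \<Omega> \<xi> \<phi> \<psi> \<longleftrightarrow>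
     real_analytic_on (\<lambda>(x, y, w, e). \<xi> x y w e) \<Omega> \<and>
     real_analytic_on (\<lambda>(x, y, w, e). \<phi> x y w e) \<Omega> \<and>
     real_analytic_on (\<lambda>(x, y, w, e). \<psi> x y w e) \<Omega> \<and>
     (\<forall>j. (j X, j Y, j W, j E) \<in> \<Omega> \<and> F j = 0 \<and>
          \<phi>1 \<xi> \<phi> j = 0 \<and> \<phi>2 \<xi> \<psi> j = 0 \<and>
          Dx (\<phi>1 \<xi> \<phi>) j = 0 \<and> Dy (\<phi>1 \<xi> \<phi>) j = 0 \<and>
          Dx (\<phi>2 \<xi> \<psi>) j = 0 \<and> Dy (\<phi>2 \<xi> \<psi>) j = 0
        \<longrightarrow>
          pr2 (lift \<xi>) (\<lambda>_. 1) (lift \<phi>) (lift \<psi>) F j = 0 \<and>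
          pr1 (lift \<xi>) (\<lambda>_. 1) (lift \<phi>) (lift \<psi>) (\<phi>1 \<xi> \<phi>) j = 0 \<and>
          pr1 (lift \<xi>) (\<lambda>_. 1) (lift \<phi>) (lift \<psi>) (\<phi>2 \<xi> \<psi>) j = 0)"

section \<open>The coefficients of the equation for S\<close>

definition q1 :: "(real \<Rightarrow> real \<Rightarrow> real) \<Rightarrow> (real \<Rightarrow> real \<Rightarrow> real) \<Rightarrow> real \<Rightarrow> real \<Rightarrow> real" where
  "q1 A u x y = (d2 u x y)^3 * ((A x y)^2 + 1)^3"

definition q2 :: "(real \<Rightarrow> real \<Rightarrow> real) \<Rightarrow> (real \<Rightarrow> real \<Rightarrow> real) \<Rightarrow> real \<Rightarrow> real \<Rightarrow> real" where
  "q2 A u x y =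
    (let a = A x y; ax = d1 A x y; ay = d2 A x y;
         uy = d2 u x y; uyy = d2 (d2 u) x y
     in uy * (a^2 + 1) *
          (3 * uyy * (a^2 + 1)^2 + uy * (5 * ax + 3 * a^3 * ay + 3 * a^2 * ax + a * ay)))"

definition q3 :: "(real \<Rightarrow> real \<Rightarrow> real) \<Rightarrow> (real \<Rightarrow> real \<Rightarrow> real) \<Rightarrow> real \<Rightarrow> real \<Rightarrow> real" where
  "q3 A u x y =
    (let a = A x y; ax = d1 A x y; ay = d2 A x y;
         axx = d1 (d1 A) x y; axy = d2 (d1 A) x y; ayy = d2 (d2 A) x y;
         uy = d2 u x y; uyy = d2 (d2 u) x y; uyyy = d2 (d2 (d2 u)) x y
     in uyyy * (a^2 + 1)^3
        + uyy * (a^2 + 1) * ((3 * a^2 + 5) * ax + (3 * a^2 + 1) * a * ay)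
        + uy * (2 * a * (a^2 + 1) * axx + (a^2 + 1) * (a^2 + 3) * axy + a * (a^2 + 1)^2 * ayy
                - 2 * (a^2 - 3) * ax^2 + 2 * a * (a^2 - 3) * ax * ay + (a^4 - 1) * ay^2))"

end

theory Submission
  imports Defs
begin

text \<open>
  On the invariant surfaces \<open>\<phi>1 = \<phi>2 = 0\<close> all derivatives except \<open>p = w\<^sub>x\<close>, \<open>r = E\<^sub>x\<close> and \<open>w\<^sub>x\<^sub>x\<close>
  are determined, and the second derivatives of \<open>w\<close> enter the invariance condition only through
  \<open>\<kappa> = w\<^sub>x\<^sub>x + w\<^sub>y\<^sub>y\<close>, which \<open>F = 0\<close> turns into \<open>- (1 + p r + w\<^sub>y E\<^sub>y) / E\<close>. What remains is a
  polynomial in \<open>p\<close> and \<open>r\<close>. With \<open>\<sigma> = 2 (A\<^sub>x - A A\<^sub>y) / (A\<^sup>2 + 1)\<close> the coefficient of \<open>\<kappa>\<close> is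
  \<open>\<psi> + E \<phi>\<^sub>w - E \<sigma>\<close>, which vanishes for the asserted \<open>\<psi>\<close>; the coefficient of \<open>p\<close> is then
  \<open>- E / (A\<^sup>2 + 1)\<^sup>2\<close> times the equation for \<open>A\<close>, the constant coefficient is \<open>E / (A\<^sup>2 + 1)\<close> times
  the equation for \<open>S\<close>, and the other coefficients vanish identically. Conversely, for an unknown
  \<open>\<psi>\<close> the coefficient of \<open>p r\<close> says that \<open>\<psi>\<close> is locally linear in \<open>E\<close>, and then the part of the
  constant coefficient independent of \<open>E\<close>, which comes from the summand \<open>1\<close> of \<open>F\<close>, determines \<open>\<psi>\<close>.

  That the coefficients of the vector field are analytic and sufficiently differentiable rests on
  closure properties of real analytic functions. They are obtained from absolutely convergent power
  series with a bound \<open>M\<close> on \<open>\<Sum> \<bar>c\<^sub>\<alpha>\<bar> r\<^bsup>\<bar>\<alpha>\<bar>\<^esup>\<close>: these bounds are submultiplicative, so products,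
  compositions and reciprocals reduce to a single statement on absolutely convergent sums of such series.
\<close>

section \<open>Absolutely convergent power series in several variables\<close>

abbreviation multi_indices :: "('a::euclidean_space \<Rightarrow> nat) set" where
  "multi_indices \<equiv> Basis \<rightarrow>\<^sub>E UNIV"

definition mon :: "('a::euclidean_space \<Rightarrow> nat) \<Rightarrow> 'a \<Rightarrow> real" where
  "mon \<alpha> v = (\<Prod>b\<in>Basis. (v \<bullet> b) ^ \<alpha> b)"

definition mdeg :: "('a::euclidean_space \<Rightarrow> nat) \<Rightarrow> nat" where
  "mdeg \<alpha> = (\<Sum>b\<in>Basis. \<alpha> b)"

text \<open>\<open>M\<close> bounds the weighted l1 norm of the coefficients. The Euclidean ball of
  radius \<open>r\<close> lies in the polydisc of radius \<open>r\<close>, so \<open>M\<close> also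
  bounds the values on the ball. The inequality \<open>s \<le> M\<close> leaves room to enlarge the
  bound.\<close>

definition pseries ::
  "(('a::euclidean_space \<Rightarrow> nat) \<Rightarrow> real) \<Rightarrow> ('a \<Rightarrow> real) \<Rightarrow> 'a \<Rightarrow> real \<Rightarrow> real \<Rightarrow> bool" where
  "pseries c f a r M \<longleftrightarrow> r > 0
     \<and> (\<exists>s\<le>M. ((\<lambda>\<alpha>. \<bar>c \<alpha>\<bar> * r ^ mdeg \<alpha>) has_sum s) multi_indices)
     \<and> (\<forall>z\<in>ball a r. ((\<lambda>\<alpha>. c \<alpha> * mon \<alpha> (z - a)) has_sum f z) multi_indices)"

definition has_pseries :: "('a::euclidean_space \<Rightarrow> real) \<Rightarrow> 'a \<Rightarrow> real \<Rightarrow> real \<Rightarrow> bool" where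
  "has_pseries f a r M \<longleftrightarrow> (\<exists>c. pseries c f a r M)"

lemma abs_mon_le:
  assumes "norm v \<le> r"
  shows "\<bar>mon \<alpha> v\<bar> \<le> r ^ mdeg \<alpha>"
proof -
  have "\<bar>mon \<alpha> v\<bar> = (\<Prod>b\<in>Basis. \<bar>v \<bullet> b\<bar> ^ \<alpha> b)"
    by (simp add: mon_def abs_prod power_abs)
  also have "\<dots> \<le> (\<Prod>b\<in>Basis. r ^ \<alpha> b)"
    using assms by (intro prod_mono conjI power_mono) (auto intro: order_trans[OF Basis_le_norm])
  also have "\<dots> = r ^ mdeg \<alpha>"
    by (simp add: mdeg_def power_sum)
  finally show ?thesis .
qed

lemma mon_diagonal: "mon \<alpha> (s *\<^sub>R (\<Sum>b\<in>Basis. b)) = s ^ mdeg \<alpha>"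
proof -
  have "mon \<alpha> (s *\<^sub>R (\<Sum>b\<in>Basis. b)) = (\<Prod>b\<in>Basis. s ^ \<alpha> b)"
    unfolding mon_def by (intro prod.cong) (simp_all add: inner_sum_left inner_Basis if_distrib sum.delta cong: if_cong)
  then show ?thesis
    by (simp add: mdeg_def power_sum)
qed

text \<open>Members of \<open>multi_indices\<close> are \<open>undefined\<close> off
  \<open>Basis\<close>, so a pointwise sum of two of them need not be one. Restricting it repairs
  this and changes neither monomial nor degree.\<close>

lemma mon_restrict [simp]: "mon (restrict \<alpha> Basis) v = mon \<alpha> v"
  by (simp add: mon_def)

lemma mdeg_restrict [simp]: "mdeg (restrict \<alpha> Basis) = mdeg \<alpha>"
  by (simp add: mdeg_def)

lemma mon_add: "mon (\<lambda>b. \<alpha> b + \<beta> b) v = mon \<alpha> v * mon \<beta> v"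
  by (simp add: mon_def power_add prod.distrib)

lemma mdeg_add: "mdeg (\<lambda>b. \<alpha> b + \<beta> b) = mdeg \<alpha> + mdeg \<beta>"
  by (simp add: mdeg_def sum.distrib)

section \<open>Absolute summability and regrouping of series\<close>

lemma real_has_sum_abs_summable:
  fixes f :: "'i \<Rightarrow> real"
  assumes "(f has_sum s) I"
  shows "(\<lambda>i. \<bar>f i\<bar>) summable_on I"
  using has_sum_imp_summable[OF assms] summable_on_iff_abs_summable_on_real[of f I] by simp

lemma real_summable_abs_comparison:
  fixes f g :: "'i \<Rightarrow> real"
  assumes "g summable_on I" and "\<And>i. i \<in> I \<Longrightarrow> \<bar>f i\<bar> \<le> g i"
  shows "f summable_on I"
proof -
  have "(\<lambda>i. norm (f i)) summable_on I"
    by (rule Infinite_Sum.abs_summable_on_comparison_test'[OF assms(1)]) (use assms(2) in auto)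
  then show ?thesis
    using summable_on_iff_abs_summable_on_real[of f I] by simp
qed

lemma real_analytic_atI:
  assumes "has_pseries f a r M"
  shows "real_analytic_at f a"
  using assms unfolding has_pseries_def pseries_def real_analytic_at_def mon_def by blast

text \<open>Evaluating the series on the diagonal ray, where every monomial is a power of the
  parameter, bounds the coefficients.\<close>

lemma real_analytic_atE:
  assumes "real_analytic_at f a"
  obtains r M where "has_pseries f a r M"
proof -
  obtain r c where r: "r > 0" and c: "\<And>z. z \<in> ball a r \<Longrightarrow>
      ((\<lambda>\<alpha>. c \<alpha> * mon \<alpha> (z - a)) has_sum f z) multi_indices"
    using assms unfolding real_analytic_at_def mon_def by blast
  define e :: 'a where "e = (\<Sum>b\<in>Basis. b)"
  define s where "s = r / (norm e + 1) / 2"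
  have s: "s > 0" "s \<le> r" "s * norm e < r"
  proof -
    have n: "norm e + 1 > 0"
      by (smt (verit) norm_ge_zero)
    show "s > 0"
      using r n by (simp add: s_def)
    have "r \<le> r * (norm e + 1) * 2"
    proof -
      have "r * 1 \<le> r * ((norm e + 1) * 2)"
        using r by (intro mult_left_mono) (auto simp: add.commute intro: order_trans[of _ "2 + norm e * 2"])
      then show ?thesis by (simp add: mult.assoc)
    qed
    then show "s \<le> r"
      using n by (simp add: s_def field_simps)
    have "s * norm e \<le> s * (norm e + 1)"
      using \<open>s > 0\<close> by (intro mult_left_mono) auto
    also have "\<dots> = r / 2"
      using n by (simp add: s_def field_simps)
    also have "\<dots> < r"
      using r by simp
    finally show "s * norm e < r" .
  qed
  have "a + s *\<^sub>R e \<in> ball a r"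
    using s by (simp add: dist_norm)
  from c[OF this] have "((\<lambda>\<alpha>. c \<alpha> * s ^ mdeg \<alpha>) has_sum f (a + s *\<^sub>R e)) multi_indices"
    by (simp add: e_def mon_diagonal)
  from real_has_sum_abs_summable[OF this]
  have "(\<lambda>\<alpha>. \<bar>c \<alpha>\<bar> * s ^ mdeg \<alpha>) summable_on multi_indices"
    using s by (simp add: abs_mult)
  then obtain t where "((\<lambda>\<alpha>. \<bar>c \<alpha>\<bar> * s ^ mdeg \<alpha>) has_sum t) multi_indices"
    by (auto simp: summable_on_def)
  moreover have "ball a s \<subseteq> ball a r"
    using s by (intro subset_ball)
  ultimately have "pseries c f a s t"
    using s c unfolding pseries_def by blast
  then show thesis
    using that unfolding has_pseries_def by blast
qed

lemma has_pseries_pos: "has_pseries f a r M \<Longrightarrow> r > 0"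
  by (auto simp: has_pseries_def pseries_def)

lemma has_pseries_bound:
  assumes "has_pseries f a r M" and "z \<in> ball a r"
  shows "\<bar>f z\<bar> \<le> M"
proof -
  obtain c s where "s \<le> M" and s: "((\<lambda>\<alpha>. \<bar>c \<alpha>\<bar> * r ^ mdeg \<alpha>) has_sum s) multi_indices"
    and f: "((\<lambda>\<alpha>. c \<alpha> * mon \<alpha> (z - a)) has_sum f z) multi_indices"
    using assms unfolding has_pseries_def pseries_def by blast
  have "norm (f z) \<le> s"
    by (rule norm_infsum_le[OF f s])
       (use assms(2) in \<open>auto simp: abs_mult dist_norm norm_minus_commute intro!: mult_left_mono abs_mon_le\<close>)
  then show ?thesis
    using \<open>s \<le> M\<close> by simp
qed

lemma has_pseries_nonneg: "has_pseries f a r M \<Longrightarrow> M \<ge> 0"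
  using has_pseries_bound[of f a r M a] has_pseries_pos[of f a r M] by fastforce

text \<open>A series indexed by an arbitrary set is brought into normal form by collecting the
  terms with the same monomial.\<close>

lemma has_pseries_regroup:
  fixes m :: "'i \<Rightarrow> 'a::euclidean_space \<Rightarrow> nat"
  assumes r: "r > 0" and s: "((\<lambda>i. \<bar>c i\<bar> * r ^ mdeg (m i)) has_sum s) I" and "s \<le> M"
    and f: "\<And>z. z \<in> ball a r \<Longrightarrow> ((\<lambda>i. c i * mon (m i) (z - a)) has_sum f z) I"
  shows "has_pseries f a r M"
proof -
  \<comment> \<open>\<open>p\<close> normalises the index of a term. Its fibres \<open>J\<close>
    partition \<open>I\<close>, so a sum over \<open>I\<close> becomes an iterated sum over the
    fibres.\<close>
  define p where "p i = restrict (m i) Basis" for i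
  define J where "J \<alpha> = {i\<in>I. p i = \<alpha>}" for \<alpha>
  define d where "d \<alpha> = infsum c (J \<alpha>)" for \<alpha>
  have bij: "bij_betw snd (Sigma multi_indices J) I"
    by (rule bij_betwI[where g = "\<lambda>i. (p i, i)"]) (auto simp: J_def p_def)
  have sig: "((\<lambda>(\<alpha>, i). h i) has_sum x) (Sigma multi_indices J)"
    if "(h has_sum x) I" for h :: "'i \<Rightarrow> real" and x
    using that has_sum_reindex_bij_betw[OF bij, of h x] by (simp add: case_prod_unfold)
  have m: "mdeg (m i) = mdeg \<alpha>" "mon (m i) v = mon \<alpha> v" if "i \<in> J \<alpha>" for i \<alpha> v
    using that mdeg_restrict[of "m i"] mon_restrict[of "m i" v] unfolding J_def p_def by auto
  have abs: "(\<lambda>i. \<bar>c i\<bar>) summable_on J \<alpha>" for \<alpha>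
  proof -
    have "(\<lambda>i. \<bar>c i\<bar> * r ^ mdeg (m i)) summable_on J \<alpha>"
      by (rule summable_on_subset[OF has_sum_imp_summable[OF s]]) (auto simp: J_def)
    then have "(\<lambda>i. \<bar>c i\<bar> * r ^ mdeg \<alpha>) summable_on J \<alpha>"
      by (rule summable_on_cong[THEN iffD1, rotated]) (simp add: m)
    \<comment> \<open>The power of \<open>r\<close> is constant on a fibre and can be divided
      out.\<close>
    then have "(\<lambda>i. \<bar>c i\<bar> * r ^ mdeg \<alpha> * (1 / r ^ mdeg \<alpha>)) summable_on J \<alpha>"
      by (rule summable_on_cmult_left)
    then show ?thesis
      using r by simp
  qed
  have d: "(c has_sum d \<alpha>) (J \<alpha>)" for \<alpha>
    unfolding d_def by (rule has_sum_infsum, rule real_summable_abs_comparison[OF abs]) simp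
  have D: "((\<lambda>i. \<bar>c i\<bar>) has_sum infsum (\<lambda>i. \<bar>c i\<bar>) (J \<alpha>)) (J \<alpha>)" for \<alpha>
    by (rule has_sum_infsum[OF abs])
  have tot: "((\<lambda>\<alpha>. infsum (\<lambda>i. \<bar>c i\<bar>) (J \<alpha>) * r ^ mdeg \<alpha>) has_sum s) multi_indices"
  proof (rule has_sum_Sigma'[OF sig[OF s]])
    fix \<alpha>
    have "((\<lambda>i. \<bar>c i\<bar> * r ^ mdeg \<alpha>) has_sum infsum (\<lambda>i. \<bar>c i\<bar>) (J \<alpha>) * r ^ mdeg \<alpha>) (J \<alpha>)"
      by (rule has_sum_cmult_left[OF D])
    then show "((\<lambda>i. case (\<alpha>, i) of (\<alpha>, i) \<Rightarrow> \<bar>c i\<bar> * r ^ mdeg (m i)) has_sum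
        infsum (\<lambda>i. \<bar>c i\<bar>) (J \<alpha>) * r ^ mdeg \<alpha>) (J \<alpha>)"
      by (rule has_sum_cong[THEN iffD1, rotated]) (simp add: m)
  qed
  have le: "\<bar>d \<alpha>\<bar> \<le> infsum (\<lambda>i. \<bar>c i\<bar>) (J \<alpha>)" for \<alpha>
    using norm_infsum_le[OF d D, of \<alpha>] by simp
  have dsum: "(\<lambda>\<alpha>. \<bar>d \<alpha>\<bar> * r ^ mdeg \<alpha>) summable_on multi_indices"
    by (rule summable_on_comparison_test[OF has_sum_imp_summable[OF tot]])
       (use r le in \<open>auto intro!: mult_right_mono\<close>)
  have "infsum (\<lambda>\<alpha>. \<bar>d \<alpha>\<bar> * r ^ mdeg \<alpha>) multi_indices \<le> s"
    by (rule has_sum_mono[OF has_sum_infsum[OF dsum] tot]) (use r le in \<open>auto intro!: mult_right_mono\<close>)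
  moreover have "((\<lambda>\<alpha>. d \<alpha> * mon \<alpha> (z - a)) has_sum f z) multi_indices" if "z \<in> ball a r" for z
  proof (rule has_sum_Sigma'[OF sig[OF f[OF that]]])
    fix \<alpha>
    have "((\<lambda>i. c i * mon \<alpha> (z - a)) has_sum d \<alpha> * mon \<alpha> (z - a)) (J \<alpha>)"
      by (rule has_sum_cmult_left[OF d])
    then show "((\<lambda>i. case (\<alpha>, i) of (\<alpha>, i) \<Rightarrow> c i * mon (m i) (z - a)) has_sum
        d \<alpha> * mon \<alpha> (z - a)) (J \<alpha>)"
      by (rule has_sum_cong[THEN iffD1, rotated]) (simp add: m)
  qed
  ultimately have "pseries d f a r M"
    unfolding pseries_def using r \<open>s \<le> M\<close> has_sum_infsum[OF dsum] by (meson order_trans)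
  then show ?thesis
    unfolding has_pseries_def by blast
qed

text \<open>The double family over \<open>K\<close> and the multi-indices is absolutely summable,
  since the norms of the \<open>G k\<close> are dominated by the summable \<open>B\<close>; it may
  therefore be regrouped by monomials. Products, reciprocals and compositions are obtained as
  instances.\<close>

lemma has_pseries_sum:
  assumes r: "r > 0"
    and fk: "\<And>k. k \<in> K \<Longrightarrow> has_pseries (G k) a r (B k)"
    and B: "(B has_sum M) K"
    and f: "\<And>z. z \<in> ball a r \<Longrightarrow> ((\<lambda>k. G k z) has_sum f z) K"
  shows "has_pseries f a r M"
proof -
  have "\<forall>k\<in>K. \<exists>c. pseries c (G k) a r (B k)"
    using fk unfolding has_pseries_def by blast
  from bchoice[OF this] obtain c where c: "\<And>k. k \<in> K \<Longrightarrow> pseries (c k) (G k) a r (B k)"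
    by blast
  then have "\<forall>k\<in>K. \<exists>s\<le>B k. ((\<lambda>\<alpha>. \<bar>c k \<alpha>\<bar> * r ^ mdeg \<alpha>) has_sum s) multi_indices"
    and G: "\<And>k z. k \<in> K \<Longrightarrow> z \<in> ball a r \<Longrightarrow>
       ((\<lambda>\<alpha>. c k \<alpha> * mon \<alpha> (z - a)) has_sum G k z) multi_indices"
    unfolding pseries_def by blast+
  \<comment> \<open>The \<open>s k\<close> are the exact norms. They are only dominated by the
    \<open>B k\<close>, and their summability follows by comparison.\<close>
  from bchoice[OF this(1)] obtain s where le: "\<And>k. k \<in> K \<Longrightarrow> s k \<le> B k"
    and s: "\<And>k. k \<in> K \<Longrightarrow> ((\<lambda>\<alpha>. \<bar>c k \<alpha>\<bar> * r ^ mdeg \<alpha>) has_sum s k) multi_indices"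
    by blast
  have s0: "s k \<ge> 0" if "k \<in> K" for k
    by (rule has_sum_nonneg[OF s[OF that]]) (use r in auto)
  have ssum: "s summable_on K"
    by (rule summable_on_comparison_test[OF has_sum_imp_summable[OF B]]) (use le s0 in auto)
  define S where "S = infsum s K"
  have sS: "(s has_sum S) K"
    unfolding S_def by (rule has_sum_infsum[OF ssum])
  have "S \<le> M"
    by (rule has_sum_mono[OF sS B]) (rule le)
  have abs_sum: "(\<lambda>(k, \<alpha>). \<bar>c k \<alpha>\<bar> * r ^ mdeg \<alpha>) summable_on (Sigma K (\<lambda>_. multi_indices))"
    by (rule summable_on_SigmaI[OF _ ssum]) (use s r in auto)
  have abs_has: "((\<lambda>(k, \<alpha>). \<bar>c k \<alpha>\<bar> * r ^ mdeg \<alpha>) has_sum S) (Sigma K (\<lambda>_. multi_indices))"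
    by (rule has_sum_SigmaI[OF _ sS abs_sum]) (use s in auto)
  show ?thesis
  proof (rule has_pseries_regroup[OF r _ \<open>S \<le> M\<close>, where m = snd and c = "\<lambda>(k, \<alpha>). c k \<alpha>"])
    show "((\<lambda>i. \<bar>case i of (k, \<alpha>) \<Rightarrow> c k \<alpha>\<bar> * r ^ mdeg (snd i)) has_sum S)
        (Sigma K (\<lambda>_. multi_indices))"
      using abs_has by (simp add: case_prod_unfold)
    fix z assume z: "z \<in> ball a r"
    show "((\<lambda>i. (case i of (k, \<alpha>) \<Rightarrow> c k \<alpha>) * mon (snd i) (z - a)) has_sum f z)
        (Sigma K (\<lambda>_. multi_indices))"
    proof (rule has_sum_SigmaI[OF _ f[OF z]])
      show "(\<lambda>i. (case i of (k, \<alpha>) \<Rightarrow> c k \<alpha>) * mon (snd i) (z - a)) summable_on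
          (Sigma K (\<lambda>_. multi_indices))"
        by (rule real_summable_abs_comparison[OF abs_sum])
           (use z in \<open>auto simp: abs_mult dist_norm norm_minus_commute intro!: mult_left_mono abs_mon_le\<close>)
    qed (use G z in auto)
  qed
qed

section \<open>Arithmetic of power series with norm bounds\<close>

lemma has_pseries_mono:
  assumes "has_pseries f a r M" and "0 < r'" and "r' \<le> r" and "M \<le> M'"
  shows "has_pseries f a r' M'"
proof -
  obtain c s where sM: "s \<le> M" and s: "((\<lambda>\<alpha>. \<bar>c \<alpha>\<bar> * r ^ mdeg \<alpha>) has_sum s) multi_indices"
    and f: "\<And>z. z \<in> ball a r \<Longrightarrow> ((\<lambda>\<alpha>. c \<alpha> * mon \<alpha> (z - a)) has_sum f z) multi_indices"
    using assms(1) unfolding has_pseries_def pseries_def by blast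
  have le: "\<bar>c \<alpha>\<bar> * r' ^ mdeg \<alpha> \<le> \<bar>c \<alpha>\<bar> * r ^ mdeg \<alpha>" for \<alpha>
    using assms by (intro mult_left_mono power_mono) auto
  have sum': "(\<lambda>\<alpha>. \<bar>c \<alpha>\<bar> * r' ^ mdeg \<alpha>) summable_on multi_indices"
    by (rule summable_on_comparison_test[OF has_sum_imp_summable[OF s]]) (use le assms in auto)
  have "infsum (\<lambda>\<alpha>. \<bar>c \<alpha>\<bar> * r' ^ mdeg \<alpha>) multi_indices \<le> s"
    by (rule has_sum_mono[OF has_sum_infsum[OF sum'] s]) (rule le)
  then have "pseries c f a r' M'"
    unfolding pseries_def using assms sM has_sum_infsum[OF sum'] f
    by (intro conjI exI[of _ "infsum (\<lambda>\<alpha>. \<bar>c \<alpha>\<bar> * r' ^ mdeg \<alpha>) multi_indices"]) auto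
  then show ?thesis
    unfolding has_pseries_def by blast
qed

text \<open>Regrouping a one-term series also normalises \<open>\<alpha>\<close>, which need not
  vanish or be \<open>undefined\<close> off \<open>Basis\<close>.\<close>

lemma has_pseries_scaled_mon:
  assumes "r > 0"
  shows "has_pseries (\<lambda>z. k * mon \<alpha> (z - a)) a r (\<bar>k\<bar> * r ^ mdeg \<alpha>)"
  by (rule has_pseries_regroup[OF assms, where c = "\<lambda>_. k" and m = "\<lambda>_. \<alpha>" and I = "{()}"
        and s = "\<bar>k\<bar> * r ^ mdeg \<alpha>"])
     (auto intro!: has_sum_finiteI)

lemma has_pseries_const:
  assumes "r > 0"
  shows "has_pseries (\<lambda>_. k) a r \<bar>k\<bar>"
  using has_pseries_scaled_mon[OF assms, of k "\<lambda>_. 0" a] by (simp add: mon_def mdeg_def)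

text \<open>A sum of two series is a family indexed by \<open>bool\<close>.\<close>

lemma has_pseries_add:
  assumes "has_pseries f a r M" and "has_pseries g a r N"
  shows "has_pseries (\<lambda>z. f z + g z) a r (M + N)"
  by (rule has_pseries_sum[OF has_pseries_pos[OF assms(1)], where K = UNIV
        and G = "\<lambda>b. if b then f else g" and B = "\<lambda>b. if b then M else N"])
     (use assms in \<open>auto intro!: has_sum_finiteI simp: UNIV_bool\<close>)

lemma has_pseries_mult_mon:
  assumes "has_pseries f a r M"
  shows "has_pseries (\<lambda>z. k * mon \<beta> (z - a) * f z) a r (\<bar>k\<bar> * r ^ mdeg \<beta> * M)"
proof -
  obtain c s where sM: "s \<le> M" and s: "((\<lambda>\<alpha>. \<bar>c \<alpha>\<bar> * r ^ mdeg \<alpha>) has_sum s) multi_indices"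
    and f: "\<And>z. z \<in> ball a r \<Longrightarrow> ((\<lambda>\<alpha>. c \<alpha> * mon \<alpha> (z - a)) has_sum f z) multi_indices"
    using assms(1) unfolding has_pseries_def pseries_def by blast
  have r: "r > 0"
    by (rule has_pseries_pos[OF assms])
  show ?thesis
  proof (rule has_pseries_regroup[OF r, where m = "\<lambda>\<alpha> b. \<beta> b + \<alpha> b" and c = "\<lambda>\<alpha>. k * c \<alpha>"])
    show "((\<lambda>\<alpha>. \<bar>k * c \<alpha>\<bar> * r ^ mdeg (\<lambda>b. \<beta> b + \<alpha> b)) has_sum \<bar>k\<bar> * r ^ mdeg \<beta> * s) multi_indices"
      using has_sum_cmult_right[OF s, of "\<bar>k\<bar> * r ^ mdeg \<beta>"]
      by (simp add: mdeg_add power_add abs_mult mult_ac)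
    show "\<bar>k\<bar> * r ^ mdeg \<beta> * s \<le> \<bar>k\<bar> * r ^ mdeg \<beta> * M"
      using sM r by (intro mult_left_mono) auto
    fix z assume "z \<in> ball a r"
    from has_sum_cmult_right[OF f[OF this], of "k * mon \<beta> (z - a)"]
    show "((\<lambda>\<alpha>. k * c \<alpha> * mon (\<lambda>b. \<beta> b + \<alpha> b) (z - a)) has_sum k * mon \<beta> (z - a) * f z) multi_indices"
      by (simp add: mon_add mult_ac)
  qed
qed

text \<open>Expanding \<open>f\<close> turns the product into a sum of monomial multiples of
  \<open>g\<close>, and each of these only shifts the indices of \<open>g\<close>.\<close>

lemma has_pseries_mult:
  assumes "has_pseries f a r M" and "has_pseries g a r N"
  shows "has_pseries (\<lambda>z. f z * g z) a r (M * N)"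
proof -
  obtain c s where sM: "s \<le> M" and s: "((\<lambda>\<alpha>. \<bar>c \<alpha>\<bar> * r ^ mdeg \<alpha>) has_sum s) multi_indices"
    and f: "\<And>z. z \<in> ball a r \<Longrightarrow> ((\<lambda>\<alpha>. c \<alpha> * mon \<alpha> (z - a)) has_sum f z) multi_indices"
    using assms(1) unfolding has_pseries_def pseries_def by blast
  have r: "r > 0"
    by (rule has_pseries_pos[OF assms(1)])
  \<comment> \<open>\<open>has_pseries_sum\<close> wants bounds with a known sum, so the exact norm
    \<open>s\<close> of \<open>f\<close> is used first and enlarged to \<open>M\<close>
    afterwards.\<close>
  have "has_pseries (\<lambda>z. f z * g z) a r (s * N)"
  proof (rule has_pseries_sum[OF r])
    show "has_pseries (\<lambda>z. c \<alpha> * mon \<alpha> (z - a) * g z) a r (\<bar>c \<alpha>\<bar> * r ^ mdeg \<alpha> * N)" for \<alpha>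
      by (rule has_pseries_mult_mon[OF assms(2)])
    show "((\<lambda>\<alpha>. \<bar>c \<alpha>\<bar> * r ^ mdeg \<alpha> * N) has_sum s * N) multi_indices"
      by (rule has_sum_cmult_left[OF s])
    show "((\<lambda>\<alpha>. c \<alpha> * mon \<alpha> (z - a) * g z) has_sum f z * g z) multi_indices" if "z \<in> ball a r" for z
      by (rule has_sum_cmult_left[OF f[OF that]])
  qed
  moreover have "s * N \<le> M * N"
    using sM has_pseries_nonneg[OF assms(2)] by (rule mult_right_mono)
  ultimately show ?thesis
    using has_pseries_mono r by blast
qed

lemma has_pseries_power:
  assumes "has_pseries f a r M"
  shows "has_pseries (\<lambda>z. f z ^ n) a r (M ^ n)"
proof (induction n)
  case 0
  show ?case
    using has_pseries_const[OF has_pseries_pos[OF assms], of 1 a] by simp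
next
  case (Suc n)
  then show ?case
    using has_pseries_mult[OF assms Suc] by simp
qed

lemma has_pseries_prod:
  assumes "finite I" and "r > 0" and "\<And>i. i \<in> I \<Longrightarrow> has_pseries (f i) a r (M i)"
  shows "has_pseries (\<lambda>z. \<Prod>i\<in>I. f i z) a r (\<Prod>i\<in>I. M i)"
  using assms(1,3)
proof (induction I rule: finite_induct)
  case empty
  show ?case
    using has_pseries_const[OF assms(2), of 1 a] by simp
next
  case (insert i I)
  then show ?case
    using has_pseries_mult[of "f i" a r "M i"] by simp
qed

definition zero_index :: "'a::euclidean_space \<Rightarrow> nat" where
  "zero_index = restrict (\<lambda>_. 0) Basis"

text \<open>Every monomial with a positive exponent vanishes at the centre.\<close>

lemma pseries_at_center:
  assumes "pseries c f a r M"
  shows "f a = c zero_index"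
proof -
  have f: "((\<lambda>\<alpha>. c \<alpha> * mon \<alpha> (a - a)) has_sum f a) multi_indices"
    using assms centre_in_ball[of a r] unfolding pseries_def by blast
  have "((\<lambda>\<alpha>. c \<alpha> * mon \<alpha> (a - a)) has_sum c zero_index) multi_indices"
  proof (rule has_sum_cong_neutral[THEN iffD1, of _ "{zero_index}"])
    show "((\<lambda>_. c zero_index) has_sum c zero_index) {zero_index}"
      by (simp add: has_sum_finiteI)
    fix \<alpha> :: "'a \<Rightarrow> nat" assume \<alpha>: "\<alpha> \<in> multi_indices - {zero_index}"
    have "\<exists>b\<in>Basis. \<alpha> b \<noteq> 0"
    proof (rule ccontr)
      assume "\<not> ?thesis"
      then have "\<alpha> = zero_index"
        using \<alpha> by (auto simp: zero_index_def PiE_def extensional_def)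
      then show False
        using \<alpha> by simp
    qed
    then show "c \<alpha> * mon \<alpha> (a - a) = 0"
      by (auto simp: mon_def)
  qed (auto simp: zero_index_def mon_def)
  with f show ?thesis
    by (rule has_sum_unique)
qed

text \<open>Without a constant term, shrinking the radius by a factor \<open>t \<le> 1\<close>
  multiplies the term of degree \<open>d \<ge> 1\<close> by \<open>t ^ d \<le> t\<close>, hence the
  norm by at most \<open>t\<close>.\<close>

lemma has_pseries_small:
  assumes "has_pseries f a r M" and "f a = 0" and "\<epsilon> > 0"
  obtains r' where "0 < r'" and "r' \<le> r" and "has_pseries f a r' \<epsilon>"
proof -
  obtain c where c: "pseries c f a r M"
    using assms(1) unfolding has_pseries_def by blast
  then obtain s where sM: "s \<le> M" and s: "((\<lambda>\<alpha>. \<bar>c \<alpha>\<bar> * r ^ mdeg \<alpha>) has_sum s) multi_indices"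
    and f: "\<And>z. z \<in> ball a r \<Longrightarrow> ((\<lambda>\<alpha>. c \<alpha> * mon \<alpha> (z - a)) has_sum f z) multi_indices"
    unfolding pseries_def by blast
  have r: "r > 0"
    by (rule has_pseries_pos[OF assms(1)])
  have deg0: "\<alpha> = zero_index" if "\<alpha> \<in> multi_indices" "mdeg \<alpha> = 0" for \<alpha> :: "'a \<Rightarrow> nat"
    using that unfolding mdeg_def zero_index_def by (auto intro!: extensionalityI[of _ Basis] simp: PiE_def)
  have c0: "c zero_index = 0"
    using pseries_at_center[OF c] assms(2) by simp
  have s0: "s \<ge> 0"
    by (rule has_sum_nonneg[OF s]) (use r in auto)
  \<comment> \<open>The \<open>+ 1\<close> covers the case \<open>s = 0\<close>, and the minimum
    keeps the new radius from exceeding the old one.\<close>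
  define t where "t = min 1 (\<epsilon> / (s + 1))"
  have t: "0 < t" "t \<le> 1" "t * s \<le> \<epsilon>"
  proof -
    show "0 < t" "t \<le> 1"
      using s0 assms(3) by (auto simp: t_def)
    have "t * s \<le> \<epsilon> / (s + 1) * s"
      using s0 by (intro mult_right_mono) (auto simp: t_def)
    also have "\<dots> \<le> \<epsilon>"
      using s0 assms(3) by (simp add: field_simps)
    finally show "t * s \<le> \<epsilon>" .
  qed
  have le: "\<bar>c \<alpha>\<bar> * (t * r) ^ mdeg \<alpha> \<le> t * (\<bar>c \<alpha>\<bar> * r ^ mdeg \<alpha>)" if "\<alpha> \<in> multi_indices" for \<alpha>
  proof (cases "mdeg \<alpha>")
    case 0
    then show ?thesis
      using deg0[OF that] c0 by simp
  next
    case (Suc n)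
    have "t ^ mdeg \<alpha> \<le> t"
      using t Suc by (simp add: mult_left_le power_le_one)
    then have "t ^ mdeg \<alpha> * (\<bar>c \<alpha>\<bar> * r ^ mdeg \<alpha>) \<le> t * (\<bar>c \<alpha>\<bar> * r ^ mdeg \<alpha>)"
      using r by (intro mult_right_mono) auto
    then show ?thesis
      by (simp add: power_mult_distrib mult_ac)
  qed
  have ts: "((\<lambda>\<alpha>. t * (\<bar>c \<alpha>\<bar> * r ^ mdeg \<alpha>)) has_sum t * s) multi_indices"
    by (rule has_sum_cmult_right[OF s])
  have sum': "(\<lambda>\<alpha>. \<bar>c \<alpha>\<bar> * (t * r) ^ mdeg \<alpha>) summable_on multi_indices"
    by (rule summable_on_comparison_test[OF has_sum_imp_summable[OF ts]]) (use le t r in auto)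
  have "infsum (\<lambda>\<alpha>. \<bar>c \<alpha>\<bar> * (t * r) ^ mdeg \<alpha>) multi_indices \<le> t * s"
    by (rule has_sum_mono[OF has_sum_infsum[OF sum'] ts]) (rule le)
  moreover have tr: "0 < t * r" "t * r \<le> r"
    using t r by (auto simp: mult_le_cancel_right1)
  ultimately have "pseries c f a (t * r) \<epsilon>"
    unfolding pseries_def using f has_sum_infsum[OF sum'] t(3)
    by (intro conjI exI[of _ "infsum (\<lambda>\<alpha>. \<bar>c \<alpha>\<bar> * (t * r) ^ mdeg \<alpha>) multi_indices"]) auto
  then show thesis
    using that[of "t * r"] tr unfolding has_pseries_def by blast
qed

section \<open>Closure properties of real analytic functions\<close>

lemma has_pseries_mono_radius:
  "has_pseries f a r M \<Longrightarrow> 0 < r' \<Longrightarrow> r' \<le> r \<Longrightarrow> has_pseries f a r' M"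
  using has_pseries_mono by blast

lemma real_analytic_at_const [simp]: "real_analytic_at (\<lambda>_. k) a"
  by (rule real_analytic_atI[OF has_pseries_const[of 1]]) simp

lemma real_analytic_at_add:
  assumes "real_analytic_at f a" and "real_analytic_at g a"
  shows "real_analytic_at (\<lambda>z. f z + g z) a"
proof -
  obtain r M where f: "has_pseries f a r M"
    using assms(1) by (rule real_analytic_atE)
  obtain s N where g: "has_pseries g a s N"
    using assms(2) by (rule real_analytic_atE)
  have "min r s > 0"
    using f g by (simp add: has_pseries_pos)
  then show ?thesis
    using real_analytic_atI[OF has_pseries_add] has_pseries_mono_radius[OF f, of "min r s"]
      has_pseries_mono_radius[OF g, of "min r s"] by simp
qed

lemma real_analytic_at_mult:
  assumes "real_analytic_at f a" and "real_analytic_at g a"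
  shows "real_analytic_at (\<lambda>z. f z * g z) a"
proof -
  obtain r M where f: "has_pseries f a r M"
    using assms(1) by (rule real_analytic_atE)
  obtain s N where g: "has_pseries g a s N"
    using assms(2) by (rule real_analytic_atE)
  have "min r s > 0"
    using f g by (simp add: has_pseries_pos)
  then show ?thesis
    using real_analytic_atI[OF has_pseries_mult] has_pseries_mono_radius[OF f, of "min r s"]
      has_pseries_mono_radius[OF g, of "min r s"] by simp
qed

lemma real_analytic_at_minus:
  assumes "real_analytic_at f a"
  shows "real_analytic_at (\<lambda>z. - f z) a"
  using real_analytic_at_mult[OF real_analytic_at_const[of "-1"] assms] by simp

lemma real_analytic_at_diff:
  assumes "real_analytic_at f a" and "real_analytic_at g a"
  shows "real_analytic_at (\<lambda>z. f z - g z) a"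
  using real_analytic_at_add[OF assms(1) real_analytic_at_minus[OF assms(2)]] by simp

lemma real_analytic_at_power:
  assumes "real_analytic_at f a"
  shows "real_analytic_at (\<lambda>z. f z ^ n) a"
  by (induction n) (auto intro: real_analytic_at_mult assms)

lemma real_analytic_at_sum:
  assumes "finite I" and "\<And>i. i \<in> I \<Longrightarrow> real_analytic_at (f i) a"
  shows "real_analytic_at (\<lambda>z. \<Sum>i\<in>I. f i z) a"
  using assms by (induction I rule: finite_induct) (auto intro: real_analytic_at_add)

text \<open>The geometric series, after normalising the value at the centre.\<close>

lemma real_analytic_at_inverse:
  assumes "real_analytic_at f a" and "f a \<noteq> 0"
  shows "real_analytic_at (\<lambda>z. inverse (f z)) a"
proof -
  define h where "h z = 1 - f z / f a" for z
  have "real_analytic_at (\<lambda>z. 1 - inverse (f a) * f z) a"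
    by (intro real_analytic_at_diff real_analytic_at_mult real_analytic_at_const assms)
  then have "real_analytic_at h a"
    by (simp add: h_def[abs_def] field_simps)
  then obtain r M where "has_pseries h a r M"
    by (rule real_analytic_atE)
  \<comment> \<open>Since \<open>h a = 0\<close>, the norm can be pushed down to \<open>1/2\<close>;
    the bounds \<open>(1/2) ^ n\<close> for the powers then have sum 2.\<close>
  then obtain s where h: "has_pseries h a s (1/2)"
    by (rule has_pseries_small[where \<epsilon> = "1/2"]) (use assms(2) in \<open>auto simp: h_def\<close>)
  have "has_pseries (\<lambda>z. 1 / (1 - h z)) a s 2"
  proof (rule has_pseries_sum[OF has_pseries_pos[OF h], where K = UNIV])
    show "has_pseries (\<lambda>z. h z ^ n) a s ((1/2) ^ n)" for n
      by (rule has_pseries_power[OF h])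
    show "((\<lambda>n. (1/2::real) ^ n) has_sum 2) UNIV"
      using geometric_sums[of "1/2::real"] by (intro sums_nonneg_imp_has_sum) auto
    fix z assume "z \<in> ball a s"
    from has_pseries_bound[OF h this] have "norm (h z) < 1"
      by simp
    moreover from this have "summable (\<lambda>n. norm (h z ^ n))"
      unfolding norm_power by (intro summable_geometric) simp
    ultimately show "((\<lambda>n. h z ^ n) has_sum 1 / (1 - h z)) UNIV"
      using geometric_sums[of "h z"] by (intro norm_summable_imp_has_sum)
  qed
  from real_analytic_at_mult[OF real_analytic_at_const[of "inverse (f a)"] real_analytic_atI[OF this]]
  show ?thesis
    using assms(2) by (simp add: h_def field_simps)
qed

lemma real_analytic_at_divide:
  assumes "real_analytic_at f a" and "real_analytic_at g a" and "g a \<noteq> 0"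
  shows "real_analytic_at (\<lambda>z. f z / g z) a"
  using real_analytic_at_mult[OF assms(1) real_analytic_at_inverse[OF assms(2,3)]]
  by (simp add: divide_inverse)

lemma real_analytic_at_Basis:
  fixes a b :: "'a::euclidean_space"
  assumes "b \<in> Basis"
  shows "real_analytic_at (\<lambda>z. z \<bullet> b) a"
proof -
  define \<alpha> :: "'a \<Rightarrow> nat" where "\<alpha> = (\<lambda>i. if i = b then 1 else 0)"
  have "mon \<alpha> v = v \<bullet> b" for v :: 'a
  proof -
    have "mon \<alpha> v = (\<Prod>i\<in>Basis. if i = b then v \<bullet> b else 1)"
      unfolding mon_def \<alpha>_def by (rule prod.cong) auto
    then show ?thesis
      using assms by (simp add: prod.delta)
  qed
  then have "real_analytic_at (\<lambda>z. (z - a) \<bullet> b) a"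
    using real_analytic_atI[OF has_pseries_scaled_mon[of 1 1 \<alpha> a]] by simp
  from real_analytic_at_add[OF this real_analytic_at_const[of "a \<bullet> b"]]
  show ?thesis
    by (simp add: inner_diff_left)
qed

lemma real_analytic_at_linear:
  fixes f :: "'a::euclidean_space \<Rightarrow> real"
  assumes "linear f"
  shows "real_analytic_at f a"
proof -
  have "f z = (\<Sum>b\<in>Basis. z \<bullet> b * f b)" for z
    by (subst euclidean_representation[of z, symmetric])
       (simp add: linear_sum[OF assms] linear_cmul[OF assms])
  then have "f = (\<lambda>z. \<Sum>b\<in>Basis. z \<bullet> b * f b)"
    by blast
  moreover have "real_analytic_at (\<lambda>z. \<Sum>b\<in>Basis. z \<bullet> b * f b) a"
    by (intro real_analytic_at_sum real_analytic_at_mult real_analytic_at_Basis) auto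
  ultimately show ?thesis
    by simp
qed

text \<open>Inserting component series of norm at most \<open>\<epsilon>\<close> into the monomial
  \<open>\<alpha>\<close> gives a series of norm at most \<open>\<epsilon> ^ mdeg \<alpha>\<close>.
  As \<open>\<epsilon> \<le> \<rho>\<close>, these norms, weighted by the coefficients of
  \<open>f\<close>, are summable.\<close>

lemma real_analytic_at_compose:
  fixes f :: "'b::euclidean_space \<Rightarrow> real" and g :: "'a::euclidean_space \<Rightarrow> 'b"
  assumes f: "real_analytic_at f (g a)"
    and g: "\<And>b. b \<in> Basis \<Longrightarrow> real_analytic_at (\<lambda>z. g z \<bullet> b) a"
  shows "real_analytic_at (\<lambda>z. f (g z)) a"
proof -
  obtain \<rho> M where "has_pseries f (g a) \<rho> M"
    using f by (rule real_analytic_atE)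
  then obtain c s where \<rho>: "\<rho> > 0"
    and s: "((\<lambda>\<alpha>. \<bar>c \<alpha>\<bar> * \<rho> ^ mdeg \<alpha>) has_sum s) multi_indices"
    and F: "\<And>z. z \<in> ball (g a) \<rho> \<Longrightarrow> ((\<lambda>\<alpha>. c \<alpha> * mon \<alpha> (z - g a)) has_sum f z) multi_indices"
    unfolding has_pseries_def pseries_def by blast
  \<comment> \<open>The l1 estimate of the norm adds up one \<open>\<epsilon>\<close> per
    coordinate; the sum is \<open>\<rho> / 2\<close>, so \<open>g z\<close> stays in the ball where
    \<open>f\<close> has its expansion.\<close>
  define \<epsilon> where "\<epsilon> = \<rho> / (2 * real DIM('b))"
  have \<epsilon>: "\<epsilon> > 0" "\<epsilon> \<le> \<rho>"
  proof -
    have "real DIM('b) \<ge> 1"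
      using DIM_positive[where 'a = 'b] by linarith
    then have "\<rho> * 1 \<le> \<rho> * (2 * real DIM('b))"
      using \<rho> by (intro mult_left_mono) linarith+
    then show "\<epsilon> > 0" "\<epsilon> \<le> \<rho>"
      using \<rho> by (auto simp: \<epsilon>_def field_simps)
  qed
  have "\<exists>r>0. has_pseries (\<lambda>z. (g z - g a) \<bullet> b) a r \<epsilon>" if "b \<in> Basis" for b
  proof -
    have "real_analytic_at (\<lambda>z. g z \<bullet> b - g a \<bullet> b) a"
      by (intro real_analytic_at_diff g that real_analytic_at_const)
    then obtain r N where "has_pseries (\<lambda>z. (g z - g a) \<bullet> b) a r N"
      by (auto simp: inner_diff_left elim: real_analytic_atE)
    then show ?thesis
      by (rule has_pseries_small[OF _ _ \<epsilon>(1)]) auto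
  qed
  then obtain r where r: "\<And>b. b \<in> Basis \<Longrightarrow> r b > 0"
    "\<And>b. b \<in> Basis \<Longrightarrow> has_pseries (\<lambda>z. (g z - g a) \<bullet> b) a (r b) \<epsilon>"
    by metis
  define R where "R = Min (r ` Basis)"
  have R: "R > 0"
    using r(1) by (simp add: R_def)
  have G: "has_pseries (\<lambda>z. (g z - g a) \<bullet> b) a R \<epsilon>" if "b \<in> Basis" for b
    using has_pseries_mono_radius[OF r(2)[OF that] R] that by (simp add: R_def)
  have "(\<lambda>\<alpha>. \<bar>c \<alpha>\<bar> * \<epsilon> ^ mdeg \<alpha>) summable_on multi_indices"
    by (rule summable_on_comparison_test[OF has_sum_imp_summable[OF s]])
       (use \<epsilon> in \<open>auto intro!: mult_left_mono power_mono\<close>)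
  then obtain t where t: "((\<lambda>\<alpha>. \<bar>c \<alpha>\<bar> * \<epsilon> ^ mdeg \<alpha>) has_sum t) multi_indices"
    by (auto simp: summable_on_def)
  have "has_pseries (\<lambda>z. f (g z)) a R t"
  proof (rule has_pseries_sum[OF R _ t])
    show "has_pseries (\<lambda>z. c \<alpha> * mon \<alpha> (g z - g a)) a R (\<bar>c \<alpha>\<bar> * \<epsilon> ^ mdeg \<alpha>)" for \<alpha>
      unfolding mon_def mdeg_def power_sum
      by (intro has_pseries_mult has_pseries_prod has_pseries_power has_pseries_const G R finite_Basis)
    fix z assume z: "z \<in> ball a R"
    have "norm (g z - g a) \<le> (\<Sum>b\<in>Basis. \<bar>(g z - g a) \<bullet> b\<bar>)"
      by (rule norm_le_l1)
    also have "\<dots> \<le> (\<Sum>b\<in>(Basis::'b set). \<epsilon>)"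
      by (rule sum_mono) (rule has_pseries_bound[OF G z])
    also have "\<dots> < \<rho>"
      using \<rho> by (simp add: \<epsilon>_def)
    finally show "((\<lambda>\<alpha>. c \<alpha> * mon \<alpha> (g z - g a)) has_sum f (g z)) multi_indices"
      by (intro F) (simp add: dist_norm norm_minus_commute)
  qed
  then show ?thesis
    by (rule real_analytic_atI)
qed

section \<open>Partial derivatives of real analytic functions\<close>

text \<open>One operator for all coordinates in all dimensions; \<open>d1\<close> and
  \<open>d2\<close> are the directions \<open>(1, 0)\<close> and \<open>(0, 1)\<close>.\<close>

definition ddir :: "'a::euclidean_space \<Rightarrow> ('a \<Rightarrow> real) \<Rightarrow> 'a \<Rightarrow> real" where
  "ddir b f z = deriv (\<lambda>t. f (z + t *\<^sub>R b)) 0"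

text \<open>The coefficients of the formal derivative in direction \<open>b\<close>, re-indexed so
  that \<open>\<alpha>\<close> again belongs to the monomial \<open>mon \<alpha>\<close>.\<close>

definition shift_coeff ::
  "'a::euclidean_space \<Rightarrow> (('a \<Rightarrow> nat) \<Rightarrow> real) \<Rightarrow> ('a \<Rightarrow> nat) \<Rightarrow> real" where
  "shift_coeff b c \<alpha> = real (Suc (\<alpha> b)) * c (\<alpha>(b := Suc (\<alpha> b)))"

text \<open>Raising the exponent of \<open>b\<close> is a bijection onto the indices whose exponent
  at \<open>b\<close> is positive; all other indices contribute zero.\<close>

lemma has_sum_shift_index:
  fixes b :: "'a::euclidean_space" and h :: "('a \<Rightarrow> nat) \<Rightarrow> real"
  assumes b: "b \<in> Basis" and h: "\<And>\<beta>. \<beta> b = 0 \<Longrightarrow> h \<beta> = 0"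
  shows "((\<lambda>\<alpha>. h (\<alpha>(b := Suc (\<alpha> b)))) has_sum s) multi_indices \<longleftrightarrow> (h has_sum s) multi_indices"
proof -
  have bij: "bij_betw (\<lambda>\<alpha>. \<alpha>(b := Suc (\<alpha> b))) multi_indices {\<beta>\<in>multi_indices. \<beta> b \<noteq> 0}"
    by (rule bij_betwI[where g = "\<lambda>\<beta>. \<beta>(b := \<beta> b - 1)"])
       (use b in \<open>auto simp: PiE_def extensional_def\<close>)
  have "(h has_sum s) {\<beta>\<in>multi_indices. \<beta> b \<noteq> 0} \<longleftrightarrow> (h has_sum s) multi_indices"
    by (rule has_sum_cong_neutral) (use h in auto)
  then show ?thesis
    using has_sum_reindex_bij_betw[OF bij, of h s] by simp
qed

lemma mdeg_shift_index:
  assumes "b \<in> Basis"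
  shows "mdeg (\<alpha>(b := Suc (\<alpha> b))) = Suc (mdeg \<alpha>)"
  using assms by (simp add: mdeg_def sum.remove)

lemma index_le_mdeg:
  assumes "b \<in> Basis"
  shows "\<alpha> b \<le> mdeg \<alpha>"
  using assms by (simp add: mdeg_def member_le_sum)

text \<open>Differentiation brings down a factor of at most the degree, and halving the radius gains
  a power of 2 that absorbs it.\<close>

lemma shift_coeff_summable:
  assumes c: "(\<lambda>\<alpha>. \<bar>c \<alpha>\<bar> * r ^ mdeg \<alpha>) summable_on multi_indices" and "r > 0"
    and b: "b \<in> Basis"
  shows "(\<lambda>\<alpha>. \<bar>shift_coeff b c \<alpha>\<bar> * (r/2) ^ mdeg \<alpha>) summable_on multi_indices"
proof -
  \<comment> \<open>The truncated \<open>mdeg \<beta> - 1\<close> is harmless: in degree 0 the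
    factor \<open>\<beta> b\<close> is zero.\<close>
  define h where "h \<beta> = real (\<beta> b) * \<bar>c \<beta>\<bar> * (r/2) ^ (mdeg \<beta> - 1)" for \<beta>
  have "h summable_on multi_indices"
  proof (rule summable_on_comparison_test)
    show "(\<lambda>\<beta>. 2 / r * (\<bar>c \<beta>\<bar> * r ^ mdeg \<beta>)) summable_on multi_indices"
      by (rule summable_on_cmult_right[OF c])
    fix \<beta> :: "'a \<Rightarrow> nat"
    show "h \<beta> \<ge> 0"
      using assms by (simp add: h_def)
    show "h \<beta> \<le> 2 / r * (\<bar>c \<beta>\<bar> * r ^ mdeg \<beta>)"
    proof (cases "mdeg \<beta>")
      case 0
      then show ?thesis
        using index_le_mdeg[OF b, of \<beta>] assms by (simp add: h_def)
    next
      case (Suc n)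
      have "real (\<beta> b) \<le> 2 ^ mdeg \<beta>"
        using index_le_mdeg[OF b, of \<beta>] of_nat_less_two_power[of "mdeg \<beta>", where 'a = real]
        by linarith
      then have "real (\<beta> b) * (\<bar>c \<beta>\<bar> * (r/2) ^ n) \<le> 2 ^ mdeg \<beta> * (\<bar>c \<beta>\<bar> * (r/2) ^ n)"
        using assms by (intro mult_right_mono) auto
      then show ?thesis
        using assms by (simp add: h_def Suc power_divide mult.assoc)
    qed
  qed
  then obtain s where "(h has_sum s) multi_indices"
    by (auto simp: summable_on_def)
  then have "((\<lambda>\<alpha>. h (\<alpha>(b := Suc (\<alpha> b)))) has_sum s) multi_indices"
    by (subst has_sum_shift_index[OF b]) (simp_all add: h_def)
  moreover have "h (\<alpha>(b := Suc (\<alpha> b))) = \<bar>shift_coeff b c \<alpha>\<bar> * (r/2) ^ mdeg \<alpha>" for \<alpha>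
    by (simp add: h_def shift_coeff_def abs_mult mdeg_shift_index[OF b])
  ultimately show ?thesis
    by (auto simp: summable_on_def)
qed

text \<open>The second-order analogue of \<open>n \<le> 2 ^ n\<close>: halving the radius absorbs
  the factor that two differentiations bring down.\<close>

lemma nat_times_pred_le: "real n * real (n - 1) \<le> 2 * 2 ^ n"
proof (induction n)
  case (Suc n)
  have "real (Suc n) * real (Suc n - 1) = real n * real (n - 1) + 2 * real n"
    by (cases n) (simp_all add: algebra_simps)
  also have "\<dots> \<le> 2 * 2 ^ n + 2 * 2 ^ n"
    using Suc of_nat_less_two_power[of n, where 'a = real] by linarith
  finally show ?case
    by simp
qed simp

text \<open>Along \<open>b\<close> every monomial is a power of one variable, whose difference
  quotient misses the derivative by at most \<open>n (n - 1) K ^ (n - 2)\<close> times the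
  increment. Summed over all indices, the error is a constant multiple of
  \<open>\<bar>t\<bar>\<close>.\<close>

lemma pseries_termwise_derivative:
  fixes a b z :: "'a::euclidean_space"
  assumes ps: "pseries c f a r M" and b: "b \<in> Basis" and z: "z \<in> ball a (r/2)"
    and g: "((\<lambda>\<alpha>. shift_coeff b c \<alpha> * mon \<alpha> (z - a)) has_sum g) multi_indices"
  shows "((\<lambda>t. f (z + t *\<^sub>R b)) has_real_derivative g) (at 0)"
proof -
  obtain s where r: "r > 0" and s: "((\<lambda>\<alpha>. \<bar>c \<alpha>\<bar> * r ^ mdeg \<alpha>) has_sum s) multi_indices"
    and f: "\<And>z. z \<in> ball a r \<Longrightarrow> ((\<lambda>\<alpha>. c \<alpha> * mon \<alpha> (z - a)) has_sum f z) multi_indices"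
    using ps unfolding pseries_def by blast
  define v where "v = z - a"
  define K where "K = r / 2"
  \<comment> \<open>The part of the monomial that stays constant along the direction
    \<open>b\<close>.\<close>
  define R where "R \<beta> = (\<Prod>i\<in>Basis - {b}. (v \<bullet> i) ^ \<beta> i)" for \<beta>
  have v: "norm v < K"
    using z by (simp add: v_def K_def dist_norm norm_minus_commute)
  have K: "K > 0" "K < r"
    using r by (auto simp: K_def)
  have mon: "mon \<beta> (v + t *\<^sub>R b) = (v \<bullet> b + t) ^ \<beta> b * R \<beta>" for \<beta> t
  proof -
    have "mon \<beta> (v + t *\<^sub>R b)
        = ((v + t *\<^sub>R b) \<bullet> b) ^ \<beta> b * (\<Prod>i\<in>Basis - {b}. ((v + t *\<^sub>R b) \<bullet> i) ^ \<beta> i)"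
      unfolding mon_def using b by (simp add: prod.remove)
    moreover have "(\<Prod>i\<in>Basis - {b}. ((v + t *\<^sub>R b) \<bullet> i) ^ \<beta> i) = R \<beta>"
      unfolding R_def using b by (intro prod.cong) (auto simp: inner_add_left inner_Basis)
    ultimately show ?thesis
      using b by (simp add: inner_add_left inner_Basis)
  qed
  have mdeg: "mdeg \<beta> = \<beta> b + (\<Sum>i\<in>Basis - {b}. \<beta> i)" for \<beta>
    unfolding mdeg_def using b by (simp add: sum.remove)
  have R_le: "\<bar>R \<beta>\<bar> \<le> K ^ (mdeg \<beta> - \<beta> b)" for \<beta>
  proof -
    have "\<bar>R \<beta>\<bar> = (\<Prod>i\<in>Basis - {b}. \<bar>v \<bullet> i\<bar> ^ \<beta> i)"
      by (simp add: R_def abs_prod power_abs)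
    also have "\<dots> \<le> (\<Prod>i\<in>Basis - {b}. K ^ \<beta> i)"
      using v by (intro prod_mono conjI power_mono) (auto intro: order_trans[OF Basis_le_norm])
    also have "\<dots> = K ^ (mdeg \<beta> - \<beta> b)"
      by (simp add: mdeg power_sum)
    finally show ?thesis .
  qed
  define dm where "dm \<beta> = real (\<beta> b) * (v \<bullet> b) ^ (\<beta> b - Suc 0) * R \<beta>" for \<beta>
  have g': "((\<lambda>\<beta>. c \<beta> * dm \<beta>) has_sum g) multi_indices"
  proof (subst has_sum_shift_index[OF b, symmetric])
    have "R (\<alpha>(b := Suc (\<alpha> b))) = R \<alpha>" for \<alpha>
      unfolding R_def by (rule prod.cong) auto
    then have "c (\<alpha>(b := Suc (\<alpha> b))) * dm (\<alpha>(b := Suc (\<alpha> b))) = shift_coeff b c \<alpha> * mon \<alpha> (z - a)" for \<alpha>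
      using mon[of \<alpha> 0] by (simp add: dm_def shift_coeff_def v_def)
    then show "((\<lambda>\<alpha>. c (\<alpha>(b := Suc (\<alpha> b))) * dm (\<alpha>(b := Suc (\<alpha> b)))) has_sum g) multi_indices"
      using g by simp
  qed (simp add: dm_def)
  \<comment> \<open>The constant 8 is the 2 of \<open>nat_times_pred_le\<close> times the 4 in
    \<open>1 / K\<^sup>2 = 4 / r\<^sup>2\<close>. The restriction on \<open>t\<close> keeps the
    displaced point within distance \<open>K\<close> of the centre.\<close>
  have bound: "\<bar>(f (z + t *\<^sub>R b) - f z) / t - g\<bar> \<le> 8 / r\<^sup>2 * s * \<bar>t\<bar>"
    if t: "t \<noteq> 0" "\<bar>t\<bar> < K - norm v" for t
  proof -
    have vt: "norm (v + t *\<^sub>R b) < K"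
      using norm_triangle_ineq[of v "t *\<^sub>R b"] t b by simp
    have abs_b: "\<bar>v \<bullet> b\<bar> \<le> K" "\<bar>v \<bullet> b + t\<bar> \<le> K"
      using Basis_le_norm[OF b, of v] Basis_le_norm[OF b, of "v + t *\<^sub>R b"] v vt b
      by (auto simp: inner_add_left inner_Basis)
    have zt: "z + t *\<^sub>R b - a = v + t *\<^sub>R b"
      by (simp add: v_def)
    have "z + t *\<^sub>R b \<in> ball a r"
      using vt K by (simp add: dist_norm norm_minus_commute[of a] zt)
    from f[OF this] have 1: "((\<lambda>\<beta>. c \<beta> * ((v \<bullet> b + t) ^ \<beta> b * R \<beta>)) has_sum f (z + t *\<^sub>R b)) multi_indices"
      by (simp add: zt mon)
    have "z \<in> ball a r"
      using z r by simp
    from f[OF this] have 2: "((\<lambda>\<beta>. c \<beta> * ((v \<bullet> b) ^ \<beta> b * R \<beta>)) has_sum f z) multi_indices"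
      using mon[of _ 0] by (simp add: v_def)
    have "((\<lambda>\<beta>. (c \<beta> * ((v \<bullet> b + t) ^ \<beta> b * R \<beta>) + - (c \<beta> * ((v \<bullet> b) ^ \<beta> b * R \<beta>))) * (1 / t)
        + - (c \<beta> * dm \<beta>)) has_sum (f (z + t *\<^sub>R b) + - f z) * (1 / t) + - g) multi_indices"
      by (intro has_sum_add has_sum_cmult_left has_sum_uminusI 1 2 g')
    moreover have "(c \<beta> * ((v \<bullet> b + t) ^ \<beta> b * R \<beta>) + - (c \<beta> * ((v \<bullet> b) ^ \<beta> b * R \<beta>))) * (1 / t)
        + - (c \<beta> * dm \<beta>)
      = c \<beta> * R \<beta> * (((v \<bullet> b + t) ^ \<beta> b - (v \<bullet> b) ^ \<beta> b) / t
           - real (\<beta> b) * (v \<bullet> b) ^ (\<beta> b - Suc 0))" for \<beta>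
      unfolding dm_def using t by (simp add: field_simps)
    ultimately have 3: "((\<lambda>\<beta>. c \<beta> * R \<beta> * (((v \<bullet> b + t) ^ \<beta> b - (v \<bullet> b) ^ \<beta> b) / t
           - real (\<beta> b) * (v \<bullet> b) ^ (\<beta> b - Suc 0)))
        has_sum (f (z + t *\<^sub>R b) - f z) / t - g) multi_indices"
      by simp
    have 4: "((\<lambda>\<beta>. 8 / r\<^sup>2 * \<bar>t\<bar> * (\<bar>c \<beta>\<bar> * r ^ mdeg \<beta>)) has_sum 8 / r\<^sup>2 * \<bar>t\<bar> * s) multi_indices"
      by (rule has_sum_cmult_right[OF s])
    have "norm ((f (z + t *\<^sub>R b) - f z) / t - g) \<le> 8 / r\<^sup>2 * \<bar>t\<bar> * s"
    proof (rule norm_infsum_le[OF 3 4])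
      fix \<beta> :: "'a \<Rightarrow> nat"
      define n where "n = \<beta> b"
      define N where "N = mdeg \<beta>"
      have nN: "n \<le> N"
        unfolding n_def N_def by (rule index_le_mdeg[OF b])
      have q: "\<bar>((v \<bullet> b + t) ^ n - (v \<bullet> b) ^ n) / t - real n * (v \<bullet> b) ^ (n - Suc 0)\<bar>
          \<le> real n * real (n - Suc 0) * K ^ (n - 2) * \<bar>t\<bar>"
        using lemma_termdiff3[of t "v \<bullet> b" K n] t abs_b by simp
      have "K ^ (N - n) * (real n * real (n - Suc 0) * K ^ (n - 2)) \<le> 8 / r\<^sup>2 * r ^ N"
      proof (cases "n \<ge> 2")
        case True
        then have N2: "N = (N - n) + (n - 2) + 2" "N \<ge> 2"
          using nN by auto
        have "K ^ (N - n) * K ^ (n - 2) * K\<^sup>2 = K ^ N"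
          by (subst (2) N2(1)) (simp only: power_add)
        then have KK: "K ^ (N - n) * K ^ (n - 2) = K ^ N / K\<^sup>2"
          using K by (simp add: field_simps)
        have "real n * real (n - Suc 0) \<le> real N * real (N - 1)"
          using nN by (intro mult_mono) auto
        also have "\<dots> \<le> 2 * 2 ^ N"
          by (rule nat_times_pred_le)
        finally have "(K ^ (N - n) * K ^ (n - 2)) * (real n * real (n - Suc 0))
            \<le> (K ^ (N - n) * K ^ (n - 2)) * (2 * 2 ^ N)"
          using K by (intro mult_left_mono) auto
        also have "\<dots> = 8 / r\<^sup>2 * r ^ N"
          unfolding KK using r by (simp add: K_def power_divide field_simps)
        finally show ?thesis
          by (simp only: mult_ac)
      next
        \<comment> \<open>For exponents 0 and 1 the factor \<open>n * (n - 1)\<close> vanishes, so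
          the truncated \<open>n - 2\<close> does no harm.\<close>
        case False
        then have "n = 0 \<or> n = 1"
          by auto
        then show ?thesis
          using r by auto
      qed
      note KN = this
      have "\<bar>R \<beta>\<bar> * \<bar>((v \<bullet> b + t) ^ n - (v \<bullet> b) ^ n) / t - real n * (v \<bullet> b) ^ (n - Suc 0)\<bar>
         \<le> K ^ (N - n) * (real n * real (n - Suc 0) * K ^ (n - 2) * \<bar>t\<bar>)"
        using R_le[of \<beta>] K unfolding n_def N_def by (intro mult_mono q[unfolded n_def]) auto
      also have "\<dots> = K ^ (N - n) * (real n * real (n - Suc 0) * K ^ (n - 2)) * \<bar>t\<bar>"
        by simp
      also have "\<dots> \<le> 8 / r\<^sup>2 * r ^ N * \<bar>t\<bar>"
        by (rule mult_right_mono[OF KN]) simp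
      finally have "\<bar>c \<beta>\<bar> * (\<bar>R \<beta>\<bar> * \<bar>((v \<bullet> b + t) ^ n - (v \<bullet> b) ^ n) / t - real n * (v \<bullet> b) ^ (n - Suc 0)\<bar>)
          \<le> \<bar>c \<beta>\<bar> * (8 / r\<^sup>2 * r ^ N * \<bar>t\<bar>)"
        by (rule mult_left_mono) simp
      then show "norm (c \<beta> * R \<beta> * (((v \<bullet> b + t) ^ \<beta> b - (v \<bullet> b) ^ \<beta> b) / t
           - real (\<beta> b) * (v \<bullet> b) ^ (\<beta> b - Suc 0))) \<le> 8 / r\<^sup>2 * \<bar>t\<bar> * (\<bar>c \<beta>\<bar> * r ^ mdeg \<beta>)"
        unfolding n_def N_def by (simp add: abs_mult mult_ac)
    qed
    then show ?thesis
      by (simp add: mult_ac)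
  qed
  have "((\<lambda>t. (f (z + t *\<^sub>R b) - f z) / t - g) \<longlongrightarrow> 0) (at 0)"
  proof (rule Lim_null_comparison)
    show "\<forall>\<^sub>F t in at 0. norm ((f (z + t *\<^sub>R b) - f z) / t - g) \<le> 8 / r\<^sup>2 * s * \<bar>t\<bar>"
      unfolding eventually_at
      using v bound by (intro exI[of _ "K - norm v"]) auto
    have "((\<lambda>t. 8 / r\<^sup>2 * s * \<bar>t\<bar>) \<longlongrightarrow> 8 / r\<^sup>2 * s * \<bar>0\<bar>) (at 0)"
      by (intro tendsto_intros)
    then show "((\<lambda>t. 8 / r\<^sup>2 * s * \<bar>t\<bar>) \<longlongrightarrow> 0) (at 0)"
      by simp
  qed
  then show ?thesis
    by (simp add: DERIV_def LIM_zero_iff)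
qed

lemma pseries_ddir:
  assumes ps: "pseries c f a r M" and b: "b \<in> Basis"
  obtains M' where "pseries (shift_coeff b c) (ddir b f) a (r/2) M'"
    and "\<And>z. z \<in> ball a (r/2) \<Longrightarrow> ((\<lambda>t. f (z + t *\<^sub>R b)) has_real_derivative ddir b f z) (at 0)"
proof -
  obtain s where r: "r > 0" and s: "((\<lambda>\<alpha>. \<bar>c \<alpha>\<bar> * r ^ mdeg \<alpha>) has_sum s) multi_indices"
    using ps unfolding pseries_def by blast
  have sum: "(\<lambda>\<alpha>. \<bar>shift_coeff b c \<alpha>\<bar> * (r/2) ^ mdeg \<alpha>) summable_on multi_indices"
    by (rule shift_coeff_summable[OF has_sum_imp_summable[OF s] r b])
  have d: "((\<lambda>\<alpha>. shift_coeff b c \<alpha> * mon \<alpha> (z - a)) has_sum ddir b f z) multi_indices \<and>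
      ((\<lambda>t. f (z + t *\<^sub>R b)) has_real_derivative ddir b f z) (at 0)" if z: "z \<in> ball a (r/2)" for z
  proof -
    have "(\<lambda>\<alpha>. shift_coeff b c \<alpha> * mon \<alpha> (z - a)) summable_on multi_indices"
      by (rule real_summable_abs_comparison[OF sum])
         (use z in \<open>auto simp: abs_mult dist_norm norm_minus_commute intro!: mult_left_mono abs_mon_le\<close>)
    then obtain g where g: "((\<lambda>\<alpha>. shift_coeff b c \<alpha> * mon \<alpha> (z - a)) has_sum g) multi_indices"
      by (auto simp: summable_on_def)
    moreover note pseries_termwise_derivative[OF ps b z g]
    moreover from this have "ddir b f z = g"
      unfolding ddir_def by (rule DERIV_imp_deriv)
    ultimately show ?thesis
      by simp
  qed
  show thesis
    by (rule that[of "infsum (\<lambda>\<alpha>. \<bar>shift_coeff b c \<alpha>\<bar> * (r/2) ^ mdeg \<alpha>) multi_indices"])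
       (use r d has_sum_infsum[OF sum] in \<open>auto simp: pseries_def\<close>)
qed

lemma real_analytic_at_ddir:
  assumes "real_analytic_at f a" and "b \<in> Basis"
  shows "real_analytic_at (ddir b f) a"
proof -
  obtain r M where "has_pseries f a r M"
    using assms(1) by (rule real_analytic_atE)
  then obtain c where "pseries c f a r M"
    unfolding has_pseries_def by blast
  then obtain M' where "pseries (shift_coeff b c) (ddir b f) a (r/2) M'"
    using pseries_ddir assms(2) by blast
  then show ?thesis
    using real_analytic_atI unfolding has_pseries_def by blast
qed

text \<open>\<open>deriv\<close> is total and says nothing about differentiability by itself; for
  analytic functions \<open>ddir\<close> is a genuine derivative.\<close>

lemma has_derivative_ddir:
  assumes "real_analytic_at f a" and "b \<in> Basis"
  shows "((\<lambda>t. f (a + t *\<^sub>R b)) has_real_derivative ddir b f a) (at 0)"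
proof -
  obtain r M where rM: "has_pseries f a r M"
    using assms(1) by (rule real_analytic_atE)
  then obtain c where "pseries c f a r M"
    unfolding has_pseries_def by blast
  then show ?thesis
    using pseries_ddir[of c f a r M b] assms(2) has_pseries_pos[OF rM]
    by (metis centre_in_ball half_gt_zero)
qed

text \<open>Both mixed derivatives are the coefficient of the same monomial.\<close>

lemma ddir_commute:
  assumes "real_analytic_at f a" and b: "b \<in> Basis" "b' \<in> Basis"
  shows "ddir b (ddir b' f) a = ddir b' (ddir b f) a"
proof (cases "b = b'")
  case False
  obtain r M where "has_pseries f a r M"
    using assms(1) by (rule real_analytic_atE)
  then obtain c where c: "pseries c f a r M"
    unfolding has_pseries_def by blast
  \<comment> \<open>For \<open>i \<noteq> j\<close> both exponents are raised from 0 to 1, so both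
    factors in \<open>shift_coeff\<close> are 1.\<close>
  have "ddir i (ddir j f) a = c (zero_index(i := 1, j := 1))"
    if ij: "i \<in> Basis" "j \<in> Basis" "i \<noteq> j" for i j
  proof -
    obtain M1 where "pseries (shift_coeff j c) (ddir j f) a (r/2) M1"
      using pseries_ddir[OF c ij(2)] by blast
    then obtain M2 where "pseries (shift_coeff i (shift_coeff j c)) (ddir i (ddir j f)) a (r/2/2) M2"
      using pseries_ddir ij(1) by blast
    from pseries_at_center[OF this] show ?thesis
      using ij by (simp add: shift_coeff_def zero_index_def)
  qed
  from this[OF b] this[OF b(2,1)] show ?thesis
    using False by (simp add: fun_upd_twist)
qed simp

section \<open>Transfer to \<open>d1\<close> and \<open>d2\<close>\<close>

lemma deriv_translate: "deriv (\<lambda>t. f (x + t)) 0 = deriv (f :: real \<Rightarrow> real) x"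
  unfolding deriv_def using DERIV_shift[of f _ 0 x] by (simp add: add.commute)

lemma DERIV_translate:
  "((\<lambda>t. f (x + t)) has_real_derivative d) (at 0) \<longleftrightarrow> (f has_real_derivative d) (at x)"
  for f :: "real \<Rightarrow> real"
  using DERIV_shift[of f d 0 x] by (simp add: add.commute)

lemma d1_eq_ddir: "(\<lambda>(x, y). d1 f x y) = ddir (1, 0) (\<lambda>(x, y). f x y)"
  by (auto simp: d1_def ddir_def deriv_translate[of "\<lambda>s. f s _"])

lemma d2_eq_ddir: "(\<lambda>(x, y). d2 f x y) = ddir (0, 1) (\<lambda>(x, y). f x y)"
  by (auto simp: d2_def ddir_def deriv_translate)

lemma Basis_real_prod: "(1, 0) \<in> (Basis :: (real \<times> real) set)" "(0, 1) \<in> (Basis :: (real \<times> real) set)"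
  by (auto simp: Basis_prod_def)

lemma real_analytic_on_d1:
  "real_analytic_on (\<lambda>(x, y). f x y) D \<Longrightarrow> real_analytic_on (\<lambda>(x, y). d1 f x y) D"
  unfolding d1_eq_ddir real_analytic_on_def using real_analytic_at_ddir Basis_real_prod by blast

lemma real_analytic_on_d2:
  "real_analytic_on (\<lambda>(x, y). f x y) D \<Longrightarrow> real_analytic_on (\<lambda>(x, y). d2 f x y) D"
  unfolding d2_eq_ddir real_analytic_on_def using real_analytic_at_ddir Basis_real_prod by blast

lemma DERIV_d1:
  assumes "real_analytic_on (\<lambda>(x, y). f x y) D" and "(x, y) \<in> D"
  shows "((\<lambda>s. f s y) has_real_derivative d1 f x y) (at x)"
proof -
  have "((\<lambda>t. f (x + t) y) has_real_derivative ddir (1, 0) (\<lambda>(x, y). f x y) (x, y)) (at 0)"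
    using assms has_derivative_ddir[of "\<lambda>(x, y). f x y" "(x, y)" "(1, 0)"] Basis_real_prod
    by (auto simp: real_analytic_on_def)
  then show ?thesis
    unfolding d1_eq_ddir[symmetric] using DERIV_translate[of "\<lambda>s. f s y"] by simp
qed

lemma DERIV_d2:
  assumes "real_analytic_on (\<lambda>(x, y). f x y) D" and "(x, y) \<in> D"
  shows "((\<lambda>t. f x t) has_real_derivative d2 f x y) (at y)"
proof -
  have "((\<lambda>t. f x (y + t)) has_real_derivative ddir (0, 1) (\<lambda>(x, y). f x y) (x, y)) (at 0)"
    using assms has_derivative_ddir[of "\<lambda>(x, y). f x y" "(x, y)" "(0, 1)"] Basis_real_prod
    by (auto simp: real_analytic_on_def)
  then show ?thesis
    unfolding d2_eq_ddir[symmetric] using DERIV_translate[of "\<lambda>t. f x t"] by simp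
qed

lemma d1_d2_commute:
  assumes "real_analytic_on (\<lambda>(x, y). f x y) D" and "(x, y) \<in> D"
  shows "d1 (d2 f) x y = d2 (d1 f) x y"
proof -
  have "ddir (1, 0) (ddir (0, 1) (\<lambda>(x, y). f x y)) (x, y) = ddir (0, 1) (ddir (1, 0) (\<lambda>(x, y). f x y)) (x, y)"
    using assms by (intro ddir_commute Basis_real_prod) (auto simp: real_analytic_on_def)
  then show ?thesis
    unfolding d1_eq_ddir[symmetric] d2_eq_ddir[symmetric] by simp
qed

section \<open>Partial derivatives on the jet space\<close>

text \<open>Differentiability in each coordinate separately, not jointly: this is all that
  \<open>pd\<close> looks at.\<close>

definition has_grad :: "(jet \<Rightarrow> real) \<Rightarrow> (coord \<Rightarrow> real) \<Rightarrow> jet \<Rightarrow> bool" where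
  "has_grad f g j \<longleftrightarrow> (\<forall>c. ((\<lambda>t. f (j(c := t))) has_real_derivative g c) (at (j c)))"

lemma has_gradI:
  "(\<And>c. ((\<lambda>t. f (j(c := t))) has_real_derivative g c) (at (j c))) \<Longrightarrow> has_grad f g j"
  by (simp add: has_grad_def)

lemma has_gradD: "has_grad f g j \<Longrightarrow> ((\<lambda>t. f (j(c := t))) has_real_derivative g c) (at (j c))"
  by (simp add: has_grad_def)

lemma pd_has_grad: "has_grad f g j \<Longrightarrow> pd c f j = g c"
  unfolding pd_def by (intro DERIV_imp_deriv has_gradD)

lemma has_grad_const: "has_grad (\<lambda>_. k) (\<lambda>_. 0) j"
  by (simp add: has_grad_def)

lemma has_grad_coord: "has_grad (\<lambda>j. j k) (\<lambda>c. if c = k then 1 else 0) j"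
proof (rule has_gradI)
  show "((\<lambda>t. (j(c := t)) k) has_real_derivative (if c = k then 1 else 0)) (at (j c))" for c
    by (cases "c = k") auto
qed

lemma has_grad_add:
  "has_grad f g j \<Longrightarrow> has_grad f' g' j \<Longrightarrow> has_grad (\<lambda>j. f j + f' j) (\<lambda>c. g c + g' c) j"
  by (simp add: has_grad_def DERIV_add)

lemma has_grad_diff:
  "has_grad f g j \<Longrightarrow> has_grad f' g' j \<Longrightarrow> has_grad (\<lambda>j. f j - f' j) (\<lambda>c. g c - g' c) j"
  by (simp add: has_grad_def DERIV_diff)

lemma has_grad_mult:
  assumes "has_grad f g j" and "has_grad f' g' j"
  shows "has_grad (\<lambda>j. f j * f' j) (\<lambda>c. g c * f' j + g' c * f j) j"
proof (rule has_gradI)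
  fix c
  from DERIV_mult[OF has_gradD[OF assms(1), of c] has_gradD[OF assms(2), of c]]
  show "((\<lambda>t. f (j(c := t)) * f' (j(c := t))) has_real_derivative g c * f' j + g' c * f j) (at (j c))"
    by simp
qed

lemmas has_grad_intros = has_grad_const has_grad_coord has_grad_add has_grad_diff has_grad_mult

definition base_point :: "jet \<Rightarrow> real \<times> real \<times> real \<times> real" where
  "base_point j = (j X, j Y, j W, j E)"

text \<open>Prolongation coefficients agree with explicit polynomials only over
  \<open>\<Omega>\<close>. Since \<open>\<Omega>\<close> is open, varying one coordinate slightly
  stays over it, so the agreement survives a further differentiation.\<close>

lemma has_grad_cong:
  assumes "open \<Omega>" and "base_point j \<in> \<Omega>"
    and eq: "\<And>j. base_point j \<in> \<Omega> \<Longrightarrow> f j = f' j"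
    and "has_grad f g j"
  shows "has_grad f' g j"
proof (rule has_gradI)
  fix c
  have "isCont (\<lambda>t. (j(c := t)) k) (j c)" for k
    by (cases "c = k") auto
  then have "isCont (\<lambda>t. base_point (j(c := t))) (j c)"
    unfolding base_point_def by (intro continuous_Pair)
  then have "\<forall>\<^sub>F t in nhds (j c). base_point (j(c := t)) \<in> \<Omega>"
    using assms(1,2)
    unfolding continuous_at_open eventually_nhds
    by (metis fun_upd_triv)
  then have ev: "\<forall>\<^sub>F t in nhds (j c). f (j(c := t)) = f' (j(c := t))"
    by (rule eventually_mono) (rule eq)
  show "((\<lambda>t. f' (j(c := t))) has_real_derivative g c) (at (j c))"
    using has_gradD[OF assms(4), of c] DERIV_cong_ev[OF refl ev refl, of "g c"] by blast
qed

type_synonym base_fun = "real \<Rightarrow> real \<Rightarrow> real \<Rightarrow> real \<Rightarrow> real"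

definition has_partials ::
  "(real \<times> real \<times> real \<times> real) set \<Rightarrow> base_fun \<Rightarrow> base_fun \<Rightarrow> base_fun \<Rightarrow> base_fun \<Rightarrow> base_fun \<Rightarrow> bool"
  where
  "has_partials \<Omega> f fx fy fw fe \<longleftrightarrow> (\<forall>(x, y, w, e)\<in>\<Omega>.
     ((\<lambda>t. f t y w e) has_real_derivative fx x y w e) (at x) \<and>
     ((\<lambda>t. f x t w e) has_real_derivative fy x y w e) (at y) \<and>
     ((\<lambda>t. f x y t e) has_real_derivative fw x y w e) (at w) \<and>
     ((\<lambda>t. f x y w t) has_real_derivative fe x y w e) (at e))"

definition partials_grad :: "base_fun \<Rightarrow> base_fun \<Rightarrow> base_fun \<Rightarrow> base_fun \<Rightarrow> jet \<Rightarrow> coord \<Rightarrow> real" where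
  "partials_grad fx fy fw fe j c =
     (case c of X \<Rightarrow> lift fx j | Y \<Rightarrow> lift fy j | W \<Rightarrow> lift fw j | E \<Rightarrow> lift fe j | _ \<Rightarrow> 0)"

lemma partials_grad_simps [simp]:
  "partials_grad fx fy fw fe j X = lift fx j"
  "partials_grad fx fy fw fe j Y = lift fy j"
  "partials_grad fx fy fw fe j W = lift fw j"
  "partials_grad fx fy fw fe j E = lift fe j"
  "partials_grad fx fy fw fe j Wx = 0"
  "partials_grad fx fy fw fe j Wy = 0"
  "partials_grad fx fy fw fe j Ex = 0"
  "partials_grad fx fy fw fe j Ey = 0"
  "partials_grad fx fy fw fe j Wxx = 0"
  "partials_grad fx fy fw fe j Wxy = 0"
  "partials_grad fx fy fw fe j Wyy = 0"
  "partials_grad fx fy fw fe j Exx = 0"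
  "partials_grad fx fy fw fe j Exy = 0"
  "partials_grad fx fy fw fe j Eyy = 0"
  by (simp_all add: partials_grad_def)

lemma has_grad_lift:
  assumes "has_partials \<Omega> f fx fy fw fe" and "base_point j \<in> \<Omega>"
  shows "has_grad (lift f) (partials_grad fx fy fw fe j) j"
proof (rule has_gradI)
  show "((\<lambda>t. lift f (j(c := t))) has_real_derivative partials_grad fx fy fw fe j c) (at (j c))" for c
    using assms by (cases c) (auto simp: has_partials_def base_point_def lift_def)
qed

lemma Dx_has_grad:
  "has_grad f g j \<Longrightarrow> Dx f j = g X + j Wx * g W + j Ex * g E
     + j Wxx * g Wx + j Wxy * g Wy + j Exx * g Ex + j Exy * g Ey"
  by (simp add: Dx_def pd_has_grad)

lemma Dy_has_grad:
  "has_grad f g j \<Longrightarrow> Dy f j = g Y + j Wy * g W + j Ey * g E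
     + j Wxy * g Wx + j Wyy * g Wy + j Exy * g Ex + j Eyy * g Ey"
  by (simp add: Dy_def pd_has_grad)

section \<open>Prolongation formulas\<close>

abbreviation zero_fun :: base_fun where
  "zero_fun \<equiv> \<lambda>_ _ _ _. 0"

lemma lift_zero [simp]: "lift zero_fun j = 0"
  by (simp add: lift_def)

text \<open>The partial derivatives are parameters, so that explicit formulas can be supplied later.
  Mixed ones come in both orders, and their equality is not assumed here. The zero partials encode
  that \<open>\<xi>\<close> depends on \<open>x, y\<close> only and \<open>\<phi>\<close> on
  \<open>x, y, w\<close> only.\<close>

locale vector_field =
  fixes \<Omega> :: "(real \<times> real \<times> real \<times> real) set"
    and \<xi> \<xi>x \<xi>y \<xi>xx \<xi>xy \<xi>yx \<xi>yy \<phi> \<phi>x \<phi>y \<phi>w \<phi>xx \<phi>xy \<phi>yx \<phi>yy \<phi>xw \<phi>yw \<phi>wx \<phi>wy \<phi>ww :: base_fun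
  assumes open_\<Omega>: "open \<Omega>"
    and \<xi>: "has_partials \<Omega> \<xi> \<xi>x \<xi>y zero_fun zero_fun"
    and \<xi>x: "has_partials \<Omega> \<xi>x \<xi>xx \<xi>xy zero_fun zero_fun"
    and \<xi>y: "has_partials \<Omega> \<xi>y \<xi>yx \<xi>yy zero_fun zero_fun"
    and \<phi>: "has_partials \<Omega> \<phi> \<phi>x \<phi>y \<phi>w zero_fun"
    and \<phi>x: "has_partials \<Omega> \<phi>x \<phi>xx \<phi>xy \<phi>xw zero_fun"
    and \<phi>y: "has_partials \<Omega> \<phi>y \<phi>yx \<phi>yy \<phi>yw zero_fun"
    and \<phi>w: "has_partials \<Omega> \<phi>w \<phi>wx \<phi>wy \<phi>ww zero_fun"
begin

lemmas grads = has_grad_lift[OF \<xi>] has_grad_lift[OF \<xi>x] has_grad_lift[OF \<xi>y] has_grad_lift[OF \<phi>]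
  has_grad_lift[OF \<phi>x] has_grad_lift[OF \<phi>y] has_grad_lift[OF \<phi>w]

lemma prol_x_\<phi>:
  assumes "base_point j \<in> \<Omega>"
  shows "prol Dx (lift \<xi>) (\<lambda>_. 1) Wx Wy (lift \<phi>) j
    = lift \<phi>x j + j Wx * lift \<phi>w j - lift \<xi>x j * j Wx"
  by (simp add: prol_def Dx_has_grad[OF grads(1)[OF assms]] Dx_has_grad[OF grads(4)[OF assms]]
      Dx_has_grad[OF has_grad_const])

lemma prol_y_\<phi>:
  assumes "base_point j \<in> \<Omega>"
  shows "prol Dy (lift \<xi>) (\<lambda>_. 1) Wx Wy (lift \<phi>) j
    = lift \<phi>y j + j Wy * lift \<phi>w j - lift \<xi>y j * j Wx"
  by (simp add: prol_def Dy_has_grad[OF grads(1)[OF assms]] Dy_has_grad[OF grads(4)[OF assms]]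
      Dy_has_grad[OF has_grad_const])

lemma prol_xx_\<phi>:
  assumes j: "base_point j \<in> \<Omega>"
  shows "prol Dx (lift \<xi>) (\<lambda>_. 1) Wxx Wxy (prol Dx (lift \<xi>) (\<lambda>_. 1) Wx Wy (lift \<phi>)) j
    = lift \<phi>xx j + j Wx * (lift \<phi>xw j + lift \<phi>wx j) + (j Wx)\<^sup>2 * lift \<phi>ww j + lift \<phi>w j * j Wxx
      - lift \<xi>xx j * j Wx - 2 * lift \<xi>x j * j Wxx"
proof -
  have "has_grad (\<lambda>j. lift \<phi>x j + j Wx * lift \<phi>w j - lift \<xi>x j * j Wx)
     (\<lambda>c. partials_grad \<phi>xx \<phi>xy \<phi>xw zero_fun j c
        + ((if c = Wx then 1 else 0) * lift \<phi>w j + partials_grad \<phi>wx \<phi>wy \<phi>ww zero_fun j c * j Wx)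
        - (partials_grad \<xi>xx \<xi>xy zero_fun zero_fun j c * j Wx + (if c = Wx then 1 else 0) * lift \<xi>x j)) j"
    by (intro has_grad_intros grads j)
  \<comment> \<open>The second prolongation differentiates the first one, which is replaced here by
    its explicit form over \<open>\<Omega>\<close>.\<close>
  note g = has_grad_cong[OF open_\<Omega> j prol_x_\<phi>[symmetric] this]
  show ?thesis
    by (subst prol_def)
       (simp add: Dx_has_grad[OF g] Dx_has_grad[OF grads(1)[OF j]]
        Dx_has_grad[OF has_grad_const] algebra_simps power2_eq_square)
qed

lemma prol_yy_\<phi>:
  assumes j: "base_point j \<in> \<Omega>"
  shows "prol Dy (lift \<xi>) (\<lambda>_. 1) Wxy Wyy (prol Dy (lift \<xi>) (\<lambda>_. 1) Wx Wy (lift \<phi>)) j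
    = lift \<phi>yy j + j Wy * (lift \<phi>yw j + lift \<phi>wy j) + (j Wy)\<^sup>2 * lift \<phi>ww j + lift \<phi>w j * j Wyy
      - lift \<xi>yy j * j Wx - 2 * lift \<xi>y j * j Wxy"
proof -
  have "has_grad (\<lambda>j. lift \<phi>y j + j Wy * lift \<phi>w j - lift \<xi>y j * j Wx)
     (\<lambda>c. partials_grad \<phi>yx \<phi>yy \<phi>yw zero_fun j c
        + ((if c = Wy then 1 else 0) * lift \<phi>w j + partials_grad \<phi>wx \<phi>wy \<phi>ww zero_fun j c * j Wy)
        - (partials_grad \<xi>yx \<xi>yy zero_fun zero_fun j c * j Wx + (if c = Wx then 1 else 0) * lift \<xi>y j)) j"
    by (intro has_grad_intros grads j)
  note g = has_grad_cong[OF open_\<Omega> j prol_y_\<phi>[symmetric] this]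
  show ?thesis
    by (subst prol_def)
       (simp add: Dy_has_grad[OF g] Dy_has_grad[OF grads(1)[OF j]]
        Dy_has_grad[OF has_grad_const] algebra_simps power2_eq_square)
qed

lemma has_grad_F:
  "has_grad F (\<lambda>c. (if c = Wx then 1 else 0) * j Ex + (if c = Ex then 1 else 0) * j Wx
     + ((if c = Wy then 1 else 0) * j Ey + (if c = Ey then 1 else 0) * j Wy)
     + ((if c = E then 1 else 0) * (j Wxx + j Wyy)
        + ((if c = Wxx then 1 else 0) + (if c = Wyy then 1 else 0)) * j E) + 0) j"
  unfolding F_def[abs_def] by (intro has_grad_intros)

end

text \<open>\<open>\<psi>\<close> is split off because uniqueness needs the same
  \<open>\<xi>\<close> and \<open>\<phi>\<close> together with an unknown
  \<open>\<psi>\<close>.\<close>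

locale full_vector_field = vector_field +
  fixes \<psi> \<psi>x \<psi>y \<psi>w \<psi>e :: base_fun
  assumes \<psi>: "has_partials \<Omega> \<psi> \<psi>x \<psi>y \<psi>w \<psi>e"
begin

lemma prol_x_\<psi>:
  assumes "base_point j \<in> \<Omega>"
  shows "prol Dx (lift \<xi>) (\<lambda>_. 1) Ex Ey (lift \<psi>) j
    = lift \<psi>x j + j Wx * lift \<psi>w j + j Ex * lift \<psi>e j - lift \<xi>x j * j Ex"
  by (simp add: prol_def Dx_has_grad[OF grads(1)[OF assms]] Dx_has_grad[OF has_grad_lift[OF \<psi> assms]]
      Dx_has_grad[OF has_grad_const])

lemma prol_y_\<psi>:
  assumes "base_point j \<in> \<Omega>"
  shows "prol Dy (lift \<xi>) (\<lambda>_. 1) Ex Ey (lift \<psi>) j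
    = lift \<psi>y j + j Wy * lift \<psi>w j + j Ey * lift \<psi>e j - lift \<xi>y j * j Ex"
  by (simp add: prol_def Dy_has_grad[OF grads(1)[OF assms]] Dy_has_grad[OF has_grad_lift[OF \<psi> assms]]
      Dy_has_grad[OF has_grad_const])

text \<open>\<open>F\<close> contains neither \<open>Wxy\<close> nor second derivatives of
  \<open>E\<close>, so of the second-order coefficients only those of \<open>Wxx\<close> and
  \<open>Wyy\<close> survive.\<close>

lemma pr2_F:
  assumes j: "base_point j \<in> \<Omega>"
  shows "pr2 (lift \<xi>) (\<lambda>_. 1) (lift \<phi>) (lift \<psi>) F j =
    (lift \<phi>x j + j Wx * lift \<phi>w j - lift \<xi>x j * j Wx) * j Ex
    + (lift \<psi>x j + j Wx * lift \<psi>w j + j Ex * lift \<psi>e j - lift \<xi>x j * j Ex) * j Wx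
    + (lift \<phi>y j + j Wy * lift \<phi>w j - lift \<xi>y j * j Wx) * j Ey
    + (lift \<psi>y j + j Wy * lift \<psi>w j + j Ey * lift \<psi>e j - lift \<xi>y j * j Ex) * j Wy
    + lift \<psi> j * (j Wxx + j Wyy)
    + j E * ((lift \<phi>xx j + j Wx * (lift \<phi>xw j + lift \<phi>wx j) + (j Wx)\<^sup>2 * lift \<phi>ww j
              + lift \<phi>w j * j Wxx - lift \<xi>xx j * j Wx - 2 * lift \<xi>x j * j Wxx)
           + (lift \<phi>yy j + j Wy * (lift \<phi>yw j + lift \<phi>wy j) + (j Wy)\<^sup>2 * lift \<phi>ww j
              + lift \<phi>w j * j Wyy - lift \<xi>yy j * j Wx - 2 * lift \<xi>y j * j Wxy))"
  unfolding pr2_def pr1_def prol_xx_\<phi>[OF j] prol_yy_\<phi>[OF j] prol_x_\<phi>[OF j] prol_y_\<phi>[OF j]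
    prol_x_\<psi>[OF j] prol_y_\<psi>[OF j] pd_has_grad[OF has_grad_F]
  by (simp add: algebra_simps)

lemma has_grad_\<phi>1:
  assumes j: "base_point j \<in> \<Omega>"
  shows "has_grad (\<phi>1 \<xi> \<phi>) (\<lambda>c. partials_grad \<xi>x \<xi>y zero_fun zero_fun j c * j Wx
      + (if c = Wx then 1 else 0) * lift \<xi> j + (if c = Wy then 1 else 0)
      - partials_grad \<phi>x \<phi>y \<phi>w zero_fun j c) j"
  unfolding \<phi>1_def[abs_def] by (intro has_grad_intros grads j)

lemma has_grad_\<phi>2:
  assumes j: "base_point j \<in> \<Omega>"
  shows "has_grad (\<phi>2 \<xi> \<psi>) (\<lambda>c. partials_grad \<xi>x \<xi>y zero_fun zero_fun j c * j Ex
      + (if c = Ex then 1 else 0) * lift \<xi> j + (if c = Ey then 1 else 0)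
      - partials_grad \<psi>x \<psi>y \<psi>w \<psi>e j c) j"
  unfolding \<phi>2_def[abs_def] by (intro has_grad_intros grads j has_grad_lift[OF \<psi>])

lemma Dx_\<phi>1:
  "base_point j \<in> \<Omega> \<Longrightarrow> Dx (\<phi>1 \<xi> \<phi>) j
     = lift \<xi>x j * j Wx - lift \<phi>x j - j Wx * lift \<phi>w j + j Wxx * lift \<xi> j + j Wxy"
  by (simp add: Dx_has_grad[OF has_grad_\<phi>1])

lemma Dy_\<phi>1:
  "base_point j \<in> \<Omega> \<Longrightarrow> Dy (\<phi>1 \<xi> \<phi>) j
     = lift \<xi>y j * j Wx - lift \<phi>y j - j Wy * lift \<phi>w j + j Wxy * lift \<xi> j + j Wyy"
  by (simp add: Dy_has_grad[OF has_grad_\<phi>1])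

lemma Dx_\<phi>2:
  "base_point j \<in> \<Omega> \<Longrightarrow> Dx (\<phi>2 \<xi> \<psi>) j
     = lift \<xi>x j * j Ex - lift \<psi>x j - j Wx * lift \<psi>w j - j Ex * lift \<psi>e j + j Exx * lift \<xi> j + j Exy"
  by (simp add: Dx_has_grad[OF has_grad_\<phi>2])

lemma Dy_\<phi>2:
  "base_point j \<in> \<Omega> \<Longrightarrow> Dy (\<phi>2 \<xi> \<psi>) j
     = lift \<xi>y j * j Ex - lift \<psi>y j - j Wy * lift \<psi>w j - j Ey * lift \<psi>e j + j Exy * lift \<xi> j + j Eyy"
  by (simp add: Dy_has_grad[OF has_grad_\<phi>2])

text \<open>The prolonged field maps \<open>\<phi>1\<close> to a multiple of itself, so this
  invariance condition holds automatically where \<open>\<phi>1 = 0\<close>. The condition for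
  \<open>\<phi>2\<close> is settled in the same way.\<close>

lemma pr1_\<phi>1:
  assumes j: "base_point j \<in> \<Omega>"
  shows "pr1 (lift \<xi>) (\<lambda>_. 1) (lift \<phi>) (lift \<psi>) (\<phi>1 \<xi> \<phi>) j = lift \<phi>w j * \<phi>1 \<xi> \<phi> j"
  unfolding pr1_def prol_x_\<phi>[OF j] prol_y_\<phi>[OF j] pd_has_grad[OF has_grad_\<phi>1[OF j]]
  by (simp add: \<phi>1_def algebra_simps)

lemma pr1_\<phi>2:
  assumes j: "base_point j \<in> \<Omega>"
  shows "pr1 (lift \<xi>) (\<lambda>_. 1) (lift \<phi>) (lift \<psi>) (\<phi>2 \<xi> \<psi>) j
     = lift \<psi>w j * \<phi>1 \<xi> \<phi> j + lift \<psi>e j * \<phi>2 \<xi> \<psi> j"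
  unfolding pr1_def prol_x_\<psi>[OF j] prol_y_\<psi>[OF j] pd_has_grad[OF has_grad_\<phi>2[OF j]]
  by (simp add: \<phi>1_def \<phi>2_def algebra_simps)

end

section \<open>The algebraic identities\<close>

text \<open>The relation for \<open>\<phi>x\<close> reflects the shape
  \<open>u_y (A^2 + 1) S(u, w)\<close> together with \<open>u_x = A u_y\<close>. Under it and the
  asserted \<open>\<psi>\<close>, all terms in \<open>r\<close> and all higher powers of
  \<open>p\<close> cancel. Writing \<open>\<xi>x\<close> through \<open>\<tau>\<close> avoids
  division by \<open>\<xi>\<^sup>2 + 1\<close>.\<close>

lemma remainder_identity:
  fixes \<xi> :: real
  assumes "\<xi>x = \<xi> * \<xi>y + \<tau> * (\<xi>\<^sup>2 + 1)" and "\<sigma> = 2 * \<tau>"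
    and "\<phi>x = \<xi> * \<phi>y + (\<xi>y + \<xi> * \<sigma>) * \<phi>"
    and "\<phi>wx = \<phi>xw" and "\<phi>wy = \<phi>yw"
    and "\<phi>xw = \<xi> * \<phi>yw + (\<xi>y + \<xi> * \<sigma>) * \<phi>w"
    and "\<psi>x = e * (\<sigma>x - \<phi>xw)" and "\<psi>y = e * (\<sigma>y - \<phi>yw)" and "\<psi>w = - (e * \<phi>ww)" and "\<psi>e = \<sigma> - \<phi>w"
    and "wy = \<phi> - \<xi> * p" and "ey = e * (\<sigma> - \<phi>w) - \<xi> * r"
  shows "(\<phi>x + p * \<phi>w - \<xi>x * p) * r
    + (\<psi>x + p * \<psi>w + r * \<psi>e - \<xi>x * r) * p
    + (\<phi>y + wy * \<phi>w - \<xi>y * p) * ey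
    + (\<psi>y + wy * \<psi>w + ey * \<psi>e - \<xi>y * r) * wy
    + e * (\<phi>xx + p * (\<phi>xw + \<phi>wx) + p\<^sup>2 * \<phi>ww - \<xi>xx * p
      + \<phi>yy + wy * (\<phi>yw + \<phi>wy) + wy\<^sup>2 * \<phi>ww - \<xi>yy * p
      - 2 * \<xi>y * (\<phi>x + p * \<phi>w - \<xi>x * p))
    + e * \<sigma> * (\<phi>y + wy * \<phi>w - \<xi>y * p - \<xi> * (\<phi>x + p * \<phi>w - \<xi>x * p))
    = e * (\<phi>xx + \<phi>yy + \<phi> * \<phi>yw + (\<sigma> - \<phi>w + \<sigma>) * \<phi>y + \<phi> * (\<sigma>\<^sup>2 + \<sigma>y) - (2 * \<xi>y + \<sigma> * \<xi>) * \<phi>x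
        + p * (\<sigma>x - \<xi> * \<sigma>y - \<xi>xx - \<xi>yy - \<xi> * \<sigma>\<^sup>2 - 2 * \<xi>y * \<sigma> + 2 * \<xi>x * \<xi>y + \<sigma> * \<xi> * \<xi>x))"
  \<comment> \<open>Dependent quantities are eliminated first and \<open>\<xi>x\<close>,
    \<open>\<sigma>\<close> last, which leaves a plain polynomial identity.\<close>
  unfolding assms(4,5,7-12) unfolding assms(6,3) unfolding assms(1,2) by algebra

text \<open>The last factor is the coefficient of \<open>p\<close> in
  \<open>remainder_identity\<close>. The hypotheses on \<open>axx\<close> and \<open>axy\<close> are
  the derivatives of the one on \<open>ax\<close>.\<close>

lemma A_equation_normalised:
  fixes a :: real
  assumes ax: "ax = a * ay + \<tau> * (a\<^sup>2 + 1)" and \<sigma>: "\<sigma> = 2 * \<tau>"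
    and axx: "axx = \<tau>x * (a\<^sup>2 + 1) + \<tau> * (2 * a * ax) + ax * ay + a * axy" and \<sigma>x: "\<sigma>x = 2 * \<tau>x"
    and axy: "axy = \<tau>y * (a\<^sup>2 + 1) + \<tau> * (2 * a * ay) + ay\<^sup>2 + a * ayy" and \<sigma>y: "\<sigma>y = 2 * \<tau>y"
  shows "(a ^ 4 - 1) * axx + 4 * a * (a\<^sup>2 + 1) * axy - (a ^ 4 - 1) * ayy
        - 2 * a * (a\<^sup>2 - 3) * ax\<^sup>2 - 4 * (3 * a\<^sup>2 - 1) * ax * ay + 2 * a * (a\<^sup>2 - 3) * ay\<^sup>2
     = - (a\<^sup>2 + 1)\<^sup>2 *
       (\<sigma>x - a * \<sigma>y - axx - ayy - a * \<sigma>\<^sup>2 - 2 * ay * \<sigma> + 2 * ax * ay + \<sigma> * a * ax)"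
  unfolding axx unfolding axy \<sigma>x \<sigma>y \<sigma> unfolding ax by algebra

text \<open>Here \<open>v\<close> stands for \<open>u_y\<close>, and the left side is
  \<open>n\<close> times the part of \<open>remainder_identity\<close> free of \<open>p\<close>. It
  is compared with the equation for \<open>S\<close> coefficient by coefficient in the derivatives
  of \<open>S\<close>.\<close>

lemma S_equation_normalised:
  fixes a :: real
  assumes ax: "ax = a * ay + \<tau> * (a\<^sup>2 + 1)" and \<sigma>: "\<sigma> = 2 * \<tau>"
    and axy: "axy = \<tau>y * (a\<^sup>2 + 1) + \<tau> * (2 * a * ay) + ay\<^sup>2 + a * ayy" and \<sigma>y: "\<sigma>y = 2 * \<tau>y"
    and ux: "vx = ay * v + a * vy" and uxx: "uxx = ax * v + a * vx"
    and vxx: "vxx = axy * v + ay * vx + ax * vy + a * vxy" and vxy: "vxy = ayy * v + 2 * ay * vy + a * vyy"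
    and n: "n = a\<^sup>2 + 1"
    and g: "g = v * n" and gx: "gx = vx * n + v * (2 * a * ax)" and gy: "gy = vy * n + v * (2 * a * ay)"
    and gxx: "gxx = vxx * n + 2 * vx * (2 * a * ax) + v * (2 * ax\<^sup>2 + 2 * a * axx)"
    and gyy: "gyy = vyy * n + 2 * vy * (2 * a * ay) + v * (2 * ay\<^sup>2 + 2 * a * ayy)"
    and \<phi>: "\<phi> = g * S" and \<phi>x: "\<phi>x = gx * S + g * (Su * (a * v))" and \<phi>y: "\<phi>y = gy * S + g * (Su * v)"
    and \<phi>yw: "\<phi>yw = gy * Sw + g * (Suw * v)"
    and \<phi>xx: "\<phi>xx = gxx * S + 2 * gx * (Su * (a * v)) + g * (Suu * (a * v)\<^sup>2 + Su * uxx)"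
    and \<phi>yy: "\<phi>yy = gyy * S + 2 * gy * (Su * v) + g * (Suu * v\<^sup>2 + Su * vy)"
  shows "n * (\<phi>xx + \<phi>yy + \<phi> * \<phi>yw + (\<sigma> - g * Sw + \<sigma>) * \<phi>y + \<phi> * (\<sigma>\<^sup>2 + \<sigma>y) - (2 * ay + \<sigma> * a) * \<phi>x)
    = v ^ 3 * n ^ 3 * (Suw * S - Su * Sw + Suu)
      + v * n * (3 * vy * n\<^sup>2 + v * (5 * ax + 3 * a ^ 3 * ay + 3 * a\<^sup>2 * ax + a * ay)) * Su
      + (vyy * n ^ 3 + vy * n * ((3 * a\<^sup>2 + 5) * ax + (3 * a\<^sup>2 + 1) * a * ay)
        + v * (2 * a * n * axx + n * (a\<^sup>2 + 3) * axy + a * n\<^sup>2 * ayy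
                - 2 * (a\<^sup>2 - 3) * ax\<^sup>2 + 2 * a * (a\<^sup>2 - 3) * ax * ay + (a ^ 4 - 1) * ay\<^sup>2)) * S"
proof -
  \<comment> \<open>This is \<open>n\<close> times the coefficient of \<open>S\<close>, matching
    \<open>q3\<close>; \<open>m1\<close> is the one of \<open>Su\<close>, matching
    \<open>q2\<close>.\<close>
  have m0: "n * (gxx + gyy + 2 * \<sigma> * gy + g * (\<sigma>\<^sup>2 + \<sigma>y) - (2 * ay + \<sigma> * a) * gx)
    = vyy * n ^ 3 + vy * n * ((3 * a\<^sup>2 + 5) * ax + (3 * a\<^sup>2 + 1) * a * ay)
        + v * (2 * a * n * axx + n * (a\<^sup>2 + 3) * axy + a * n\<^sup>2 * ayy
                - 2 * (a\<^sup>2 - 3) * ax\<^sup>2 + 2 * a * (a\<^sup>2 - 3) * ax * ay + (a ^ 4 - 1) * ay\<^sup>2)"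
    unfolding gxx gyy gx gy g vxx unfolding ux vxy unfolding axy \<sigma>y \<sigma> unfolding ax n by algebra
  have m1: "n * (2 * gx * a * v + g * uxx + 2 * gy * v + g * vy + 2 * \<sigma> * g * v - (2 * ay + \<sigma> * a) * g * a * v)
    = v * n * (3 * vy * n\<^sup>2 + v * (5 * ax + 3 * a ^ 3 * ay + 3 * a\<^sup>2 * ax + a * ay))"
    unfolding gx gy g uxx unfolding ux \<sigma> unfolding ax n by algebra
  \<comment> \<open>The terms \<open>g * gy * S * Sw\<close> from \<open>\<phi> * \<phi>yw\<close>
    and from \<open>g * Sw * \<phi>y\<close> cancel, leaving the bilinear expression
    \<open>Suw * S - Su * Sw\<close>.\<close>
  have eq: "\<phi>xx + \<phi>yy + \<phi> * \<phi>yw + (\<sigma> - g * Sw + \<sigma>) * \<phi>y + \<phi> * (\<sigma>\<^sup>2 + \<sigma>y) - (2 * ay + \<sigma> * a) * \<phi>x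
     = (gxx + gyy + 2 * \<sigma> * gy + g * (\<sigma>\<^sup>2 + \<sigma>y) - (2 * ay + \<sigma> * a) * gx) * S
       + (2 * gx * a * v + g * uxx + 2 * gy * v + g * vy + 2 * \<sigma> * g * v - (2 * ay + \<sigma> * a) * g * a * v) * Su
       + g * v\<^sup>2 * (a\<^sup>2 + 1) * Suu + g\<^sup>2 * v * (Suw * S - Su * Sw)"
    unfolding \<phi>xx \<phi>yy \<phi>yw \<phi>y \<phi>x \<phi> by algebra
  have "n * (\<phi>xx + \<phi>yy + \<phi> * \<phi>yw + (\<sigma> - g * Sw + \<sigma>) * \<phi>y + \<phi> * (\<sigma>\<^sup>2 + \<sigma>y) - (2 * ay + \<sigma> * a) * \<phi>x)
     = n * (gxx + gyy + 2 * \<sigma> * gy + g * (\<sigma>\<^sup>2 + \<sigma>y) - (2 * ay + \<sigma> * a) * gx) * S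
       + n * (2 * gx * a * v + g * uxx + 2 * gy * v + g * vy + 2 * \<sigma> * g * v - (2 * ay + \<sigma> * a) * g * a * v) * Su
       + n * (g * v\<^sup>2 * n * Suu + g\<^sup>2 * v * (Suw * S - Su * Sw))"
    unfolding eq unfolding n by algebra
  also have "n * (g * v\<^sup>2 * n * Suu + g\<^sup>2 * v * (Suw * S - Su * Sw)) = v ^ 3 * n ^ 3 * (Suw * S - Su * Sw + Suu)"
    unfolding g by algebra
  finally show ?thesis
    unfolding m0 m1 by simp
qed

section \<open>The invariance condition on the invariant surfaces\<close>

text \<open>With \<open>wxy\<close> and \<open>wyy\<close> eliminated,
  \<open>- 2 * \<xi>x * wxx - 2 * \<xi>y * wxy\<close> becomes
  \<open>- \<sigma> * (wxx + wyy)\<close> plus terms without second derivatives, because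
  \<open>\<xi>x - \<xi> * \<xi>y = \<tau> * (\<xi>\<^sup>2 + 1)\<close>. This is the origin of
  \<open>\<sigma>\<close>.\<close>

lemma restricted_identity:
  fixes \<xi> :: real
  assumes "wxy = \<phi>x + p * \<phi>w - \<xi>x * p - \<xi> * wxx"
    and "wyy = \<phi>y + wy * \<phi>w - \<xi>y * p - \<xi> * wxy"
    and "\<xi>x = \<xi> * \<xi>y + \<tau> * (\<xi>\<^sup>2 + 1)" and "\<sigma> = 2 * \<tau>"
  shows "a + \<psi> * (wxx + wyy)
      + e * ((b + \<phi>w * wxx - c - 2 * \<xi>x * wxx) + (b' + \<phi>w * wyy - c' - 2 * \<xi>y * wxy))
    = a + e * (b - c + b' - c' - 2 * \<xi>y * (\<phi>x + p * \<phi>w - \<xi>x * p))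
      + e * \<sigma> * (\<phi>y + wy * \<phi>w - \<xi>y * p - \<xi> * (\<phi>x + p * \<phi>w - \<xi>x * p))
      + (\<psi> + e * \<phi>w - e * \<sigma>) * (wxx + wyy)"
  unfolding assms by algebra

context full_vector_field
begin

text \<open>What is left of the prolonged \<open>F\<close>, apart from a multiple of
  \<open>Wxx + Wyy\<close>, after elimination of \<open>Wxy\<close> and \<open>Wyy\<close>. Nothing
  is assumed about the form of \<open>\<psi>\<close>.\<close>

definition remainder :: "real \<Rightarrow> jet \<Rightarrow> real" where
  "remainder \<sigma> j =
    (lift \<phi>x j + j Wx * lift \<phi>w j - lift \<xi>x j * j Wx) * j Ex
    + (lift \<psi>x j + j Wx * lift \<psi>w j + j Ex * lift \<psi>e j - lift \<xi>x j * j Ex) * j Wx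
    + (lift \<phi>y j + j Wy * lift \<phi>w j - lift \<xi>y j * j Wx) * j Ey
    + (lift \<psi>y j + j Wy * lift \<psi>w j + j Ey * lift \<psi>e j - lift \<xi>y j * j Ex) * j Wy
    + j E * (lift \<phi>xx j + j Wx * (lift \<phi>xw j + lift \<phi>wx j) + (j Wx)\<^sup>2 * lift \<phi>ww j - lift \<xi>xx j * j Wx
           + lift \<phi>yy j + j Wy * (lift \<phi>yw j + lift \<phi>wy j) + (j Wy)\<^sup>2 * lift \<phi>ww j - lift \<xi>yy j * j Wx
           - 2 * lift \<xi>y j * (lift \<phi>x j + j Wx * lift \<phi>w j - lift \<xi>x j * j Wx))
    + j E * \<sigma> * (lift \<phi>y j + j Wy * lift \<phi>w j - lift \<xi>y j * j Wx
           - lift \<xi> j * (lift \<phi>x j + j Wx * lift \<phi>w j - lift \<xi>x j * j Wx))"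

lemma pr2_F_restricted:
  assumes j: "base_point j \<in> \<Omega>" and D: "Dx (\<phi>1 \<xi> \<phi>) j = 0" "Dy (\<phi>1 \<xi> \<phi>) j = 0"
    and \<tau>: "lift \<xi>x j = lift \<xi> j * lift \<xi>y j + \<tau> * ((lift \<xi> j)\<^sup>2 + 1)"
  shows "pr2 (lift \<xi>) (\<lambda>_. 1) (lift \<phi>) (lift \<psi>) F j
    = remainder (2 * \<tau>) j + (lift \<psi> j + j E * lift \<phi>w j - j E * (2 * \<tau>)) * (j Wxx + j Wyy)"
proof -
  have 1: "j Wxy = lift \<phi>x j + j Wx * lift \<phi>w j - lift \<xi>x j * j Wx - lift \<xi> j * j Wxx"
    using D(1) unfolding Dx_\<phi>1[OF j] by (simp add: algebra_simps)
  have 2: "j Wyy = lift \<phi>y j + j Wy * lift \<phi>w j - lift \<xi>y j * j Wx - lift \<xi> j * j Wxy"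
    using D(2) unfolding Dy_\<phi>1[OF j] by (simp add: algebra_simps)
  show ?thesis
    unfolding pr2_F[OF j] restricted_identity[OF 1 2 \<tau> refl] remainder_def
    by (simp only: add_diff_eq add.assoc)
qed

text \<open>Over each base point \<open>p\<close> and \<open>r\<close> can be prescribed freely: the
  remaining coordinates are solved from the constraints. The invariance condition thus becomes an
  identity in \<open>p\<close> and \<open>r\<close>.\<close>

lemma nonclassical_restricted:
  assumes gen: "nonclassical_generator \<Omega> \<xi> \<phi> \<psi>" and pt: "(x, y, w, e) \<in> \<Omega>" and "e \<noteq> 0"
    and \<tau>: "\<xi>x x y w e = \<xi> x y w e * \<xi>y x y w e + \<tau> * ((\<xi> x y w e)\<^sup>2 + 1)"
  obtains j where "j X = x" "j Y = y" "j W = w" "j E = e" "j Wx = p" "j Ex = r"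
    "j Wy = \<phi> x y w e - \<xi> x y w e * p" "j Ey = \<psi> x y w e - \<xi> x y w e * r"
    "remainder (2 * \<tau>) j = (\<psi> x y w e + e * \<phi>w x y w e - e * (2 * \<tau>)) * (1 + p * r + j Wy * j Ey) / e"
proof -
  define \<xi>0 where "\<xi>0 = \<xi> x y w e"
  define wy where "wy = \<phi> x y w e - \<xi>0 * p"
  define ey where "ey = \<psi> x y w e - \<xi>0 * r"
  define dx where "dx = \<phi>x x y w e + p * \<phi>w x y w e - \<xi>x x y w e * p"
  define dy where "dy = \<phi>y x y w e + wy * \<phi>w x y w e - \<xi>y x y w e * p"
  define N where "N = 1 + p * r + wy * ey"
  define \<kappa> where "\<kappa> = - (N / e)"
  \<comment> \<open>The solution of \<open>wxx + wyy = \<kappa>\<close> once \<open>wxy\<close> and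
    \<open>wyy\<close> are expressed through \<open>wxx\<close>.\<close>
  define wxx where "wxx = (\<kappa> - dy + \<xi>0 * dx) / (\<xi>0\<^sup>2 + 1)"
  define wxy where "wxy = dx - \<xi>0 * wxx"
  define wyy where "wyy = dy - \<xi>0 * wxy"
  define exy where "exy = - (\<xi>x x y w e * r - \<psi>x x y w e - p * \<psi>w x y w e - r * \<psi>e x y w e)"
  define eyy where "eyy = - (\<xi>y x y w e * r - \<psi>y x y w e - wy * \<psi>w x y w e - ey * \<psi>e x y w e + exy * \<xi>0)"
  \<comment> \<open>\<open>Exx\<close> is a free choice, set to 0; \<open>exy\<close> and
    \<open>eyy\<close> are solved accordingly.\<close>
  define j where "j c = (case c of X \<Rightarrow> x | Y \<Rightarrow> y | W \<Rightarrow> w | E \<Rightarrow> e | Wx \<Rightarrow> p | Wy \<Rightarrow> wy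
     | Ex \<Rightarrow> r | Ey \<Rightarrow> ey | Wxx \<Rightarrow> wxx | Wxy \<Rightarrow> wxy | Wyy \<Rightarrow> wyy | Exx \<Rightarrow> 0 | Exy \<Rightarrow> exy | Eyy \<Rightarrow> eyy)" for c
  have j_simps [simp]: "j X = x" "j Y = y" "j W = w" "j E = e" "j Wx = p" "j Wy = wy" "j Ex = r" "j Ey = ey"
    "j Wxx = wxx" "j Wxy = wxy" "j Wyy = wyy" "j Exx = 0" "j Exy = exy" "j Eyy = eyy"
    by (simp_all add: j_def)
  have lift_j [simp]: "lift f j = f x y w e" for f
    by (simp add: lift_def)
  have bp: "base_point j \<in> \<Omega>"
    using pt by (simp add: base_point_def)
  have "\<xi>0\<^sup>2 + 1 \<noteq> 0"
    by (smt (verit) zero_le_power2)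
  then have "wxx * (\<xi>0\<^sup>2 + 1) = \<kappa> - dy + \<xi>0 * dx"
    by (simp add: wxx_def)
  then have \<kappa>: "wxx + wyy = \<kappa>"
    unfolding wyy_def wxy_def by (simp add: algebra_simps power2_eq_square)
  have zero: "F j = 0" "\<phi>1 \<xi> \<phi> j = 0" "\<phi>2 \<xi> \<psi> j = 0"
    "Dx (\<phi>1 \<xi> \<phi>) j = 0" "Dy (\<phi>1 \<xi> \<phi>) j = 0" "Dx (\<phi>2 \<xi> \<psi>) j = 0" "Dy (\<phi>2 \<xi> \<psi>) j = 0"
  proof -
    show "F j = 0"
      using \<open>e \<noteq> 0\<close> by (simp add: F_def \<kappa>) (simp add: \<kappa>_def N_def)
    show "\<phi>1 \<xi> \<phi> j = 0" "\<phi>2 \<xi> \<psi> j = 0"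
      by (simp_all add: \<phi>1_def \<phi>2_def wy_def ey_def \<xi>0_def)
    show "Dx (\<phi>1 \<xi> \<phi>) j = 0" "Dy (\<phi>1 \<xi> \<phi>) j = 0"
      by (simp_all add: Dx_\<phi>1[OF bp] Dy_\<phi>1[OF bp] wxy_def wyy_def dx_def dy_def \<xi>0_def[symmetric] algebra_simps)
    show "Dx (\<phi>2 \<xi> \<psi>) j = 0" "Dy (\<phi>2 \<xi> \<psi>) j = 0"
      by (simp_all add: Dx_\<phi>2[OF bp] Dy_\<phi>2[OF bp] exy_def eyy_def \<xi>0_def[symmetric] algebra_simps)
  qed
  have "(j X, j Y, j W, j E) \<in> \<Omega>"
    using pt by simp
  then have "pr2 (lift \<xi>) (\<lambda>_. 1) (lift \<phi>) (lift \<psi>) F j = 0"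
    using gen zero unfolding nonclassical_generator_def by blast
  then have "remainder (2 * \<tau>) j + (\<psi> x y w e + e * \<phi>w x y w e - e * (2 * \<tau>)) * \<kappa> = 0"
    using pr2_F_restricted[OF bp zero(4,5), of \<tau>] \<tau> by (simp add: \<kappa>)
  then have "remainder (2 * \<tau>) j = (\<psi> x y w e + e * \<phi>w x y w e - e * (2 * \<tau>)) * N / e"
    by (simp add: \<kappa>_def)
  then show thesis
    using that[of j] by (simp add: N_def wy_def ey_def \<xi>0_def)
qed

text \<open>The coefficient of \<open>w\<^sub>x E\<^sub>x\<close> in the invariance condition.\<close>

lemma nonclassical_\<psi>_homogeneous:
  assumes gen: "nonclassical_generator \<Omega> \<xi> \<phi> \<psi>" and pt: "(x, y, w, e) \<in> \<Omega>" and "e \<noteq> 0"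
  shows "\<psi>e x y w e = \<psi> x y w e / e"
proof -
  define n where "n = (\<xi> x y w e)\<^sup>2 + 1"
  define \<tau> where "\<tau> = (\<xi>x x y w e - \<xi> x y w e * \<xi>y x y w e) / n"
  have n: "n \<noteq> 0"
    unfolding n_def by (smt (verit) zero_le_power2)
  then have \<tau>: "\<xi>x x y w e = \<xi> x y w e * \<xi>y x y w e + \<tau> * ((\<xi> x y w e)\<^sup>2 + 1)"
    by (simp add: \<tau>_def n_def)
  define K where "K = (\<psi> x y w e + e * \<phi>w x y w e - e * (2 * \<tau>)) / e"
  define wy where "wy p = \<phi> x y w e - \<xi> x y w e * p" for p
  define ey where "ey r = \<psi> x y w e - \<xi> x y w e * r" for r
  define R where "R p r =
    (\<phi>x x y w e + p * \<phi>w x y w e - \<xi>x x y w e * p) * r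
    + (\<psi>x x y w e + p * \<psi>w x y w e + r * \<psi>e x y w e - \<xi>x x y w e * r) * p
    + (\<phi>y x y w e + wy p * \<phi>w x y w e - \<xi>y x y w e * p) * ey r
    + (\<psi>y x y w e + wy p * \<psi>w x y w e + ey r * \<psi>e x y w e - \<xi>y x y w e * r) * wy p
    + e * (\<phi>xx x y w e + p * (\<phi>xw x y w e + \<phi>wx x y w e) + p\<^sup>2 * \<phi>ww x y w e - \<xi>xx x y w e * p
         + \<phi>yy x y w e + wy p * (\<phi>yw x y w e + \<phi>wy x y w e) + (wy p)\<^sup>2 * \<phi>ww x y w e - \<xi>yy x y w e * p
         - 2 * \<xi>y x y w e * (\<phi>x x y w e + p * \<phi>w x y w e - \<xi>x x y w e * p))
    + e * (2 * \<tau>) * (\<phi>y x y w e + wy p * \<phi>w x y w e - \<xi>y x y w e * p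
         - \<xi> x y w e * (\<phi>x x y w e + p * \<phi>w x y w e - \<xi>x x y w e * p))" for p r
  have R: "R p r = K * (1 + p * r + wy p * ey r)" for p r
  proof -
    obtain j where j: "j X = x" "j Y = y" "j W = w" "j E = e" "j Wx = p" "j Ex = r"
      "j Wy = wy p" "j Ey = ey r"
      "remainder (2 * \<tau>) j = (\<psi> x y w e + e * \<phi>w x y w e - e * (2 * \<tau>)) * (1 + p * r + j Wy * j Ey) / e"
      unfolding wy_def ey_def by (rule nonclassical_restricted[OF gen pt \<open>e \<noteq> 0\<close> \<tau>])
    have "lift f j = f x y w e" for f
      using j by (simp add: lift_def)
    then have "remainder (2 * \<tau>) j = R p r"
      unfolding remainder_def R_def using j(1-8) by simp
    then show ?thesis
      using j(7-9) by (simp add: K_def)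
  qed
  \<comment> \<open>This mixed difference cancels every monomial that is even in \<open>p\<close> or
    in \<open>r\<close>, and leaves four times the coefficient of \<open>p * r\<close>.\<close>
  have "R 1 1 - R 1 (-1) - R (-1) 1 + R (-1) (-1)
     = 4 * (n * \<phi>w x y w e + n * \<psi>e x y w e - 2 * (\<xi>x x y w e - \<xi> x y w e * \<xi>y x y w e))"
    unfolding R_def wy_def ey_def n_def by (simp add: algebra_simps power2_eq_square)
  also have "\<dots> = 4 * n * (\<phi>w x y w e + \<psi>e x y w e - 2 * \<tau>)"
    by (simp add: \<tau> n_def algebra_simps)
  finally have "4 * n * (\<phi>w x y w e + \<psi>e x y w e - 2 * \<tau>)
      = K * (1 + 1 * 1 + wy 1 * ey 1) - K * (1 + 1 * (-1) + wy 1 * ey (-1))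
        - K * (1 + (-1) * 1 + wy (-1) * ey 1) + K * (1 + (-1) * (-1) + wy (-1) * ey (-1))"
    unfolding R by simp
  also have "\<dots> = 4 * n * K"
    unfolding wy_def ey_def n_def by (simp add: algebra_simps power2_eq_square)
  finally have "\<phi>w x y w e + \<psi>e x y w e - 2 * \<tau> = K"
    using n by simp
  moreover have "K = \<psi> x y w e / e + \<phi>w x y w e - 2 * \<tau>"
    using \<open>e \<noteq> 0\<close> by (simp add: K_def field_simps)
  ultimately show ?thesis
    by simp
qed

text \<open>The case \<open>p = r = 0\<close>. The 1 on the right-hand side is the inhomogeneous
  term of \<open>F\<close>.\<close>

lemma nonclassical_constant_coefficient:
  assumes gen: "nonclassical_generator \<Omega> \<xi> \<phi> \<psi>" and pt: "(x, y, w, e) \<in> \<Omega>" and "e \<noteq> 0"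
    and \<tau>: "\<xi>x x y w e = \<xi> x y w e * \<xi>y x y w e + \<tau> * ((\<xi> x y w e)\<^sup>2 + 1)"
  shows "\<phi>y x y w e * \<psi> x y w e + \<phi> x y w e * \<phi>w x y w e * \<psi> x y w e
    + (\<psi>y x y w e + \<phi> x y w e * \<psi>w x y w e + \<psi> x y w e * \<psi>e x y w e) * \<phi> x y w e
    + e * (\<phi>xx x y w e + \<phi>yy x y w e + \<phi> x y w e * (\<phi>yw x y w e + \<phi>wy x y w e)
         + (\<phi> x y w e)\<^sup>2 * \<phi>ww x y w e - 2 * \<xi>y x y w e * \<phi>x x y w e)
    + e * (2 * \<tau>) * (\<phi>y x y w e + \<phi> x y w e * \<phi>w x y w e - \<xi> x y w e * \<phi>x x y w e)
    = (\<psi> x y w e + e * \<phi>w x y w e - e * (2 * \<tau>)) * (1 + \<phi> x y w e * \<psi> x y w e) / e"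
proof -
  obtain j where j: "j X = x" "j Y = y" "j W = w" "j E = e" "j Wx = 0" "j Ex = 0"
    "j Wy = \<phi> x y w e - \<xi> x y w e * 0" "j Ey = \<psi> x y w e - \<xi> x y w e * 0"
    "remainder (2 * \<tau>) j = (\<psi> x y w e + e * \<phi>w x y w e - e * (2 * \<tau>)) * (1 + 0 * 0 + j Wy * j Ey) / e"
    by (rule nonclassical_restricted[OF gen pt \<open>e \<noteq> 0\<close> \<tau>])
  have "lift f j = f x y w e" for f
    using j by (simp add: lift_def)
  then show ?thesis
    using j(9) j(1-8) unfolding remainder_def by (simp add: algebra_simps)
qed

text \<open>Along an interval of values of \<open>E\<close>, the homogeneity turns the constant coefficient of the
  invariance condition into a polynomial of degree one in \<open>E\<close>, which forces its constant term
  to vanish; that term is the asserted formula.\<close>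

lemma nonclassical_\<psi>_unique:
  assumes gen: "nonclassical_generator \<Omega> \<xi> \<phi> \<psi>" and pt: "(x, y, w, e) \<in> \<Omega>"
    and nz: "\<And>x y w e. (x, y, w, e) \<in> \<Omega> \<Longrightarrow> e \<noteq> 0"
    and \<tau>: "\<xi>x x y w e = \<xi> x y w e * \<xi>y x y w e + \<tau> * ((\<xi> x y w e)\<^sup>2 + 1)"
    and indep: "\<And>f x y w e e'. f \<in> {\<xi>, \<xi>x, \<xi>y, \<phi>, \<phi>x, \<phi>y, \<phi>w, \<phi>xx, \<phi>yy, \<phi>yw, \<phi>wy, \<phi>ww} \<Longrightarrow>
        f x y w e = f x y w e'"
  shows "\<psi> x y w e = e * (2 * \<tau> - \<phi>w x y w e)"
proof -
  \<comment> \<open>A product box in \<open>\<Omega>\<close> lets the four coordinates vary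
    independently.\<close>
  obtain S1 T1 where 1: "open S1" "open T1" "x \<in> S1" "(y, w, e) \<in> T1" "S1 \<times> T1 \<subseteq> \<Omega>"
    using open_\<Omega> pt by (auto elim: open_prod_elim)
  obtain S2 T2 where 2: "open S2" "open T2" "y \<in> S2" "(w, e) \<in> T2" "S2 \<times> T2 \<subseteq> T1"
    using 1(2,4) by (auto elim: open_prod_elim)
  obtain S3 T3 where 3: "open S3" "open T3" "w \<in> S3" "e \<in> T3" "S3 \<times> T3 \<subseteq> T2"
    using 2(2,4) by (auto elim: open_prod_elim)
  obtain \<delta> where \<delta>: "\<delta> > 0" "ball e \<delta> \<subseteq> T3"
    using 3(2,4) openE by blast
  have box: "(x', y', w', e') \<in> \<Omega>" if "x' \<in> S1" "y' \<in> S2" "w' \<in> S3" "e' \<in> ball e \<delta>" for x' y' w' e'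
    using that 1(5) 2(5) 3(5) \<delta>(2) by blast
  \<comment> \<open>The quotient of \<open>\<psi>\<close> by \<open>E\<close> has zero derivative
    along the interval. Neighbouring \<open>x', y', w'\<close> are included so that the partial
    derivatives of \<open>\<psi>\<close> in \<open>y\<close> and \<open>w\<close> scale in the same
    way.\<close>
  have hom: "\<psi> x' y' w' e' = e' / e * \<psi> x' y' w' e"
    if p: "x' \<in> S1" "y' \<in> S2" "w' \<in> S3" "e' \<in> ball e \<delta>" for x' y' w' e'
  proof -
    have "\<psi> x' y' w' e' / e' = \<psi> x' y' w' e / e"
    proof (rule has_field_derivative_zero_constant[of "ball e \<delta>" "\<lambda>t. \<psi> x' y' w' t / t", THEN exE])
      fix t assume t: "t \<in> ball e \<delta>"
      have pt': "(x', y', w', t) \<in> \<Omega>"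
        by (rule box[OF p(1-3) t])
      then have "t \<noteq> 0"
        by (rule nz)
      have "((\<lambda>t. \<psi> x' y' w' t) has_real_derivative \<psi> x' y' w' t / t) (at t)"
        using \<psi> pt' nonclassical_\<psi>_homogeneous[OF gen pt' \<open>t \<noteq> 0\<close>] unfolding has_partials_def by auto
      from DERIV_divide[OF this DERIV_ident \<open>t \<noteq> 0\<close>]
      have "((\<lambda>t. \<psi> x' y' w' t / t) has_real_derivative 0) (at t)"
        using \<open>t \<noteq> 0\<close> by simp
      then show "((\<lambda>t. \<psi> x' y' w' t / t) has_real_derivative 0) (at t within ball e \<delta>)"
        by (rule DERIV_subset) simp
    next
      fix c assume "\<forall>t\<in>ball e \<delta>. \<psi> x' y' w' t / t = c"
      then show ?thesis
        using p(4) \<delta>(1) by simp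
    qed simp
    moreover have "e' \<noteq> 0"
      using nz box[OF p] by blast
    ultimately show ?thesis
      by (simp add: field_simps)
  qed
  have pt_in: "x \<in> S1" "y \<in> S2" "w \<in> S3" "e \<in> ball e \<delta>"
    using 1 2 3 \<delta> by auto
  have e0: "e \<noteq> 0"
    using nz pt by blast
  define h where "h = \<psi> x y w e / e"
  define hy where "hy = \<psi>y x y w e / e"
  define hw where "hw = \<psi>w x y w e / e"
  \<comment> \<open>The coefficient of \<open>t\<close> in the constant-coefficient identity at
    \<open>E = t\<close>, after \<open>\<psi>\<close> and its partials in \<open>y\<close> and
    \<open>w\<close> have been written as \<open>t\<close> times their quotients by
    \<open>e\<close>.\<close>
  define M where "M = \<phi>y x y w e * h + \<phi> x y w e * \<phi>w x y w e * h
      + (hy + \<phi> x y w e * hw + h * h) * \<phi> x y w e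
      + (\<phi>xx x y w e + \<phi>yy x y w e + \<phi> x y w e * (\<phi>yw x y w e + \<phi>wy x y w e)
         + (\<phi> x y w e)\<^sup>2 * \<phi>ww x y w e - 2 * \<xi>y x y w e * \<phi>x x y w e)
      + 2 * \<tau> * (\<phi>y x y w e + \<phi> x y w e * \<phi>w x y w e - \<xi> x y w e * \<phi>x x y w e)
      - (h + \<phi>w x y w e - 2 * \<tau>) * (\<phi> x y w e * h)"
  have lin: "t * M = h + \<phi>w x y w e - 2 * \<tau>" if t: "t \<in> ball e \<delta>" for t
  proof -
    have pt': "(x, y, w, t) \<in> \<Omega>"
      by (rule box[OF pt_in(1-3) t])
    then have t0: "t \<noteq> 0"
      by (rule nz)
    have \<psi>t: "\<psi> x y w t = t * h"
      using hom[OF pt_in(1-3) t] by (simp add: h_def)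
    have \<psi>et: "\<psi>e x y w t = h"
      using nonclassical_\<psi>_homogeneous[OF gen pt' t0] \<psi>t t0 by simp
    have "((\<lambda>s. t / e * \<psi> x s w e) has_real_derivative t / e * \<psi>y x y w e) (at y)"
      using \<psi> pt unfolding has_partials_def by (intro DERIV_cmult) auto
    then have "((\<lambda>s. \<psi> x s w t) has_real_derivative t / e * \<psi>y x y w e) (at y)"
      by (rule has_field_derivative_transform_within_open[OF _ 2(1,3)])
         (simp add: hom[OF pt_in(1) _ pt_in(3) t])
    moreover have "((\<lambda>s. \<psi> x s w t) has_real_derivative \<psi>y x y w t) (at y)"
      using \<psi> pt' unfolding has_partials_def by auto
    ultimately have \<psi>yt: "\<psi>y x y w t = t * hy"
      using DERIV_unique unfolding hy_def by fastforce
    have "((\<lambda>s. t / e * \<psi> x y s e) has_real_derivative t / e * \<psi>w x y w e) (at w)"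
      using \<psi> pt unfolding has_partials_def by (intro DERIV_cmult) auto
    then have "((\<lambda>s. \<psi> x y s t) has_real_derivative t / e * \<psi>w x y w e) (at w)"
      by (rule has_field_derivative_transform_within_open[OF _ 3(1,3)])
         (simp add: hom[OF pt_in(1,2) _ t])
    moreover have "((\<lambda>s. \<psi> x y s t) has_real_derivative \<psi>w x y w t) (at w)"
      using \<psi> pt' unfolding has_partials_def by auto
    ultimately have \<psi>wt: "\<psi>w x y w t = t * hw"
      using DERIV_unique unfolding hw_def by fastforce
    have i: "\<forall>f\<in>{\<xi>, \<xi>x, \<xi>y, \<phi>, \<phi>x, \<phi>y, \<phi>w, \<phi>xx, \<phi>yy, \<phi>yw, \<phi>wy, \<phi>ww}. f x y w t = f x y w e"
      using indep by blast
    have \<tau>t: "\<xi>x x y w t = \<xi> x y w t * \<xi>y x y w t + \<tau> * ((\<xi> x y w t)\<^sup>2 + 1)"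
      using \<tau> i by simp
    note nonclassical_constant_coefficient[OF gen pt' t0 \<tau>t]
    then have *: "\<phi>y x y w e * (t * h) + \<phi> x y w e * \<phi>w x y w e * (t * h)
      + (t * hy + \<phi> x y w e * (t * hw) + t * h * h) * \<phi> x y w e
      + t * (\<phi>xx x y w e + \<phi>yy x y w e + \<phi> x y w e * (\<phi>yw x y w e + \<phi>wy x y w e)
         + (\<phi> x y w e)\<^sup>2 * \<phi>ww x y w e - 2 * \<xi>y x y w e * \<phi>x x y w e)
      + t * (2 * \<tau>) * (\<phi>y x y w e + \<phi> x y w e * \<phi>w x y w e - \<xi> x y w e * \<phi>x x y w e)
      = (t * h + t * \<phi>w x y w e - t * (2 * \<tau>)) * (1 + \<phi> x y w e * (t * h)) / t"
      unfolding \<psi>t \<psi>et \<psi>yt \<psi>wt using i by simp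
    have "(t * h + t * \<phi>w x y w e - t * (2 * \<tau>)) * (1 + \<phi> x y w e * (t * h)) / t
        = (h + \<phi>w x y w e - 2 * \<tau>) * (1 + \<phi> x y w e * (t * h))"
      using t0 by (simp add: field_simps)
    with * show ?thesis
      unfolding M_def by (simp add: algebra_simps)
  qed
  \<comment> \<open>The right side of \<open>lin\<close> does not depend on \<open>t\<close>, so two
    distinct values of \<open>t\<close> force \<open>M = 0\<close>.\<close>
  have "e * M = (e + \<delta>/2) * M"
    using lin[OF pt_in(4)] lin[of "e + \<delta>/2"] \<delta>(1) by (simp add: dist_norm)
  then have "M = 0"
    using \<delta>(1) by (simp add: algebra_simps)
  with lin[OF pt_in(4)] have "h = 2 * \<tau> - \<phi>w x y w e"
    by simp
  then show ?thesis
    using e0 by (simp add: h_def field_simps)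
qed

end

section \<open>Coefficients of the vector field\<close>

lemma real_analytic_at_compose2:
  assumes "real_analytic_at (\<lambda>(s, t). f s t) (p a, q a)"
    and "real_analytic_at p a" and "real_analytic_at q a"
  shows "real_analytic_at (\<lambda>z. f (p z) (q z)) a"
proof -
  have "real_analytic_at (\<lambda>z. (\<lambda>(s, t). f s t) (p z, q z)) a"
  proof (rule real_analytic_at_compose[where g = "\<lambda>z. (p z, q z)"])
    fix b :: "real \<times> real" assume "b \<in> Basis"
    then show "real_analytic_at (\<lambda>z. (p z, q z) \<bullet> b) a"
      using assms by (auto simp: Basis_prod_def)
  qed (rule assms)
  then show ?thesis
    by simp
qed

lemma real_analytic_at_coords:
  fixes a :: "real \<times> real \<times> real \<times> real"
  shows "real_analytic_at (\<lambda>(x, y, w, e). x) a" "real_analytic_at (\<lambda>(x, y, w, e). y) a"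
    "real_analytic_at (\<lambda>(x, y, w, e). w) a" "real_analytic_at (\<lambda>(x, y, w, e). e) a"
  by (auto intro!: real_analytic_at_linear linearI)

lemma real_analytic_on_lift_xy:
  fixes f :: "real \<Rightarrow> real \<Rightarrow> real" and \<Omega> :: "(real \<times> real \<times> real \<times> real) set"
  assumes "real_analytic_on (\<lambda>(x, y). f x y) D"
    and "\<And>x y w e. (x, y, w, e) \<in> \<Omega> \<Longrightarrow> (x, y) \<in> D"
  shows "real_analytic_on (\<lambda>(x, y, w, e). f x y) \<Omega>"
proof -
  have "real_analytic_at (\<lambda>z. f ((\<lambda>(x, y, w, e). x) z) ((\<lambda>(x, y, w, e). y) z)) (x, y, w, e)"
    if "(x, y, w, e) \<in> \<Omega>" for x y w e
    by (rule real_analytic_at_compose2[where f = f and p = "\<lambda>(x, y, w, e). x" and q = "\<lambda>(x, y, w, e). y",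
          OF _ real_analytic_at_coords(1,2)])
       (use assms that in \<open>auto simp: real_analytic_on_def\<close>)
  then show ?thesis
    by (auto simp: real_analytic_on_def case_prod_unfold)
qed

lemma real_analytic_on_lift_uw:
  fixes f u :: "real \<Rightarrow> real \<Rightarrow> real" and \<Omega> :: "(real \<times> real \<times> real \<times> real) set"
  assumes "real_analytic_on (\<lambda>(s, w). f s w) V" and "real_analytic_on (\<lambda>(x, y). u x y) D"
    and "\<And>x y w e. (x, y, w, e) \<in> \<Omega> \<Longrightarrow> (x, y) \<in> D \<and> (u x y, w) \<in> V"
  shows "real_analytic_on (\<lambda>(x, y, w, e). f (u x y) w) \<Omega>"
proof -
  have u: "real_analytic_on (\<lambda>(x, y, w, e). u x y) \<Omega>"
    using real_analytic_on_lift_xy[OF assms(2)] assms(3) by blast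
  have "real_analytic_at (\<lambda>z. f ((\<lambda>(x, y, w, e). u x y) z) ((\<lambda>(x, y, w, e). w) z)) (x, y, w, e)"
    if "(x, y, w, e) \<in> \<Omega>" for x y w e
    by (rule real_analytic_at_compose2[where f = f and p = "\<lambda>(x, y, w, e). u x y" and q = "\<lambda>(x, y, w, e). w",
          OF _ _ real_analytic_at_coords(3)])
       (use assms u that in \<open>auto simp: real_analytic_on_def\<close>)
  then show ?thesis
    by (auto simp: real_analytic_on_def case_prod_unfold)
qed

text \<open>Provides partial derivatives for a competing \<open>\<psi>'\<close> of which only
  analyticity is known.\<close>

lemma real_analytic_on_imp_has_partials:
  assumes "real_analytic_on (\<lambda>(x, y, w, e). f x y w e) \<Omega>"
  shows "has_partials \<Omega> f (\<lambda>x y w e. deriv (\<lambda>t. f t y w e) x) (\<lambda>x y w e. deriv (\<lambda>t. f x t w e) y)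
    (\<lambda>x y w e. deriv (\<lambda>t. f x y t e) w) (\<lambda>x y w e. deriv (\<lambda>t. f x y w t) e)"
proof -
  have B: "(1, 0, 0, 0) \<in> (Basis :: (real \<times> real \<times> real \<times> real) set)"
    "(0, 1, 0, 0) \<in> (Basis :: (real \<times> real \<times> real \<times> real) set)"
    "(0, 0, 1, 0) \<in> (Basis :: (real \<times> real \<times> real \<times> real) set)"
    "(0, 0, 0, 1) \<in> (Basis :: (real \<times> real \<times> real \<times> real) set)"
    by (auto simp: Basis_prod_def zero_prod_def)
  have d: "(g has_real_derivative deriv g s) (at s)"
    if "((\<lambda>t. g (s + t)) has_real_derivative d) (at 0)" for g :: "real \<Rightarrow> real" and s d
    using that unfolding DERIV_translate by (metis DERIV_imp_deriv)
  have "((\<lambda>t. f t y w e) has_real_derivative deriv (\<lambda>t. f t y w e) x) (at x) \<and>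
     ((\<lambda>t. f x t w e) has_real_derivative deriv (\<lambda>t. f x t w e) y) (at y) \<and>
     ((\<lambda>t. f x y t e) has_real_derivative deriv (\<lambda>t. f x y t e) w) (at w) \<and>
     ((\<lambda>t. f x y w t) has_real_derivative deriv (\<lambda>t. f x y w t) e) (at e)"
    if "(x, y, w, e) \<in> \<Omega>" for x y w e
  proof -
    have "real_analytic_at (\<lambda>(x, y, w, e). f x y w e) (x, y, w, e)"
      using assms that by (auto simp: real_analytic_on_def)
    note D = has_derivative_ddir[OF this B(1)] has_derivative_ddir[OF this B(2)]
      has_derivative_ddir[OF this B(3)] has_derivative_ddir[OF this B(4)]
    show ?thesis
      using D by (intro conjI; intro d) auto
  qed
  then show ?thesis
    unfolding has_partials_def by auto
qed

section \<open>Differentiation rules for the coefficients\<close>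

definition has_partials2 ::
  "(real \<times> real) set \<Rightarrow> (real \<Rightarrow> real \<Rightarrow> real) \<Rightarrow> (real \<Rightarrow> real \<Rightarrow> real) \<Rightarrow> (real \<Rightarrow> real \<Rightarrow> real) \<Rightarrow> bool"
  where
  "has_partials2 D f fx fy \<longleftrightarrow> (\<forall>(x, y)\<in>D.
     ((\<lambda>s. f s y) has_real_derivative fx x y) (at x) \<and> ((\<lambda>t. f x t) has_real_derivative fy x y) (at y))"

lemma has_partials2D:
  assumes "has_partials2 D f fx fy" and "(x, y) \<in> D"
  shows "((\<lambda>s. f s y) has_real_derivative fx x y) (at x)"
    and "((\<lambda>t. f x t) has_real_derivative fy x y) (at y)"
  using assms by (auto simp: has_partials2_def)

lemma has_partials2_analytic:
  "real_analytic_on (\<lambda>(x, y). f x y) D \<Longrightarrow> has_partials2 D f (d1 f) (d2 f)"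
  by (auto simp: has_partials2_def DERIV_d1 DERIV_d2)

lemma has_partials2_const: "has_partials2 D (\<lambda>_ _. k) (\<lambda>_ _. 0) (\<lambda>_ _. 0)"
  by (simp add: has_partials2_def)

lemma has_partials2_add:
  assumes "has_partials2 D f fx fy" and "has_partials2 D g gx gy"
  shows "has_partials2 D (\<lambda>x y. f x y + g x y) (\<lambda>x y. fx x y + gx x y) (\<lambda>x y. fy x y + gy x y)"
  unfolding has_partials2_def
  using has_partials2D[OF assms(1)] has_partials2D[OF assms(2)] by (auto intro!: DERIV_add)

lemma has_partials2_diff:
  assumes "has_partials2 D f fx fy" and "has_partials2 D g gx gy"
  shows "has_partials2 D (\<lambda>x y. f x y - g x y) (\<lambda>x y. fx x y - gx x y) (\<lambda>x y. fy x y - gy x y)"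
  unfolding has_partials2_def
  using has_partials2D[OF assms(1)] has_partials2D[OF assms(2)] by (auto intro!: DERIV_diff)

lemma has_partials2_mult:
  assumes "has_partials2 D f fx fy" and "has_partials2 D g gx gy"
  shows "has_partials2 D (\<lambda>x y. f x y * g x y)
    (\<lambda>x y. fx x y * g x y + gx x y * f x y) (\<lambda>x y. fy x y * g x y + gy x y * f x y)"
  unfolding has_partials2_def
  using has_partials2D[OF assms(1)] has_partials2D[OF assms(2)] by (auto intro!: DERIV_mult)

text \<open>This form of the quotient rule keeps \<open>f / g\<close> visible, so that the
  derivatives of \<open>\<tau>\<close> are expressed through \<open>\<tau>\<close> itself.\<close>

lemma has_partials2_divide:
  assumes "has_partials2 D f fx fy" and "has_partials2 D g gx gy"
    and nz: "\<And>x y. (x, y) \<in> D \<Longrightarrow> g x y \<noteq> 0"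
  shows "has_partials2 D (\<lambda>x y. f x y / g x y)
    (\<lambda>x y. (fx x y - f x y / g x y * gx x y) / g x y) (\<lambda>x y. (fy x y - f x y / g x y * gy x y) / g x y)"
  unfolding has_partials2_def
proof (safe)
  fix x y assume D: "(x, y) \<in> D"
  show "((\<lambda>s. f s y / g s y) has_real_derivative (fx x y - f x y / g x y * gx x y) / g x y) (at x)"
    using DERIV_divide[OF has_partials2D(1)[OF assms(1) D] has_partials2D(1)[OF assms(2) D] nz[OF D]] nz[OF D]
    by (simp add: field_simps)
  show "((\<lambda>t. f x t / g x t) has_real_derivative (fy x y - f x y / g x y * gy x y) / g x y) (at y)"
    using DERIV_divide[OF has_partials2D(2)[OF assms(1) D] has_partials2D(2)[OF assms(2) D] nz[OF D]] nz[OF D]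
    by (simp add: field_simps)
qed

lemma has_partials2_cong:
  assumes "has_partials2 D f fx fy"
    and "\<And>x y. (x, y) \<in> D \<Longrightarrow> fx x y = fx' x y" and "\<And>x y. (x, y) \<in> D \<Longrightarrow> fy x y = fy' x y"
  shows "has_partials2 D f fx' fy'"
  using assms unfolding has_partials2_def by fastforce

text \<open>A relation that holds only on an open set may still be differentiated there; this serves
  \<open>u_x = A u_y\<close> and its consequences.\<close>

lemma eq_on_open_imp_d_eq:
  assumes "open D" and "(x, y) \<in> D" and eq: "\<And>x y. (x, y) \<in> D \<Longrightarrow> f x y = g x y"
    and g: "has_partials2 D g gx gy"
  shows "d1 f x y = gx x y" and "d2 f x y = gy x y"
proof -
  obtain S T where S: "open S" "open T" "x \<in> S" "y \<in> T" "S \<times> T \<subseteq> D"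
    using assms(1,2) by (auto elim: open_prod_elim)
  have "((\<lambda>s. f s y) has_real_derivative gx x y) (at x)"
    by (rule has_field_derivative_transform_within_open[OF has_partials2D(1)[OF g assms(2)] S(1,3)])
       (use S eq in \<open>auto simp: subset_iff\<close>)
  then show "d1 f x y = gx x y"
    unfolding d1_def by (rule DERIV_imp_deriv)
  have "((\<lambda>t. f x t) has_real_derivative gy x y) (at y)"
    by (rule has_field_derivative_transform_within_open[OF has_partials2D(2)[OF g assms(2)] S(2,4)])
       (use S eq in \<open>auto simp: subset_iff\<close>)
  then show "d2 f x y = gy x y"
    unfolding d2_def by (rule DERIV_imp_deriv)
qed

lemma has_partials_xy:
  assumes "has_partials2 D f fx fy" and "\<forall>(x, y, w, e)\<in>\<Omega>. (x, y) \<in> D"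
  shows "has_partials \<Omega> (\<lambda>x y w e. f x y) (\<lambda>x y w e. fx x y) (\<lambda>x y w e. fy x y) zero_fun zero_fun"
  unfolding has_partials_def using has_partials2D[OF assms(1)] assms(2) by auto

text \<open>\<open>\<phi>\<close> has this shape, and its derivatives are sums of terms of the same
  shape, so one rule yields the partials of \<open>\<phi>x\<close>, \<open>\<phi>y\<close> and
  \<open>\<phi>w\<close> as well.\<close>

lemma has_partials_mult_comp:
  assumes g: "has_partials2 D g gx gy" and u: "has_partials2 D u ux uy" and T: "has_partials2 V T Ts Tw"
    and \<Omega>: "\<forall>(x, y, w, e)\<in>\<Omega>. (x, y) \<in> D \<and> (u x y, w) \<in> V"
  shows "has_partials \<Omega> (\<lambda>x y w e. g x y * T (u x y) w)
    (\<lambda>x y w e. gx x y * T (u x y) w + g x y * ux x y * Ts (u x y) w)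
    (\<lambda>x y w e. gy x y * T (u x y) w + g x y * uy x y * Ts (u x y) w)
    (\<lambda>x y w e. g x y * Tw (u x y) w) zero_fun"
  unfolding has_partials_def
proof safe
  fix x y w e assume "(x, y, w, e) \<in> \<Omega>"
  then have D: "(x, y) \<in> D" and V: "(u x y, w) \<in> V"
    using \<Omega> by auto
  note gd = has_partials2D[OF g D] and ud = has_partials2D[OF u D] and Td = has_partials2D[OF T V]
  have "((\<lambda>s. T (u s y) w) has_real_derivative Ts (u x y) w * ux x y) (at x)"
    using DERIV_chain2[OF Td(1) ud(1)] .
  from DERIV_mult[OF gd(1) this]
  show "((\<lambda>t. g t y * T (u t y) w) has_real_derivative gx x y * T (u x y) w + g x y * ux x y * Ts (u x y) w) (at x)"
    by (simp add: mult_ac)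
  have "((\<lambda>s. T (u x s) w) has_real_derivative Ts (u x y) w * uy x y) (at y)"
    using DERIV_chain2[OF Td(1) ud(2)] .
  from DERIV_mult[OF gd(2) this]
  show "((\<lambda>t. g x t * T (u x t) w) has_real_derivative gy x y * T (u x y) w + g x y * uy x y * Ts (u x y) w) (at y)"
    by (simp add: mult_ac)
  show "((\<lambda>t. g x y * T (u x y) t) has_real_derivative g x y * Tw (u x y) w) (at w)"
    by (rule DERIV_cmult[OF Td(2)])
qed simp

lemma has_partials_add:
  assumes "has_partials \<Omega> f fx fy fw zero_fun" and "has_partials \<Omega> g gx gy gw zero_fun"
  shows "has_partials \<Omega> (\<lambda>x y w e. f x y w e + g x y w e)
    (\<lambda>x y w e. fx x y w e + gx x y w e) (\<lambda>x y w e. fy x y w e + gy x y w e)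
    (\<lambda>x y w e. fw x y w e + gw x y w e) zero_fun"
  using assms unfolding has_partials_def
  by (auto intro!: DERIV_add DERIV_add[where D = 0 and E = 0, simplified])

lemma has_partials_diff:
  assumes "has_partials \<Omega> f fx fy fw zero_fun" and "has_partials \<Omega> g gx gy gw zero_fun"
  shows "has_partials \<Omega> (\<lambda>x y w e. f x y w e - g x y w e)
    (\<lambda>x y w e. fx x y w e - gx x y w e) (\<lambda>x y w e. fy x y w e - gy x y w e)
    (\<lambda>x y w e. fw x y w e - gw x y w e) zero_fun"
  using assms unfolding has_partials_def
  by (auto intro!: DERIV_diff DERIV_diff[where D = 0 and E = 0, simplified])

lemma has_partials_mult_e:
  assumes "has_partials \<Omega> h hx hy hw zero_fun" and "\<And>x y w e e'. h x y w e = h x y w e'"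
  shows "has_partials \<Omega> (\<lambda>x y w e. e * h x y w e) (\<lambda>x y w e. e * hx x y w e) (\<lambda>x y w e. e * hy x y w e)
    (\<lambda>x y w e. e * hw x y w e) h"
  unfolding has_partials_def
proof safe
  fix x y w e assume p: "(x, y, w, e) \<in> \<Omega>"
  show "((\<lambda>t. e * h t y w e) has_real_derivative e * hx x y w e) (at x)"
    "((\<lambda>t. e * h x t w e) has_real_derivative e * hy x y w e) (at y)"
    "((\<lambda>t. e * h x y t e) has_real_derivative e * hw x y w e) (at w)"
    using assms(1) p unfolding has_partials_def by (auto intro!: DERIV_cmult)
  have "(\<lambda>t. t * h x y w t) = (\<lambda>t. t * h x y w e)"
    using assms(2) by metis
  then show "((\<lambda>t. t * h x y w t) has_real_derivative h x y w e) (at e)"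
    using DERIV_cmult_right[OF DERIV_ident] by simp
qed

text \<open>The equation for \<open>A\<close> removes the coefficient of \<open>p\<close>, the
  equation for \<open>S\<close> the constant one. Everything is stated for real numbers, so that the
  analysis enters only when values are substituted.\<close>

lemma remainder_eq_0:
  fixes a :: real
  assumes ax: "ax = a * ay + \<tau> * (a\<^sup>2 + 1)" and \<sigma>: "\<sigma> = 2 * \<tau>"
    and axx: "axx = \<tau>x * (a\<^sup>2 + 1) + \<tau> * (2 * a * ax) + ax * ay + a * axy"
    and axy: "axy = \<tau>y * (a\<^sup>2 + 1) + \<tau> * (2 * a * ay) + ay\<^sup>2 + a * ayy"
    and vx: "vx = ay * v + a * vy"
    and vxx: "vxx = axy * v + ay * vx + ax * vy + a * vxy" and vxy: "vxy = ayy * v + 2 * ay * vy + a * vyy"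
    and n: "n = a\<^sup>2 + 1"
    and g: "g = v * n" and gx: "gx = vx * n + v * (2 * a * ax)" and gy: "gy = vy * n + v * (2 * a * ay)"
    and \<phi>: "\<phi> = g * S" and \<phi>x: "\<phi>x = gx * S + g * (Su * (a * v))" and \<phi>y: "\<phi>y = gy * S + g * (Su * v)"
    and \<phi>w: "\<phi>w = g * Sw" and \<phi>xw: "\<phi>xw = gx * Sw + g * (Suw * (a * v))"
    and \<phi>yw: "\<phi>yw = gy * Sw + g * (Suw * v)" and \<phi>wx: "\<phi>wx = \<phi>xw" and \<phi>wy: "\<phi>wy = \<phi>yw"
    and \<phi>xx: "\<phi>xx = (vxx * n + 2 * vx * (2 * a * ax) + v * (2 * ax\<^sup>2 + 2 * a * axx)) * S
      + 2 * gx * (Su * (a * v)) + g * (Suu * (a * v)\<^sup>2 + Su * (ax * v + a * vx))"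
    and \<phi>yy: "\<phi>yy = (vyy * n + 2 * vy * (2 * a * ay) + v * (2 * ay\<^sup>2 + 2 * a * ayy)) * S
      + 2 * gy * (Su * v) + g * (Suu * v\<^sup>2 + Su * vy)"
    and \<psi>: "\<psi>x = e * (2 * \<tau>x - \<phi>xw)" "\<psi>y = e * (2 * \<tau>y - \<phi>yw)" "\<psi>w = - (e * \<phi>ww)" "\<psi>e = \<sigma> - \<phi>w"
    and wy: "wy = \<phi> - a * p" and ey: "ey = e * (\<sigma> - \<phi>w) - a * r"
    and A_eq: "(a ^ 4 - 1) * axx + 4 * a * (a\<^sup>2 + 1) * axy - (a ^ 4 - 1) * ayy
        - 2 * a * (a\<^sup>2 - 3) * ax\<^sup>2 - 4 * (3 * a\<^sup>2 - 1) * ax * ay + 2 * a * (a\<^sup>2 - 3) * ay\<^sup>2 = 0"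
    and S_eq: "v ^ 3 * n ^ 3 * (Suw * S - Su * Sw + Suu)
      + v * n * (3 * vy * n\<^sup>2 + v * (5 * ax + 3 * a ^ 3 * ay + 3 * a\<^sup>2 * ax + a * ay)) * Su
      + (vyy * n ^ 3 + vy * n * ((3 * a\<^sup>2 + 5) * ax + (3 * a\<^sup>2 + 1) * a * ay)
        + v * (2 * a * n * axx + n * (a\<^sup>2 + 3) * axy + a * n\<^sup>2 * ayy
                - 2 * (a\<^sup>2 - 3) * ax\<^sup>2 + 2 * a * (a\<^sup>2 - 3) * ax * ay + (a ^ 4 - 1) * ay\<^sup>2)) * S = 0"
  shows "(\<phi>x + p * \<phi>w - ax * p) * r
    + (\<psi>x + p * \<psi>w + r * \<psi>e - ax * r) * p
    + (\<phi>y + wy * \<phi>w - ay * p) * ey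
    + (\<psi>y + wy * \<psi>w + ey * \<psi>e - ay * r) * wy
    + e * (\<phi>xx + p * (\<phi>xw + \<phi>wx) + p\<^sup>2 * \<phi>ww - axx * p
      + \<phi>yy + wy * (\<phi>yw + \<phi>wy) + wy\<^sup>2 * \<phi>ww - ayy * p
      - 2 * ay * (\<phi>x + p * \<phi>w - ax * p))
    + e * \<sigma> * (\<phi>y + wy * \<phi>w - ay * p - a * (\<phi>x + p * \<phi>w - ax * p)) = 0"
proof -
  have "a\<^sup>2 + 1 \<noteq> 0"
    by (smt (verit) zero_le_power2)
  then have P: "2 * \<tau>x - a * (2 * \<tau>y) - axx - ayy - a * \<sigma>\<^sup>2 - 2 * ay * \<sigma> + 2 * ax * ay + \<sigma> * a * ax = 0"
    using A_equation_normalised[OF ax \<sigma> axx refl axy refl] A_eq by simp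
  have M: "\<phi>xx + \<phi>yy + \<phi> * \<phi>yw + (\<sigma> - \<phi>w + \<sigma>) * \<phi>y + \<phi> * (\<sigma>\<^sup>2 + 2 * \<tau>y) - (2 * ay + \<sigma> * a) * \<phi>x = 0"
    using S_equation_normalised[OF ax \<sigma> axy refl vx refl vxx vxy n g gx gy refl refl \<phi> \<phi>x \<phi>y \<phi>yw \<phi>xx \<phi>yy]
      S_eq \<open>a\<^sup>2 + 1 \<noteq> 0\<close> by (simp add: \<phi>w n)
  \<comment> \<open>The relation required of \<open>\<phi>\<close> already holds for its factor
    \<open>g\<close>, by \<open>u_x = A u_y\<close>; \<open>S\<close> contributes only the factor
    \<open>a\<close> between its two derivatives.\<close>
  have gxy: "gx = a * gy + (ay + a * \<sigma>) * g"
    unfolding gx gy vx g n \<sigma> unfolding ax by algebra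
  have \<phi>x': "\<phi>x = a * \<phi>y + (ay + a * \<sigma>) * \<phi>"
    unfolding \<phi>x \<phi>y \<phi> gxy by algebra
  have \<phi>xw': "\<phi>xw = a * \<phi>yw + (ay + a * \<sigma>) * \<phi>w"
    unfolding \<phi>xw \<phi>yw \<phi>w gxy by algebra
  show ?thesis
    unfolding remainder_identity[OF ax \<sigma> \<phi>x' \<phi>wx \<phi>wy \<phi>xw' \<psi> wy ey] M P by simp
qed

section \<open>Existence and uniqueness of the generator\<close>

theorem proposition11:
  fixes A u S :: "real \<Rightarrow> real \<Rightarrow> real"
    and D V :: "(real \<times> real) set"
    and \<Omega> :: "(real \<times> real \<times> real \<times> real) set"
  assumes "open D" and "open V" and "open \<Omega>"
    and \<Omega>: "\<And>x y w e. (x, y, w, e) \<in> \<Omega> \<Longrightarrow> (x, y) \<in> D \<and> (u x y, w) \<in> V \<and> e \<noteq> 0"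
    and "real_analytic_on (\<lambda>(x, y). A x y) D"
    and "real_analytic_on (\<lambda>(x, y). u x y) D"
    and "real_analytic_on (\<lambda>(s, w). S s w) V"
    and A_nonconst: "\<not> (\<lambda>(x, y). A x y) constant_on D"
    and A_eq: "\<And>x y. (x, y) \<in> D \<Longrightarrow>
        ((A x y)^4 - 1) * d1 (d1 A) x y + 4 * A x y * ((A x y)^2 + 1) * d2 (d1 A) x y
        - ((A x y)^4 - 1) * d2 (d2 A) x y
        - 2 * A x y * ((A x y)^2 - 3) * (d1 A x y)^2
        - 4 * (3 * (A x y)^2 - 1) * d1 A x y * d2 A x y
        + 2 * A x y * ((A x y)^2 - 3) * (d2 A x y)^2 = 0"
    and u_eq: "\<And>x y. (x, y) \<in> D \<Longrightarrow> d1 u x y = A x y * d2 u x y"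
    and S_nonzero: "\<exists>(s, w)\<in>V. S s w \<noteq> 0"
    and S_eq: "\<And>x y w e. (x, y, w, e) \<in> \<Omega> \<Longrightarrow>
        q1 A u x y * (d2 (d1 S) (u x y) w * S (u x y) w - d1 S (u x y) w * d2 S (u x y) w
                      + d1 (d1 S) (u x y) w)
        + q2 A u x y * d1 S (u x y) w + q3 A u x y * S (u x y) w = 0"
  defines "\<xi> \<equiv> (\<lambda>x y w e. A x y)"
    and "\<phi> \<equiv> (\<lambda>x y w e. d2 u x y * ((A x y)^2 + 1) * S (u x y) w)"
    and "\<psi> \<equiv> (\<lambda>x y w e. e * (- d2 u x y * ((A x y)^2 + 1) * d2 S (u x y) w
                       + 2 * (d1 A x y - A x y * d2 A x y) / ((A x y)^2 + 1)))"
  shows "nonclassical_generator \<Omega> \<xi> \<phi> \<psi> \<and>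
         (\<forall>\<psi>'. nonclassical_generator \<Omega> \<xi> \<phi> \<psi>' \<longrightarrow>
            (\<forall>(x, y, w, e)\<in>\<Omega>. \<psi>' x y w e = \<psi> x y w e))"
proof -
  note anA = assms(5) and anu = assms(6) and anS = assms(7)
  define v where "v = d2 u"
  define n where "n x y = (A x y)\<^sup>2 + 1" for x y
  \<comment> \<open>\<open>2 * \<tau>\<close> is the part of the asserted \<open>\<psi> / E\<close>
    that does not involve \<open>S\<close>.\<close>
  define \<tau> where "\<tau> x y = (d1 A x y - A x y * d2 A x y) / n x y" for x y
  have an: "real_analytic_on (\<lambda>(x, y). d1 A x y) D" "real_analytic_on (\<lambda>(x, y). d2 A x y) D"
    "real_analytic_on (\<lambda>(x, y). v x y) D" "real_analytic_on (\<lambda>(x, y). d1 v x y) D"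
    "real_analytic_on (\<lambda>(x, y). d2 v x y) D"
    "real_analytic_on (\<lambda>(s, w). d1 S s w) V" "real_analytic_on (\<lambda>(s, w). d2 S s w) V"
    unfolding v_def by (intro real_analytic_on_d1 real_analytic_on_d2 anA anu anS)+
  have n_nz: "n x y \<noteq> 0" for x y
    unfolding n_def by (smt (verit) zero_le_power2)

  have pA: "has_partials2 D A (d1 A) (d2 A)"
    and pAx: "has_partials2 D (d1 A) (d1 (d1 A)) (d2 (d1 A))"
    and pv: "has_partials2 D v (d1 v) (d2 v)"
    and pvx: "has_partials2 D (d1 v) (d1 (d1 v)) (d2 (d1 v))"
    and pS: "has_partials2 V S (d1 S) (d2 S)"
    and pSs: "has_partials2 V (d1 S) (d1 (d1 S)) (d2 (d1 S))"
    by (intro has_partials2_analytic anA anS an)+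
  \<comment> \<open>Mixed derivatives are brought to the order \<open>d2 (d1 _)\<close> used in the
    equations for \<open>A\<close> and \<open>S\<close>.\<close>
  have pAy: "has_partials2 D (d2 A) (d2 (d1 A)) (d2 (d2 A))"
    by (rule has_partials2_cong[OF has_partials2_analytic[OF an(2)]]) (simp_all add: d1_d2_commute[OF anA])
  have pvy: "has_partials2 D (d2 v) (d2 (d1 v)) (d2 (d2 v))"
    by (rule has_partials2_cong[OF has_partials2_analytic[OF an(5)]]) (simp_all add: d1_d2_commute[OF an(3)])
  have pSw: "has_partials2 V (d2 S) (d2 (d1 S)) (d2 (d2 S))"
    by (rule has_partials2_cong[OF has_partials2_analytic[OF an(7)]]) (simp_all add: d1_d2_commute[OF anS])
  \<comment> \<open>Putting \<open>A * v\<close> for \<open>d1 u\<close> makes the chain rule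
    deliver the factor \<open>a * v\<close> of \<open>remainder_eq_0\<close>.\<close>
  have pu: "has_partials2 D u (\<lambda>x y. A x y * v x y) v"
    by (rule has_partials2_cong[OF has_partials2_analytic[OF anu]]) (simp_all add: v_def u_eq)
  note pux = has_partials2_mult[OF pA pv]
  \<comment> \<open>The relation \<open>u_x = A u_y\<close> differentiated in \<open>y\<close>, with
    the mixed derivatives of \<open>u\<close> interchanged.\<close>
  have vx: "d1 v x y = d2 A x y * v x y + A x y * d2 v x y" if "(x, y) \<in> D" for x y
    using eq_on_open_imp_d_eq(2)[OF \<open>open D\<close> that _ pux, of "d1 u"] d1_d2_commute[OF anu that] u_eq
    by (simp add: v_def mult.commute)
  note pv_alt = has_partials2_add[OF has_partials2_mult[OF pAy pv] has_partials2_mult[OF pA pvy]]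
  have vxx: "d1 (d1 v) x y = d2 (d1 A) x y * v x y + d2 A x y * d1 v x y + d1 A x y * d2 v x y + A x y * d2 (d1 v) x y"
    if "(x, y) \<in> D" for x y
    using eq_on_open_imp_d_eq(1)[OF \<open>open D\<close> that vx pv_alt] by (simp add: mult.commute)
  have vxy: "d2 (d1 v) x y = d2 (d2 A) x y * v x y + 2 * d2 A x y * d2 v x y + A x y * d2 (d2 v) x y"
    if "(x, y) \<in> D" for x y
    using eq_on_open_imp_d_eq(2)[OF \<open>open D\<close> that vx pv_alt] by (simp add: mult.commute)

  have pn: "has_partials2 D n (\<lambda>x y. 2 * A x y * d1 A x y) (\<lambda>x y. 2 * A x y * d2 A x y)"
    unfolding n_def[abs_def] power2_eq_square
    by (rule has_partials2_cong[OF has_partials2_add[OF has_partials2_mult[OF pA pA] has_partials2_const]]) simp_all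
  note pnx = has_partials2_mult[OF has_partials2_mult[OF has_partials2_const[of D 2] pA] pAx]
    and pny = has_partials2_mult[OF has_partials2_mult[OF has_partials2_const[of D 2] pA] pAy]
  note p\<tau> = has_partials2_divide[OF has_partials2_diff[OF pAx has_partials2_mult[OF pA pAy]] pn n_nz,
      folded \<tau>_def]
  define g where "g x y = v x y * n x y" for x y
  note pg = has_partials2_mult[OF pv pn, folded g_def]
  note pgx = has_partials2_add[OF has_partials2_mult[OF pvx pn] has_partials2_mult[OF pnx pv]]
    and pgy = has_partials2_add[OF has_partials2_mult[OF pvy pn] has_partials2_mult[OF pny pv]]
  note pgux = has_partials2_mult[OF pg pux] and pguy = has_partials2_mult[OF pg pv]

  have \<Omega>D: "(x, y) \<in> D" and \<Omega>V: "(x, y) \<in> D \<and> (u x y, w) \<in> V" and \<Omega>e: "e \<noteq> 0"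
    if "(x, y, w, e) \<in> \<Omega>" for x y w e
    using \<Omega>[OF that] by auto
  have D_all: "\<forall>(x, y, w, e)\<in>\<Omega>. (x, y) \<in> D"
    and V_all: "\<forall>(x, y, w, e)\<in>\<Omega>. (x, y) \<in> D \<and> (u x y, w) \<in> V"
    using \<Omega> by blast+
  have \<phi>_eq: "\<phi> = (\<lambda>x y w e. g x y * S (u x y) w)"
    unfolding \<phi>_def g_def v_def n_def by simp
  note p\<xi> = has_partials_xy[OF pA D_all, folded \<xi>_def]
    and p\<xi>x = has_partials_xy[OF pAx D_all] and p\<xi>y = has_partials_xy[OF pAy D_all]
  note p\<phi> = has_partials_mult_comp[OF pg pu pS V_all, folded \<phi>_eq]
  note p\<phi>x = has_partials_add[OF has_partials_mult_comp[OF pgx pu pS V_all]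
        has_partials_mult_comp[OF pgux pu pSs V_all]]
    and p\<phi>y = has_partials_add[OF has_partials_mult_comp[OF pgy pu pS V_all]
        has_partials_mult_comp[OF pguy pu pSs V_all]]
    and p\<phi>w = has_partials_mult_comp[OF pg pu pSw V_all]
  note vf = vector_field.intro[OF \<open>open \<Omega>\<close> p\<xi> p\<xi>x p\<xi>y p\<phi> p\<phi>x p\<phi>y p\<phi>w]

  define \<tau>x where "\<tau>x x y = (d1 (d1 A) x y - (d1 A x y * d2 A x y + d2 (d1 A) x y * A x y)
      - \<tau> x y * (2 * A x y * d1 A x y)) / n x y" for x y
  define \<tau>y where "\<tau>y x y = (d2 (d1 A) x y - (d2 A x y * d2 A x y + d2 (d2 A) x y * A x y)
      - \<tau> x y * (2 * A x y * d2 A x y)) / n x y" for x y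
  \<comment> \<open>The definitions of \<open>\<tau>\<close>, \<open>\<tau>x\<close> and
    \<open>\<tau>y\<close> with denominators cleared, valid for all \<open>x, y\<close>.\<close>
  have ax: "d1 A x y = A x y * d2 A x y + \<tau> x y * ((A x y)\<^sup>2 + 1)" for x y
    using n_nz[of x y] unfolding \<tau>_def n_def by simp
  have axx: "d1 (d1 A) x y = \<tau>x x y * ((A x y)\<^sup>2 + 1) + \<tau> x y * (2 * A x y * d1 A x y)
      + d1 A x y * d2 A x y + A x y * d2 (d1 A) x y" for x y
    using n_nz[of x y] unfolding \<tau>x_def n_def[symmetric] by simp
  have axy: "d2 (d1 A) x y = \<tau>y x y * ((A x y)\<^sup>2 + 1) + \<tau> x y * (2 * A x y * d2 A x y)
      + (d2 A x y)\<^sup>2 + A x y * d2 (d2 A) x y" for x y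
    using n_nz[of x y] unfolding \<tau>y_def n_def[symmetric] by (simp add: power2_eq_square)
  have \<psi>_eq: "\<psi> = (\<lambda>x y w e. e * (2 * \<tau> x y - g x y * d2 S (u x y) w))"
    unfolding \<psi>_def \<tau>_def n_def g_def v_def by simp
  note p\<tau>' = p\<tau>[folded \<tau>x_def \<tau>y_def]
  note p\<psi> = has_partials_mult_e[OF has_partials_diff[OF has_partials_xy[OF
        has_partials2_mult[OF has_partials2_const[of D 2] p\<tau>'] D_all] p\<phi>w] refl, folded \<psi>_eq]
  note fv = full_vector_field.intro[OF vf full_vector_field_axioms.intro[OF p\<psi>]]
  have anL: "real_analytic_on (\<lambda>(x, y, w, e). A x y) \<Omega>" "real_analytic_on (\<lambda>(x, y, w, e). d1 A x y) \<Omega>"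
    "real_analytic_on (\<lambda>(x, y, w, e). d2 A x y) \<Omega>" "real_analytic_on (\<lambda>(x, y, w, e). d2 u x y) \<Omega>"
    "real_analytic_on (\<lambda>(x, y, w, e). S (u x y) w) \<Omega>" "real_analytic_on (\<lambda>(x, y, w, e). d2 S (u x y) w) \<Omega>"
    by (rule real_analytic_on_lift_xy[OF anA \<Omega>D] real_analytic_on_lift_xy[OF an(1) \<Omega>D]
        real_analytic_on_lift_xy[OF an(2) \<Omega>D] real_analytic_on_lift_xy[OF an(3)[unfolded v_def] \<Omega>D]
        real_analytic_on_lift_uw[OF anS anu \<Omega>V] real_analytic_on_lift_uw[OF an(7) anu \<Omega>V]; assumption)+
  note anL' = anL[unfolded real_analytic_on_def case_prod_unfold, rule_format]
  have nz: "(A x y)\<^sup>2 + 1 \<noteq> 0" for x y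
    using n_nz unfolding n_def .
  have gen: "nonclassical_generator \<Omega> \<xi> \<phi> \<psi>"
    unfolding nonclassical_generator_def
  proof (intro conjI allI impI)
    show "real_analytic_on (\<lambda>(x, y, w, e). \<xi> x y w e) \<Omega>"
      unfolding \<xi>_def by (rule anL)
    show "real_analytic_on (\<lambda>(x, y, w, e). \<phi> x y w e) \<Omega>"
      unfolding \<phi>_def real_analytic_on_def case_prod_unfold
      by (intro ballI real_analytic_at_mult real_analytic_at_add real_analytic_at_power
          real_analytic_at_const anL')
    show "real_analytic_on (\<lambda>(x, y, w, e). \<psi> x y w e) \<Omega>"
      unfolding \<psi>_def real_analytic_on_def case_prod_unfold
      by (intro ballI real_analytic_at_mult real_analytic_at_add real_analytic_at_diff real_analytic_at_divide
          real_analytic_at_minus real_analytic_at_power real_analytic_at_const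
          real_analytic_at_coords(4)[unfolded case_prod_unfold] anL' nz)
  next
    fix j assume j: "(j X, j Y, j W, j E) \<in> \<Omega> \<and> F j = 0 \<and>
          \<phi>1 \<xi> \<phi> j = 0 \<and> \<phi>2 \<xi> \<psi> j = 0 \<and>
          Dx (\<phi>1 \<xi> \<phi>) j = 0 \<and> Dy (\<phi>1 \<xi> \<phi>) j = 0 \<and>
          Dx (\<phi>2 \<xi> \<psi>) j = 0 \<and> Dy (\<phi>2 \<xi> \<psi>) j = 0"
    define x y w e where "x = j X" and "y = j Y" and "w = j W" and "e = j E"
    note xywe = this
    have bp: "base_point j \<in> \<Omega>"
      using j by (simp add: base_point_def)
    have pt: "(x, y, w, e) \<in> \<Omega>" and D: "(x, y) \<in> D"
      using j \<Omega>D by (auto simp: xywe)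
    show "pr1 (lift \<xi>) (\<lambda>_. 1) (lift \<phi>) (lift \<psi>) (\<phi>1 \<xi> \<phi>) j = 0"
      using full_vector_field.pr1_\<phi>1[OF fv bp] j by simp
    show "pr1 (lift \<xi>) (\<lambda>_. 1) (lift \<phi>) (lift \<psi>) (\<phi>2 \<xi> \<psi>) j = 0"
      using full_vector_field.pr1_\<phi>2[OF fv bp] j by simp
    have lift: "lift f j = f x y w e" for f
      by (simp add: lift_def xywe)
    have wy: "j Wy = \<phi> x y w e - A x y * j Wx" and ey: "j Ey = \<psi> x y w e - A x y * j Ex"
      using j unfolding \<phi>1_def \<phi>2_def lift by (simp_all add: \<xi>_def)
    have \<xi>x: "lift (\<lambda>x y w e. d1 A x y) j
        = lift \<xi> j * lift (\<lambda>x y w e. d2 A x y) j + \<tau> x y * ((lift \<xi> j)\<^sup>2 + 1)"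
      unfolding lift \<xi>_def by (rule ax)
    have S_eq': "v x y ^ 3 * n x y ^ 3 * (d2 (d1 S) (u x y) w * S (u x y) w - d1 S (u x y) w * d2 S (u x y) w
        + d1 (d1 S) (u x y) w)
      + v x y * n x y * (3 * d2 v x y * (n x y)\<^sup>2 + v x y * (5 * d1 A x y + 3 * (A x y) ^ 3 * d2 A x y
          + 3 * (A x y)\<^sup>2 * d1 A x y + A x y * d2 A x y)) * d1 S (u x y) w
      + (d2 (d2 v) x y * n x y ^ 3 + d2 v x y * n x y * ((3 * (A x y)\<^sup>2 + 5) * d1 A x y
          + (3 * (A x y)\<^sup>2 + 1) * A x y * d2 A x y)
        + v x y * (2 * A x y * n x y * d1 (d1 A) x y + n x y * ((A x y)\<^sup>2 + 3) * d2 (d1 A) x y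
          + A x y * (n x y)\<^sup>2 * d2 (d2 A) x y - 2 * ((A x y)\<^sup>2 - 3) * (d1 A x y)\<^sup>2
          + 2 * A x y * ((A x y)\<^sup>2 - 3) * d1 A x y * d2 A x y + ((A x y) ^ 4 - 1) * (d2 A x y)\<^sup>2))
        * S (u x y) w = 0"
      using S_eq[OF pt] unfolding q1_def q2_def q3_def Let_def v_def n_def .
    have D1: "Dx (\<phi>1 \<xi> \<phi>) j = 0" and D2: "Dy (\<phi>1 \<xi> \<phi>) j = 0"
      using j by auto
    \<comment> \<open>The 0 is the remainder; the factor of \<open>Wxx + Wyy\<close> vanishes
      afterwards by the form of \<open>\<psi>\<close>. The explicit instantiations name the
      variables of \<open>remainder_eq_0\<close> that occur in its premises but not in its
      conclusion.\<close>
    have "pr2 (lift \<xi>) (\<lambda>_. 1) (lift \<phi>) (lift \<psi>) F j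
      = 0 + (lift \<psi> j + e * (g x y * d2 S (u x y) w) - e * (2 * \<tau> x y)) * (j Wxx + j Wyy)"
      by (rule trans[OF full_vector_field.pr2_F_restricted[OF fv bp D1 D2 \<xi>x]],
          unfold full_vector_field.remainder_def[OF fv], unfold lift xywe(4)[symmetric] \<xi>_def,
          rule arg_cong2[where f = "(+)", OF remainder_eq_0[where \<tau> = "\<tau> x y" and \<tau>x = "\<tau>x x y"
            and \<tau>y = "\<tau>y x y" and axy = "d2 (d1 A) x y" and v = "v x y" and vx = "d1 v x y"
            and vy = "d2 v x y" and vxx = "d1 (d1 v) x y" and vxy = "d2 (d1 v) x y" and vyy = "d2 (d2 v) x y"
            and n = "n x y" and g = "g x y"
            and gx = "d1 v x y * n x y + v x y * (2 * A x y * d1 A x y)"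
            and gy = "d2 v x y * n x y + v x y * (2 * A x y * d2 A x y)"
            and S = "S (u x y) w" and Su = "d1 S (u x y) w" and Sw = "d2 S (u x y) w"
            and Suw = "d2 (d1 S) (u x y) w" and Suu = "d1 (d1 S) (u x y) w" and \<phi> = "\<phi> x y w e"] refl])
         (rule ax refl axx axy vx[OF D] vxx[OF D] vxy[OF D] n_def g_def wy A_eq[OF D] S_eq'
           | simp add: ey \<phi>_eq \<psi>_eq algebra_simps power2_eq_square; fail)+
    then show "pr2 (lift \<xi>) (\<lambda>_. 1) (lift \<phi>) (lift \<psi>) F j = 0"
      unfolding lift by (simp add: \<psi>_eq algebra_simps)
  qed
  have unique: "\<psi>' x y w e = \<psi> x y w e"
    if gen': "nonclassical_generator \<Omega> \<xi> \<phi> \<psi>'" and pt: "(x, y, w, e) \<in> \<Omega>" for \<psi>' x y w e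
  proof -
    have "real_analytic_on (\<lambda>(x, y, w, e). \<psi>' x y w e) \<Omega>"
      using gen' by (simp add: nonclassical_generator_def)
    from real_analytic_on_imp_has_partials[OF this]
    have fv': "full_vector_field_axioms \<Omega> \<psi>' (\<lambda>x y w e. deriv (\<lambda>t. \<psi>' t y w e) x) (\<lambda>x y w e. deriv (\<lambda>t. \<psi>' x t w e) y)
      (\<lambda>x y w e. deriv (\<lambda>t. \<psi>' x y t e) w) (\<lambda>x y w e. deriv (\<lambda>t. \<psi>' x y w t) e)"
      by (rule full_vector_field_axioms.intro)
    have "\<psi>' x y w e = e * (2 * \<tau> x y - g x y * d2 S (u x y) w)"
    proof (rule full_vector_field.nonclassical_\<psi>_unique[OF full_vector_field.intro[OF vf fv'] gen' pt])
      show "d1 A x y = \<xi> x y w e * d2 A x y + \<tau> x y * ((\<xi> x y w e)\<^sup>2 + 1)"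
        unfolding \<xi>_def by (rule ax)
    \<comment> \<open>What remains is \<open>E \<noteq> 0\<close> on \<open>\<Omega>\<close> and the
      fact that no expression built from \<open>\<xi>\<close> and \<open>\<phi>\<close> mentions
      \<open>E\<close>.\<close>
    qed (use \<Omega>e in \<open>auto simp: \<xi>_def \<phi>_eq\<close>)
    then show ?thesis
      by (simp add: \<psi>_eq)
  qed
  show ?thesis
  proof (intro conjI allI impI gen)
    fix \<psi>' assume "nonclassical_generator \<Omega> \<xi> \<phi> \<psi>'"
    from unique[OF this] show "\<forall>(x, y, w, e)\<in>\<Omega>. \<psi>' x y w e = \<psi> x y w e"
      by blast
  qed
qed

end
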